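(* Let $n\in\{2,3\}$ and let $V=\chi_\Omega\varphi$ be a qualitatively admissible potential on $\mathbb{R}^n$. Let $k>0$ and suppose that there exist $v,w\in L^2(\Omega)$ such that \[ (\Delta+k^2)v=0 \ \text{ in } \Omega,\qquad (\Delta+k^2(1+V))w=0 \ \text{ in } \Omega,\qquad w-v\in H^2_0(\Omega),\qquad \|v\|_{L^2(\Omega)}=1 . \] Let $x_c$ be a vertex of $\Omega$ with $\varphi(x_c)\neq0$, and suppose that $v$ and $w$ are $H^2$-smooth in a neighbourhood of $x_c$ in $\Omega$, i.e. there is $r_0>0$ such that $v,w\in H^2(B(x_c,r_0)\cap\Omega)$. Then \[ \lim_{r\to 0^+}\frac{1}{m(B(x_c,r)\cap\Omega)}\int_{B(x_c,r)\cap\Omega}|v(x)|\,dx=0 . \]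
   Context: A potential $V\in L^\infty(\mathbb{R}^n)$, $n\in\{2,3\}$, is called qualitatively admissible if $V=\chi_\Omega\varphi$, where: $\Omega\subset\mathbb{R}^n$ is a bounded open convex polygon if $n=2$, and an open cuboid (the image under a rigid motion of a product of three bounded open intervals) if $n=3$; $\chi_\Omega$ is the characteristic function of $\Omega$; $\varphi:\mathbb{R}^n\to\mathbb{C}$ is uniformly Hölder continuous of class $C^\alpha(\mathbb{R}^n)$ for some $\alpha>0$ if $n=2$ and some $\alpha>1/4$ if $n=3$; and $\varphi(x_c)\neq0$ for some vertex $x_c$ of $\Omega$. Functions are complex-valued; the partial differential equations are understood in the sense of distributions; $H^2_0(\Omega)$ is the closure of $C_c^\infty(\Omega)$ in $H^2(\Omega)$; $B(x_c,r)$ is the open ball of centre $x_c$ and radius $r$; $m$ is Lebesgue measure. *)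

theory Defs
  imports "HOL-Analysis.Analysis"
begin

section \<open>Classical partial derivatives and test functions\<close>

text \<open>Iterated partial derivatives are indexed by the list of coordinate directions in which
  one differentiates, rather than by a multi-index.\<close>

definition pderiv_dir :: "'n::finite \<Rightarrow> (real^'n \<Rightarrow> complex) \<Rightarrow> real^'n \<Rightarrow> complex" where
  "pderiv_dir i f = (\<lambda>x. frechet_derivative f (at x) (axis i 1))"

fun pderivs :: "'n::finite list \<Rightarrow> (real^'n \<Rightarrow> complex) \<Rightarrow> real^'n \<Rightarrow> complex" where
  "pderivs [] f = f"
| "pderivs (i # is) f = pderiv_dir i (pderivs is f)"

definition laplacian :: "(real^'n::finite \<Rightarrow> complex) \<Rightarrow> real^'n \<Rightarrow> complex" where
  "laplacian f = (\<lambda>x. \<Sum>i\<in>UNIV. pderivs [i, i] f x)"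

text \<open>Differentiability (hence continuity) of all iterated partial derivatives is the same as
  being of class \<open>C\<^sup>\<infinity>\<close>; without it \<^const>\<open>frechet_derivative\<close> would be an arbitrary value.\<close>

definition smooth :: "(real^'n::finite \<Rightarrow> complex) \<Rightarrow> bool" where
  "smooth f \<longleftrightarrow> (\<forall>is x. pderivs is f differentiable (at x))"

definition test_functions :: "(real^'n::finite) set \<Rightarrow> (real^'n \<Rightarrow> complex) set" where
  "test_functions U =
     {f. smooth f \<and> compact (closure {x. f x \<noteq> 0}) \<and> closure {x. f x \<noteq> 0} \<subseteq> U}"


section \<open>Square-integrable functions and Sobolev spaces on open sets\<close>

text \<open>Elements of the function spaces on \<open>U\<close> are represented by functions on the whole space;
  their values outside \<open>U\<close> play no role, and functions equal almost everywhere on \<open>U\<close> are not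
  identified.\<close>

definition L2_on :: "(real^'n::finite) set \<Rightarrow> (real^'n \<Rightarrow> complex) set" where
  "L2_on U = {f. set_borel_measurable lebesgue U f \<and>
                 set_integrable lebesgue U (\<lambda>x. (cmod (f x))\<^sup>2)}"

definition L2_norm_on :: "(real^'n::finite) set \<Rightarrow> (real^'n \<Rightarrow> complex) \<Rightarrow> real" where
  "L2_norm_on U f = sqrt (LINT x:U|lebesgue. (cmod (f x))\<^sup>2)"

definition has_weak_pderivs ::
    "(real^'n::finite) set \<Rightarrow> 'n list \<Rightarrow> (real^'n \<Rightarrow> complex) \<Rightarrow> (real^'n \<Rightarrow> complex) \<Rightarrow> bool" where
  "has_weak_pderivs U is f g \<longleftrightarrow>
     (\<forall>\<eta>\<in>test_functions U.
        (LINT x:U|lebesgue. f x * pderivs is \<eta> x) =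
        (-1) ^ length is * (LINT x:U|lebesgue. g x * \<eta> x))"

definition sobolev :: "nat \<Rightarrow> (real^'n::finite) set \<Rightarrow> (real^'n \<Rightarrow> complex) set" where
  "sobolev m U =
     {f \<in> L2_on U. \<forall>is. length is \<le> m \<longrightarrow> (\<exists>g\<in>L2_on U. has_weak_pderivs U is f g)}"

text \<open>Weak derivatives are unique up to null sets, so the choice below does not affect the
  norm.  As the norm runs over lists, a mixed derivative is counted once for each ordering of its
  directions; the result is equivalent to the norm that runs over multi-indices.\<close>

definition weak_pderivs ::
    "(real^'n::finite) set \<Rightarrow> 'n list \<Rightarrow> (real^'n \<Rightarrow> complex) \<Rightarrow> real^'n \<Rightarrow> complex" where
  "weak_pderivs U is f = (SOME g. g \<in> L2_on U \<and> has_weak_pderivs U is f g)"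

definition sobolev_norm :: "nat \<Rightarrow> (real^'n::finite) set \<Rightarrow> (real^'n \<Rightarrow> complex) \<Rightarrow> real" where
  "sobolev_norm m U f =
     sqrt (\<Sum>is | length is \<le> m. (L2_norm_on U (weak_pderivs U is f))\<^sup>2)"

definition sobolev_0 :: "nat \<Rightarrow> (real^'n::finite) set \<Rightarrow> (real^'n \<Rightarrow> complex) set" where
  "sobolev_0 m U =
     {f \<in> sobolev m U.
        \<forall>e>0. \<exists>\<eta>\<in>test_functions U. sobolev_norm m U (\<lambda>x. f x - \<eta> x) < e}"


section \<open>Distributional solutions\<close>

definition weakly_solves ::
    "(real^'n::finite) set \<Rightarrow> (real^'n \<Rightarrow> complex) \<Rightarrow> (real^'n \<Rightarrow> complex) \<Rightarrow> bool" where
  \<comment> \<open>\<open>(\<Delta> + q) u = 0\<close> in \<open>U\<close>\<close>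
  "weakly_solves U q u \<longleftrightarrow>
     (\<forall>\<eta>\<in>test_functions U.
        (LINT x:U|lebesgue. u x * (laplacian \<eta> x + q x * \<eta> x)) = 0)"


section \<open>Admissible potentials\<close>

definition convex_polygon :: "(real^'n::finite) set \<Rightarrow> bool" where
  "convex_polygon \<Omega> \<longleftrightarrow> CARD('n) = 2 \<and> \<Omega> \<noteq> {} \<and> (\<exists>P. polytope P \<and> \<Omega> = interior P)"

text \<open>Allowing improper orthogonal maps gives the same class of sets, as boxes are symmetric
  under coordinate reflections about their centres.\<close>

definition cuboid :: "(real^'n::finite) set \<Rightarrow> bool" where
  "cuboid \<Omega> \<longleftrightarrow> CARD('n) = 3 \<and> \<Omega> \<noteq> {} \<and>
     (\<exists>(T :: real^'n \<Rightarrow> real^'n) c a b. orthogonal_transformation T \<and> \<Omega> = (\<lambda>x. c + T x) ` box a b)"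

definition vertex_of :: "real^'n::finite \<Rightarrow> (real^'n) set \<Rightarrow> bool" where
  "vertex_of x \<Omega> \<longleftrightarrow> x extreme_point_of (closure \<Omega>)"

text \<open>The inequality is global; boundedness of \<open>f\<close> is not demanded.  Exponents above 1 add only
  constants to the class.\<close>

definition uniformly_holder :: "real \<Rightarrow> (real^'n::finite \<Rightarrow> complex) \<Rightarrow> bool" where
  "uniformly_holder \<alpha> f \<longleftrightarrow> (\<exists>C. \<forall>x y. cmod (f x - f y) \<le> C * dist x y powr \<alpha>)"

definition essentially_bounded :: "(real^'n::finite \<Rightarrow> complex) \<Rightarrow> bool" where
  "essentially_bounded f \<longleftrightarrow>
     f \<in> borel_measurable lebesgue \<and> (\<exists>C. AE x in lebesgue. cmod (f x) \<le> C)"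

definition qualitatively_admissible ::
    "(real^'n::finite) set \<Rightarrow> (real^'n \<Rightarrow> complex) \<Rightarrow> (real^'n \<Rightarrow> complex) \<Rightarrow> bool" where
  "qualitatively_admissible \<Omega> \<phi> V \<longleftrightarrow>
     essentially_bounded V \<and>
     V = (\<lambda>x. indicator \<Omega> x * \<phi> x) \<and>
     (convex_polygon \<Omega> \<and> (\<exists>\<alpha>>0. uniformly_holder \<alpha> \<phi>) \<or>
      cuboid \<Omega> \<and> (\<exists>\<alpha>>1/4. uniformly_holder \<alpha> \<phi>)) \<and>
     (\<exists>x. vertex_of x \<Omega> \<and> \<phi> x \<noteq> 0)"

end

theory Submission
  imports Defs
begin

text \<open>The difference \<open>u = w - v\<close> satisfies \<open>\<Delta>u = F\<close> in \<open>\<Omega>\<close> with \<open>F = - k\<^sup>2 (u + V w)\<close>. Because \<open>u\<close> lies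
  in \<open>H\<^sup>2\<^sub>0(\<Omega>)\<close>, Green's formula has no boundary terms and \<open>F\<close> is orthogonal on \<open>\<Omega>\<close> to every harmonic
  function of the whole space. In dimension at most three, a dyadic Poincare argument shows that the means of
  \<open>\<bar>u\<bar>\<close> over \<open>B(xc, r) \<inter> \<Omega>\<close> tend to \<open>0\<close> and those of \<open>\<bar>w - c\<bar>\<close> tend to \<open>0\<close> for some constant \<open>c\<close>; so \<open>F\<close> has
  the limit \<open>- k\<^sup>2 \<phi>(xc) c\<close> at \<open>xc\<close> in the mean. Testing \<open>F\<close> with the harmonic functions
  \<open>exp (s (a + \<i> b) \<bullet> (x - xc))\<close>, where \<open>\<bar>a\<bar> = \<bar>b\<bar>\<close>, \<open>a \<bullet> b = 0\<close> and \<open>a\<close> is negative on the tangent cone, and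
  letting \<open>s \<rightarrow> \<infinity>\<close> gives \<open>k\<^sup>2 \<phi>(xc) c \<integral> exp ((a + \<i> b) \<bullet> y) dy = 0\<close>, the integral being over the tangent cone.
  It does not vanish, since the cone at a vertex is simplicial. Hence \<open>c = 0\<close>, and \<open>v = w - u\<close> vanishes in the
  mean at \<open>xc\<close>.\<close>

section \<open>Smooth functions\<close>

text \<open>Everything is measured in L1, since only limits of means are needed and never continuity
  of a representative. In place of Cauchy-Schwarz stands Young's inequality with a free parameter,
  taken at each scale as about the square root of the measure. This fixes the role of the dimension
  n: second derivatives in L2 have L1 mass of order r^(n/2) at scale r, so halving r changes the
  mean gradient by about r^(1 - n/2), at worst r^(-1/2); the Poincare inequality multiplies this by
  r, and r^(1/2) is summable over dyadic r. The exponentials have no compact support and cannot be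
  put into a distributional equation. The equation is therefore first turned into an almost
  everywhere identity between F and the weak Laplacian of u, by duality with test functions;
  membership in H^2_0 then lets derivatives move onto any smooth function. At parameter s an
  exponential lives on the scale 1/s about xc, so that after multiplication by s^n only the mean
  limit of F at xc survives. The H^2 regularity of w near xc supplies the constant in that limit;
  for u the limit comes from extension by zero.\<close>

lemma smooth_coinduct:
  assumes "f \<in> S"
    and d: "\<And>f x. f \<in> S \<Longrightarrow> f differentiable (at x)"
    and c: "\<And>f i. f \<in> S \<Longrightarrow> pderiv_dir i f \<in> S"
  shows "smooth (f :: real^'n::finite \<Rightarrow> complex)"
proof -
  have "pderivs is f \<in> S" for "is"
    by (induction "is") (auto simp: assms)
  then show ?thesis unfolding smooth_def using d by blast
qed

lemma pderivs_append: "pderivs (xs @ ys) f = pderivs xs (pderivs ys f)"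
  by (induction xs) auto

lemma pderivs_single: "pderivs [i] f = pderiv_dir i f" by simp

lemma smooth_differentiable: "smooth f \<Longrightarrow> f differentiable (at x)"
  unfolding smooth_def by (metis pderivs.simps(1))

lemma smooth_pderiv_dir: "smooth f \<Longrightarrow> smooth (pderiv_dir i f)"
  unfolding smooth_def by (metis pderivs_append pderivs_single)

lemma smooth_pderivs: "smooth f \<Longrightarrow> smooth (pderivs is f)"
  unfolding smooth_def by (metis pderivs_append)

lemma smooth_continuous_on: "smooth f \<Longrightarrow> continuous_on S f"
  by (meson continuous_at_imp_continuous_on differentiable_imp_continuous_within smooth_differentiable)

lemma pderiv_dir_eq: "(f has_derivative D) (at x) \<Longrightarrow> pderiv_dir i f x = D (axis i 1)"
  unfolding pderiv_dir_def using frechet_derivative_at by metis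

lemma smooth_has_derivative:
  "smooth f \<Longrightarrow> (f has_derivative frechet_derivative f (at x)) (at x)"
  using smooth_differentiable frechet_derivative_works by blast

lemma linear_axis_sum:
  fixes D :: "real^'n::finite \<Rightarrow> complex"
  assumes "linear D"
  shows "D h = (\<Sum>i\<in>UNIV. of_real (h $ i) * D (axis i 1))"
proof -
  interpret linear D by fact
  have "h = (\<Sum>i\<in>UNIV. (h $ i) *\<^sub>R axis i 1)"
    using basis_expansion[of h] by (simp add: scalar_mult_eq_scaleR)
  then have "D h = D (\<Sum>i\<in>UNIV. (h $ i) *\<^sub>R axis i 1)" by simp
  also have "\<dots> = (\<Sum>i\<in>UNIV. of_real (h $ i) * D (axis i 1))"
    by (simp add: sum scale) (simp add: scaleR_conv_of_real)
  finally show ?thesis .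
qed

lemma frechet_pderiv_dir:
  fixes f :: "real^'n::finite \<Rightarrow> complex"
  assumes "f differentiable (at x)"
  shows "frechet_derivative f (at x) h = (\<Sum>i\<in>UNIV. of_real (h $ i) * pderiv_dir i f x)"
  unfolding pderiv_dir_def
  using linear_axis_sum[OF linear_frechet_derivative[OF assms], of h] .

lemma smooth_line_derivative:
  fixes f :: "real^'n::finite \<Rightarrow> complex"
  assumes "smooth f"
  shows "((\<lambda>t. f (x + t *\<^sub>R axis i 1)) has_vector_derivative pderiv_dir i f (x + t *\<^sub>R axis i 1)) (at t)"
proof -
  let ?D = "frechet_derivative f (at (x + t *\<^sub>R axis i 1))"
  have 1: "(f has_derivative ?D) (at (x + t *\<^sub>R axis i 1))"
    by (rule smooth_has_derivative[OF assms])
  have 2: "((\<lambda>t. x + t *\<^sub>R axis i 1) has_derivative (\<lambda>h. h *\<^sub>R axis i 1)) (at t)"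
    by (auto intro!: derivative_eq_intros)
  have "((\<lambda>t. f (x + t *\<^sub>R axis i 1)) has_derivative (\<lambda>h. ?D (h *\<^sub>R axis i 1))) (at t)"
    by (rule has_derivative_compose[OF 2 1])
  moreover have "?D (h *\<^sub>R axis i 1) = h *\<^sub>R pderiv_dir i f (x + t *\<^sub>R axis i 1)" for h
    unfolding pderiv_dir_def
    using linear_frechet_derivative[OF smooth_differentiable[OF assms]] linear_scale by blast
  ultimately show ?thesis by (simp add: has_vector_derivative_def)
qed

text \<open>The Leibniz rule turns a derivative of a product into a sum of products, so products
  alone are not closed under differentiation. The ring generated by the smooth functions is, and
  \<open>smooth_coinduct\<close> then applies to it without a formula for higher
  derivatives.\<close>

inductive_set smooth_ring :: "(real^'n::finite \<Rightarrow> complex) set" where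
  base: "smooth f \<Longrightarrow> f \<in> smooth_ring"
| add: "f \<in> smooth_ring \<Longrightarrow> g \<in> smooth_ring \<Longrightarrow> (\<lambda>x. f x + g x) \<in> smooth_ring"
| mult: "f \<in> smooth_ring \<Longrightarrow> g \<in> smooth_ring \<Longrightarrow> (\<lambda>x. f x * g x) \<in> smooth_ring"

lemma pderiv_dir_add:
  assumes "f differentiable (at x)" "g differentiable (at x)"
  shows "pderiv_dir i (\<lambda>x. f x + g x) x = pderiv_dir i f x + pderiv_dir i g x"
  using pderiv_dir_eq[OF has_derivative_add[OF assms[unfolded frechet_derivative_works]]]
  by (simp add: pderiv_dir_def)

lemma pderiv_dir_mult:
  assumes "f differentiable (at x)" "g differentiable (at x)"
  shows "pderiv_dir i (\<lambda>x. f x * g x) x = pderiv_dir i f x * g x + f x * pderiv_dir i g x"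
  using pderiv_dir_eq[OF has_derivative_mult[OF assms[unfolded frechet_derivative_works]]]
  by (simp add: pderiv_dir_def)

lemma smooth_ring_smooth: "f \<in> smooth_ring \<Longrightarrow> smooth f"
proof (erule smooth_coinduct)
  show dif: "f differentiable (at x)" if "f \<in> smooth_ring" for f :: "real^'n \<Rightarrow> complex" and x
    using that by induction (auto intro: smooth_differentiable)
  show "pderiv_dir i f \<in> smooth_ring" if "f \<in> smooth_ring" for f :: "real^'n \<Rightarrow> complex" and i
    using that
  proof induction
    case (base f) then show ?case by (auto intro: smooth_ring.base smooth_pderiv_dir)
  next
    case (add f g)
    then have "pderiv_dir i (\<lambda>x. f x + g x) = (\<lambda>x. pderiv_dir i f x + pderiv_dir i g x)"
      by (auto simp: dif intro!: pderiv_dir_add)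
    with add show ?case by (auto intro: smooth_ring.intros)
  next
    case (mult f g)
    then have "pderiv_dir i (\<lambda>x. f x * g x) = (\<lambda>x. pderiv_dir i f x * g x + f x * pderiv_dir i g x)"
      by (auto simp: dif intro!: pderiv_dir_mult)
    with mult show ?case by (auto intro: smooth_ring.intros)
  qed
qed

lemma smooth_add: "smooth f \<Longrightarrow> smooth g \<Longrightarrow> smooth (\<lambda>x. f x + g x)"
  by (blast intro: smooth_ring_smooth smooth_ring.intros)

lemma smooth_mult: "smooth f \<Longrightarrow> smooth g \<Longrightarrow> smooth (\<lambda>x. f x * g x)"
  by (blast intro: smooth_ring_smooth smooth_ring.intros)

lemma smooth_const: "smooth (\<lambda>x::real^'n::finite. c)"
proof (rule smooth_coinduct[where S="range (\<lambda>c x. c)"])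
  fix f :: "real^'n \<Rightarrow> complex" and x i assume "f \<in> range (\<lambda>c x. c)"
  then obtain c where f: "f = (\<lambda>x. c)" by auto
  then show "f differentiable (at x)" by simp
  have "pderiv_dir i f = (\<lambda>x. 0)"
    unfolding f by (rule ext) (rule pderiv_dir_eq[OF has_derivative_const])
  then show "pderiv_dir i f \<in> range (\<lambda>c x. c)" by auto
qed auto

lemma smooth_sum: "(\<And>j. j \<in> J \<Longrightarrow> smooth (f j)) \<Longrightarrow> smooth (\<lambda>x. \<Sum>j\<in>J. f j x)"
  by (induction J rule: infinite_finite_induct) (auto intro: smooth_const smooth_add)

lemma smooth_prod: "(\<And>j. j \<in> J \<Longrightarrow> smooth (f j)) \<Longrightarrow> smooth (\<lambda>x. \<Prod>j\<in>J. f j x)"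
  by (induction J rule: infinite_finite_induct) (auto intro: smooth_const smooth_mult)

lemma smooth_diff: "smooth f \<Longrightarrow> smooth g \<Longrightarrow> smooth (\<lambda>x. f x - g x)"
  using smooth_add[of f "\<lambda>x. (-1) * g x"] smooth_mult[OF smooth_const[of "-1"], of g] by simp

lemma ridge_has_derivative:
  fixes l :: "real^'n::finite \<Rightarrow> real" and q :: "real \<Rightarrow> complex"
  assumes l: "bounded_linear l" and q: "\<And>t. (q has_vector_derivative q' t) (at t)"
  shows "((\<lambda>x. q (l x + b)) has_derivative (\<lambda>h. l h *\<^sub>R q' (l x + b))) (at x)"
proof -
  have 1: "((\<lambda>x. l x + b) has_derivative l) (at x)"
    using bounded_linear_imp_has_derivative[OF l]  by (auto intro!: derivative_eq_intros)
  show ?thesis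
    using has_derivative_compose[OF 1 q[unfolded has_vector_derivative_def]] .
qed

text \<open>Differentiating \<open>q k (l x + b)\<close> only multiplies by a constant and raises
  \<open>k\<close>, so the multiples of all these functions form a class for
  \<open>smooth_coinduct\<close>. Linear forms, exponentials and the flat function all get their
  smoothness from here.\<close>

lemma smooth_ridge:
  fixes l :: "real^'n::finite \<Rightarrow> real" and q :: "nat \<Rightarrow> real \<Rightarrow> complex"
  assumes l: "bounded_linear l"
    and q: "\<And>k t. (q k has_vector_derivative q (Suc k) t) (at t)"
  shows "smooth (\<lambda>x. q 0 (l x + b))"
proof (rule smooth_coinduct[where S="{\<lambda>x. c * q k (l x + b) | c k. True}"])
  fix f :: "real^'n \<Rightarrow> complex" and x i assume "f \<in> {\<lambda>x. c * q k (l x + b) | c k. True}"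
  then obtain c k where f: "f = (\<lambda>x. c * q k (l x + b))" by auto
  have d: "(f has_derivative (\<lambda>h. c * (l h *\<^sub>R q (Suc k) (l x + b)))) (at x)" for x
    unfolding f by (rule has_derivative_mult_right[OF ridge_has_derivative[OF l q]])
  then show "f differentiable (at x)" by (auto simp: differentiable_def)
  have "pderiv_dir i f = (\<lambda>x. (c * l (axis i 1)) * q (Suc k) (l x + b))"
    by (rule ext, subst pderiv_dir_eq[OF d]) (simp add: scaleR_conv_of_real)
  then show "pderiv_dir i f \<in> {\<lambda>x. c * q k (l x + b) | c k. True}" by blast
next
  show "(\<lambda>x. q 0 (l x + b)) \<in> {\<lambda>x. c * q k (l x + b) | c k. True}"
    using mult_1[symmetric] by blast
qed

lemma smooth_linear:
  fixes l :: "real^'n::finite \<Rightarrow> real"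
  assumes "bounded_linear l"
  shows "smooth (\<lambda>x. of_real (l x))"
proof -
  define q :: "nat \<Rightarrow> real \<Rightarrow> complex" where
    "q = (\<lambda>k t. if k = 0 then of_real t else if k = 1 then 1 else 0)"
  have "((\<lambda>t. complex_of_real t) has_vector_derivative 1) (at t)" for t
    using has_vector_derivative_of_real[OF DERIV_ident, where 'a=complex and F="at t"] by simp
  then have "(q k has_vector_derivative q (Suc k) t) (at t)" for k t
    by (auto simp: q_def)
  then have "smooth (\<lambda>x. q 0 (l x + 0))"
    by (rule smooth_ridge[OF assms])
  then show ?thesis by (simp add: q_def)
qed

lemma smooth_affine:
  assumes "smooth f" "c \<noteq> 0"
  shows "smooth (\<lambda>x. f (a + c *\<^sub>R x))"
    and pderiv_dir_affine: "pderiv_dir i (\<lambda>x. f (a + c *\<^sub>R x)) = (\<lambda>x. of_real c * pderiv_dir i f (a + c *\<^sub>R x))"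
proof -
  have d: "((\<lambda>x. k * g (a + c *\<^sub>R x)) has_derivative (\<lambda>h. k * frechet_derivative g (at (a + c *\<^sub>R x)) (c *\<^sub>R h))) (at x)"
    if g: "smooth g" for k g and x :: "real^'a"
  proof -
    have "((\<lambda>x. a + c *\<^sub>R x) has_derivative (\<lambda>h. c *\<^sub>R h)) (at x)"
      by (auto intro!: derivative_eq_intros)
    from has_derivative_mult_right[OF has_derivative_compose[OF this smooth_has_derivative[OF g]], of k]
    show ?thesis .
  qed
  have p: "pderiv_dir i (\<lambda>x. k * g (a + c *\<^sub>R x)) = (\<lambda>x. (k * of_real c) * pderiv_dir i g (a + c *\<^sub>R x))"
    if g: "smooth g" for k g i
    using linear_scale[OF linear_frechet_derivative[OF smooth_differentiable[OF g]]]
    by (intro ext, subst pderiv_dir_eq[OF d[OF g]]) (simp add: pderiv_dir_def scaleR_conv_of_real)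
  show "smooth (\<lambda>x. f (a + c *\<^sub>R x))"
  proof (rule smooth_coinduct[where S="{\<lambda>x. k * g (a + c *\<^sub>R x) | k g. smooth g}"])
    show "(\<lambda>x. f (a + c *\<^sub>R x)) \<in> {\<lambda>x. k * g (a + c *\<^sub>R x) |k g. smooth g}"
      using assms by (auto intro!: exI[of _ 1] exI[of _ f])
  next
    fix h x i assume "h \<in> {\<lambda>x. k * g (a + c *\<^sub>R x) |k g. smooth g}"
    then obtain k g where h: "h = (\<lambda>x. k * g (a + c *\<^sub>R x))" and g: "smooth g" by auto
    show "h differentiable (at x)" using d[OF g] unfolding h differentiable_def by blast
    show "pderiv_dir i h \<in> {\<lambda>x. k * g (a + c *\<^sub>R x) |k g. smooth g}"
      unfolding h p[OF g] using smooth_pderiv_dir[OF g] by blast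
  qed
  show "pderiv_dir i (\<lambda>x. f (a + c *\<^sub>R x)) = (\<lambda>x. of_real c * pderiv_dir i f (a + c *\<^sub>R x))"
    using p[OF assms(1), of i 1] by simp
qed

lemma smooth_real_polynomial:
  "real_polynomial_function p \<Longrightarrow> smooth (\<lambda>x::real^'n::finite. of_real (p x))"
  by (induction rule: real_polynomial_function.induct)
     (auto intro: smooth_linear smooth_const smooth_add smooth_mult)

lemma smooth_exp_ridge:
  fixes a b :: "real^'n::finite"
  shows "smooth (\<lambda>x. exp (Complex (a \<bullet> x) (b \<bullet> x)))"
proof -
  have e: "((\<lambda>t. complex_of_real (exp t)) has_vector_derivative of_real (exp t)) (at t)" for t
    using has_vector_derivative_of_real[OF DERIV_exp, where 'a=complex] .
  have c: "((\<lambda>t. cis t) has_vector_derivative \<i> * cis t) (at t)" for t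
    unfolding cis_conv_exp has_vector_derivative_def
  proof -
    have "((\<lambda>t. \<i> * complex_of_real t) has_derivative (\<lambda>h. \<i> * of_real h)) (at t)"
      by (auto intro!: derivative_eq_intros)
    from has_derivative_compose[OF this DERIV_exp[unfolded has_field_derivative_def]]
    show "((\<lambda>t. exp (\<i> * complex_of_real t)) has_derivative (\<lambda>x. x *\<^sub>R (\<i> * exp (\<i> * complex_of_real t)))) (at t)"
      by (simp add: scaleR_conv_of_real algebra_simps)
  qed
  \<comment> \<open>\<open>exp (Complex s t)\<close> is split into \<open>exp s\<close> times
    \<open>cis t\<close>, two functions of one real variable each. Their sequences of derivatives
    are constantly \<open>exp\<close> and \<open>\<i> ^ k * cis t\<close>.\<close>
  have "smooth (\<lambda>x::real^'n. (\<lambda>k t. of_real (exp t) :: complex) (0::nat) (a \<bullet> x + 0))"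
    by (rule smooth_ridge[OF bounded_linear_inner_right]) (rule e)
  moreover have "smooth (\<lambda>x::real^'n. (\<lambda>k t. \<i> ^ k * cis t) (0::nat) (b \<bullet> x + 0))"
    by (rule smooth_ridge[OF bounded_linear_inner_right])
       (use has_vector_derivative_mult_right[OF c, of "\<i> ^ k" for k] in \<open>simp add: mult_ac\<close>)
  ultimately have "smooth (\<lambda>x. of_real (exp (a \<bullet> x)) * cis (b \<bullet> x))"
    using smooth_mult by fastforce
  moreover have "exp (Complex (a \<bullet> x) (b \<bullet> x)) = of_real (exp (a \<bullet> x)) * cis (b \<bullet> x)" for x
    by (simp add: exp_eq_polar)
  ultimately show ?thesis by simp
qed

lemma pderiv_dir_exp_ridge:
  fixes a b :: "real^'n::finite"
  shows "pderiv_dir i (\<lambda>x. exp (Complex (a \<bullet> x) (b \<bullet> x))) x = Complex (a $ i) (b $ i) * exp (Complex (a \<bullet> x) (b \<bullet> x))"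
proof -
  have C: "Complex u v = of_real u + \<i> * of_real v" for u v by (simp add: complex_eq_iff)
  have "((\<lambda>x. exp (Complex (a \<bullet> x) (b \<bullet> x))) has_derivative
     (\<lambda>h. Complex (a \<bullet> h) (b \<bullet> h) * exp (Complex (a \<bullet> x) (b \<bullet> x)))) (at x)"
  proof -
    have "((\<lambda>x. Complex (a \<bullet> x) (b \<bullet> x)) has_derivative (\<lambda>h. Complex (a \<bullet> h) (b \<bullet> h))) (at x)"
      unfolding C by (auto intro!: derivative_eq_intros)
    from has_derivative_compose[OF this DERIV_exp[unfolded has_field_derivative_def]]
    show ?thesis by (simp add: mult.commute)
  qed
  from pderiv_dir_eq[OF this, of i] show ?thesis by (simp add: inner_axis)
qed

text \<open>With \<open>s = 1 / t\<close>, the derivative of \<open>p s * exp (- s)\<close> in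
  \<open>t\<close> is \<open>s\<^sup>2 * (p s - p' s) * exp (- s)\<close>.\<close>

definition flat_exp_poly :: "nat \<Rightarrow> real poly" where
  "flat_exp_poly k = ((\<lambda>p. [:0, 0, 1:] * (p - pderiv p)) ^^ k) 1"

text \<open>The derivatives of \<open>exp (- 1 / t)\<close>, extended by zero to \<open>t \<le> 0\<close>.\<close>

definition flat_exp :: "nat \<Rightarrow> real \<Rightarrow> real" where
  "flat_exp k t = (if t > 0 then poly (flat_exp_poly k) (1 / t) * exp (- (1 / t)) else 0)"

lemma poly_mult_exp_neg_tendsto_0:
  fixes p :: "real poly"
  shows "((\<lambda>x. poly p x * exp (- x)) \<longlongrightarrow> 0) at_top"
proof (induction p)
  case 0 then show ?case by simp
next
  case (pCons a p)
  have P: "((\<lambda>x. x ^ k * exp (- x :: real)) \<longlongrightarrow> 0) at_top" for k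
    using tendsto_power_div_exp_0[of k] by (simp add: exp_minus field_simps)
  have "((\<lambda>x. (\<Sum>i\<le>degree (pCons a p). coeff (pCons a p) i * (x ^ i * exp (- x)))) \<longlongrightarrow> (\<Sum>i\<le>degree (pCons a p). coeff (pCons a p) i * 0)) at_top"
    by (intro tendsto_intros P)
  then show ?case by (simp add: poly_altdef sum_distrib_right mult.assoc del: coeff_pCons)
qed

lemma DERIV_flat_exp: "(flat_exp k has_real_derivative flat_exp (Suc k) t) (at t)"
proof -
  let ?p = "flat_exp_poly k"
  have S: "flat_exp_poly (Suc k) = [:0, 0, 1:] * (?p - pderiv ?p)"
    by (simp add: flat_exp_poly_def)
  consider "t > 0" | "t < 0" | "t = 0" by linarith
  then show ?thesis
  proof cases
    case 1
    have "((\<lambda>t. poly ?p (1 / t) * exp (- (1 / t))) has_real_derivative flat_exp (Suc k) t) (at t)"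
      unfolding flat_exp_def S using 1
      by (auto intro!: derivative_eq_intros simp: field_simps power2_eq_square)
    then show ?thesis
      by (rule has_field_derivative_transform_within_open[where S="{0<..}"]) (use 1 in \<open>auto simp: flat_exp_def\<close>)
  next
    case 2
    have "((\<lambda>t. 0) has_real_derivative flat_exp (Suc k) t) (at t)"
      using 2 by (simp add: flat_exp_def)
    then show ?thesis
      by (rule has_field_derivative_transform_within_open[where S="{..<0}"]) (use 2 in \<open>auto simp: flat_exp_def\<close>)
  next
    case 3
    \<comment> \<open>With \<open>s = 1 / h\<close> the difference quotient at \<open>0\<close> is
      \<open>s * p s * exp (- s)\<close>, whence the polynomial \<open>[:0,1:] * ?p\<close>
      below.\<close>
    have "((\<lambda>h. flat_exp k h / h) \<longlongrightarrow> 0) (at_right 0)"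
    proof -
      have "((\<lambda>x. poly ([:0,1:] * ?p) x * exp (- x)) \<longlongrightarrow> 0) at_top"
        by (rule poly_mult_exp_neg_tendsto_0)
      then have "((\<lambda>h. poly ([:0,1:] * ?p) (inverse h) * exp (- inverse h)) \<longlongrightarrow> 0) (at_right 0)"
        by (rule filterlim_compose) (rule filterlim_inverse_at_top_right)
      then show ?thesis
        by (rule Lim_transform_eventually)
           (auto simp: flat_exp_def eventually_at_filter field_simps)
    qed
    moreover have "((\<lambda>h. flat_exp k h / h) \<longlongrightarrow> 0) (at_left 0)"
      by (rule Lim_transform_eventually[OF tendsto_const])
         (auto simp: flat_exp_def eventually_at_filter)
    ultimately have "((\<lambda>h. flat_exp k h / h) \<longlongrightarrow> 0) (at 0)"
      using filterlim_split_at by blast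
    then show ?thesis
      unfolding 3 DERIV_def by (simp add: flat_exp_def)
  qed
qed

lemma flat_exp_bounds: "0 \<le> flat_exp 0 t" "flat_exp 0 t \<le> 1"
  by (auto simp: flat_exp_def flat_exp_poly_def)

lemma flat_exp_tendsto_1:
  assumes "t > 0"
  shows "(\<lambda>m. flat_exp 0 (real m * t - 1)) \<longlonglongrightarrow> 1"
proof -
  have top: "filterlim (\<lambda>m. real m * t - 1) at_top sequentially"
    using filterlim_tendsto_add_at_top[OF tendsto_const[of "- 1"]
        filterlim_at_top_mult_tendsto_pos[OF tendsto_const[of t] assms filterlim_real_sequentially]]
    by simp
  have "(\<lambda>m. exp (- inverse (real m * t - 1))) \<longlonglongrightarrow> exp (- 0)"
    by (intro tendsto_intros tendsto_inverse_0_at_top top)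
  then have "(\<lambda>m. exp (- inverse (real m * t - 1))) \<longlonglongrightarrow> 1" by simp
  moreover have "eventually (\<lambda>m. real m * t - 1 > 0) sequentially"
    using top unfolding filterlim_at_top_dense by blast
  ultimately show ?thesis
    by (elim Lim_transform_eventually eventually_mono)
       (simp add: flat_exp_def flat_exp_poly_def inverse_eq_divide)
qed

text \<open>The scaling by \<open>m\<close> and the shift by \<open>1\<close> make each factor
  vanish within distance \<open>1 / m\<close> of its face of the box, which gives compact support,
  and send its argument to infinity at interior points. The value \<open>1\<close> is reached only
  in the limit.\<close>

definition box_bump :: "real^'n::finite \<Rightarrow> real^'n \<Rightarrow> nat \<Rightarrow> real^'n \<Rightarrow> real" where
  "box_bump a b m x = (\<Prod>i\<in>UNIV. flat_exp 0 (real m * (x $ i - a $ i) - 1) * flat_exp 0 (real m * (b $ i - x $ i) - 1))"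

lemma smooth_box_bump:
  fixes a b :: "real^'n::finite"
  shows "smooth (\<lambda>x. of_real (box_bump a b m x))"
proof -
  have q: "((\<lambda>t. complex_of_real (flat_exp k t)) has_vector_derivative of_real (flat_exp (Suc k) t)) (at t)" for k t
    by (rule has_vector_derivative_of_real[OF DERIV_flat_exp])
  have r: "smooth (\<lambda>x::real^'n. complex_of_real (flat_exp 0 (l x + b)))" if "bounded_linear l" for l b
    by (rule smooth_ridge[OF that, where q="\<lambda>k t. of_real (flat_exp k t)"]) (rule q)
  have 1: "smooth (\<lambda>x::real^'n. complex_of_real (flat_exp 0 (real m * (x $ i - a $ i) - 1)))" for i
    using r[of "\<lambda>x. real m * x $ i" "- real m * a $ i - 1"]
    by (simp add: algebra_simps bounded_linear_const_mult bounded_linear_minus bounded_linear_vec_nth)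
  have 2: "smooth (\<lambda>x::real^'n. complex_of_real (flat_exp 0 (real m * (b $ i - x $ i) - 1)))" for i
    using r[of "\<lambda>x. - (real m * x $ i)" "real m * b $ i - 1"]
    by (simp add: algebra_simps bounded_linear_const_mult bounded_linear_minus bounded_linear_vec_nth)
  show ?thesis unfolding box_bump_def of_real_prod of_real_mult
    by (intro smooth_prod smooth_mult 1 2)
qed

lemma box_bump_bounds: "0 \<le> box_bump a b m x" "box_bump a b m x \<le> 1"
  unfolding box_bump_def
  by (auto intro!: prod_nonneg prod_le_1 mult_nonneg_nonneg mult_le_one simp: flat_exp_bounds)

lemma box_bump_eq_0:
  assumes "x \<notin> {y. \<forall>i. a $ i + 1 / real m \<le> y $ i \<and> y $ i \<le> b $ i - 1 / real m}"
  shows "box_bump a b m x = 0"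
proof -
  obtain i where "\<not> (a $ i + 1 / real m \<le> x $ i \<and> x $ i \<le> b $ i - 1 / real m)" using assms by auto
  \<comment> \<open>For \<open>m = 0\<close> the quotient \<open>1 / real m\<close> is
    \<open>0\<close>, but then both arguments equal \<open>-1\<close>.\<close>
  then have "real m * (x $ i - a $ i) - 1 \<le> 0 \<or> real m * (b $ i - x $ i) - 1 \<le> 0"
    by (cases "m = 0") (auto simp: field_simps)
  then have "flat_exp 0 (real m * (x $ i - a $ i) - 1) * flat_exp 0 (real m * (b $ i - x $ i) - 1) = 0"
    by (auto simp: flat_exp_def)
  then show ?thesis unfolding box_bump_def by (auto intro!: prod_zero)
qed

lemma box_bump_tendsto:
  assumes "x \<in> box a b"
  shows "(\<lambda>m. box_bump a b m x) \<longlonglongrightarrow> 1"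
proof -
  have "(\<lambda>m. box_bump a b m x) \<longlonglongrightarrow> (\<Prod>i\<in>(UNIV::'a set). 1 * 1)"
    unfolding box_bump_def using assms
    by (intro tendsto_prod tendsto_mult flat_exp_tendsto_1) (auto simp: mem_box_cart)
  then show ?thesis by simp
qed

section \<open>Test functions and integration by parts\<close>

lemma lebesgue_measurable_affine:
  fixes t :: "'a::euclidean_space"
  assumes "c \<noteq> 0"
  shows "(\<lambda>x. t + c *\<^sub>R x) \<in> lebesgue \<rightarrow>\<^sub>M lebesgue"
    and lebesgue_density_affine:
      "lebesgue = density (distr lebesgue lebesgue (\<lambda>x. t + c *\<^sub>R x)) (\<lambda>_. ennreal (\<bar>c\<bar> ^ DIM('a)))"
proof -
  have T: "(\<lambda>x::'a. t + (\<Sum>j\<in>Basis. (c * (x \<bullet> j)) *\<^sub>R j)) = (\<lambda>x. t + c *\<^sub>R x)"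
    by (simp flip: scaleR_scaleR scaleR_sum_right add: euclidean_representation)
  show "(\<lambda>x. t + c *\<^sub>R x) \<in> lebesgue \<rightarrow>\<^sub>M lebesgue"
    using lebesgue_affine_measurable[of "\<lambda>_. c" t] assms unfolding T by simp
  show "lebesgue = density (distr lebesgue lebesgue (\<lambda>x. t + c *\<^sub>R x)) (\<lambda>_. ennreal (\<bar>c\<bar> ^ DIM('a)))"
    using lebesgue_affine_euclidean[of "\<lambda>_. c" t] assms unfolding T by simp
qed

lemma lebesgue_integrable_affine:
  fixes g :: "'a::euclidean_space \<Rightarrow> 'b::{banach, second_countable_topology}"
  assumes c: "c \<noteq> 0" and g: "integrable lebesgue g"
  shows "integrable lebesgue (\<lambda>x. g (t + c *\<^sub>R x))"
    and lebesgue_integral_affine: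
      "(\<integral>x. g x \<partial>lebesgue) = \<bar>c\<bar> ^ DIM('a) *\<^sub>R (\<integral>x. g (t + c *\<^sub>R x) \<partial>lebesgue)"
proof -
  note T = lebesgue_measurable_affine[OF c, of t]
  have gm: "g \<in> borel_measurable lebesgue" using g by auto
  have gd: "g \<in> borel_measurable (distr lebesgue lebesgue (\<lambda>x. t + c *\<^sub>R x))"
    using gm by (simp add: measurable_def)
  have "integrable (density (distr lebesgue lebesgue (\<lambda>x. t + c *\<^sub>R x)) (\<lambda>_. ennreal (\<bar>c\<bar> ^ DIM('a)))) g"
    using g lebesgue_density_affine[OF c, of t] by metis
  then have "integrable (distr lebesgue lebesgue (\<lambda>x. t + c *\<^sub>R x)) (\<lambda>x. (\<bar>c\<bar> ^ DIM('a)) *\<^sub>R g x)"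
    by (subst (asm) integrable_density[OF gd]) auto
  then have 1: "integrable (distr lebesgue lebesgue (\<lambda>x. t + c *\<^sub>R x)) g"
    using c integrable_scaleR_right[of "inverse (\<bar>c\<bar> ^ DIM('a))"] by fastforce
  then show "integrable lebesgue (\<lambda>x. g (t + c *\<^sub>R x))"
    by (subst (asm) integrable_distr_eq[OF T(1) gm])
  have "(\<integral>x. g x \<partial>lebesgue) = (\<integral>x. g x \<partial>(density (distr lebesgue lebesgue (\<lambda>x. t + c *\<^sub>R x)) (\<lambda>_. ennreal (\<bar>c\<bar> ^ DIM('a)))))"
    using lebesgue_density_affine[OF c, of t] by metis
  also have "\<dots> = (\<integral>x. (\<bar>c\<bar> ^ DIM('a)) *\<^sub>R g x \<partial>(distr lebesgue lebesgue (\<lambda>x. t + c *\<^sub>R x)))"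
    by (subst integral_density[OF gd]) auto
  also have "\<dots> = \<bar>c\<bar> ^ DIM('a) *\<^sub>R (\<integral>x. g (t + c *\<^sub>R x) \<partial>lebesgue)"
    by (subst integral_distr[OF T(1)]) (use gm in auto)
  finally show "(\<integral>x. g x \<partial>lebesgue) = \<bar>c\<bar> ^ DIM('a) *\<^sub>R (\<integral>x. g (t + c *\<^sub>R x) \<partial>lebesgue)" .
qed

lemma bounded_lebesgue_set_finite:
  fixes U :: "'a::euclidean_space set"
  assumes "bounded U" "U \<in> sets lebesgue"
  shows "emeasure lebesgue U < \<infinity>"
  using bounded_set_imp_lmeasurable[OF assms] by (auto simp: fmeasurable_def top.not_eq_extremum)

lemma set_integrable_bounded:
  fixes f :: "'a::euclidean_space \<Rightarrow> 'b::{banach, second_countable_topology}"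
  assumes U: "bounded U" "U \<in> sets lebesgue" and f: "f \<in> borel_measurable lebesgue"
    and b: "\<And>x. x \<in> U \<Longrightarrow> norm (f x) \<le> C"
  shows "set_integrable lebesgue U f"
proof -
  have "integrable lebesgue (\<lambda>x. indicator U x * C)"
    using bounded_lebesgue_set_finite[OF U] U by auto
  then show ?thesis unfolding set_integrable_def
    by (rule Bochner_Integration.integrable_bound)
       (use U f b in \<open>auto simp: indicator_def intro: order_trans[OF _ abs_ge_self]\<close>)
qed

lemma continuous_borel_measurable_lebesgue:
  fixes f :: "'a::euclidean_space \<Rightarrow> 'b::euclidean_space"
  assumes "continuous_on UNIV f"
  shows "f \<in> borel_measurable lebesgue"
  using measurable_completion[of f lborel borel] borel_measurable_continuous_onI[OF assms] by simp

lemma continuous_set_integrable: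
  fixes f :: "'a::euclidean_space \<Rightarrow> 'b::euclidean_space"
  assumes U: "bounded U" "U \<in> sets lebesgue" and f: "continuous_on UNIV f"
  shows "set_integrable lebesgue U f"
proof -
  have "compact (f ` closure U)"
    using assms by (intro compact_continuous_image) (auto intro: continuous_on_subset simp: compact_closure)
  then obtain C where "\<And>x. x \<in> closure U \<Longrightarrow> norm (f x) \<le> C"
    using compact_imp_bounded bounded_iff by (metis imageI)
  then show ?thesis
    using closure_subset
    by (intro set_integrable_bounded[OF U, of f C]) (auto intro: continuous_borel_measurable_lebesgue f)
qed

lemma smooth_measurable: "smooth f \<Longrightarrow> f \<in> borel_measurable lebesgue"
  by (rule continuous_borel_measurable_lebesgue[OF smooth_continuous_on])

lemma smooth_bounded_on:
  assumes "smooth f" "bounded U"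
  obtains C where "C > 0" "\<And>x. x \<in> U \<Longrightarrow> cmod (f x) \<le> C"
proof -
  have "compact (f ` closure U)"
    using assms by (intro compact_continuous_image) (auto intro: smooth_continuous_on simp: compact_closure)
  then obtain C where "C > 0" "\<And>x. x \<in> closure U \<Longrightarrow> cmod (f x) \<le> C"
    using compact_imp_bounded bounded_pos by (metis imageI)
  then show thesis using closure_subset that by blast
qed

section \<open>Test functions and their closure properties\<close>

lemma test_functionsI:
  assumes "smooth f" "compact K" "K \<subseteq> U" "\<And>x. x \<notin> K \<Longrightarrow> f x = 0"
  shows "f \<in> test_functions U"
proof -
  have "closure {x. f x \<noteq> 0} \<subseteq> K"
    using assms by (intro closure_minimal) (auto simp: compact_imp_closed)
  then show ?thesis
    using assms unfolding test_functions_def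
    using compact_Int_closed[OF \<open>compact K\<close> closed_closure, of "{x. f x \<noteq> 0}"] by (auto simp: Int_absorb1)
qed

lemma test_functionsD:
  assumes "f \<in> test_functions U"
  shows "\<exists>K. smooth f \<and> compact K \<and> K \<subseteq> U \<and> (\<forall>x. x \<notin> K \<longrightarrow> f x = 0)"
proof (intro exI conjI allI impI)
  show "f x = 0" if "x \<notin> closure {x. f x \<noteq> 0}" for x
    using that closure_subset[of "{x. f x \<noteq> 0}"] by auto
qed (use assms in \<open>auto simp: test_functions_def\<close>)

lemma test_functions_smooth: "f \<in> test_functions U \<Longrightarrow> smooth f"
  by (simp add: test_functions_def)

lemma test_functions_outside: "f \<in> test_functions U \<Longrightarrow> x \<notin> U \<Longrightarrow> f x = 0"
  using test_functionsD by blast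

lemma test_functions_mono: "f \<in> test_functions U \<Longrightarrow> U \<subseteq> U' \<Longrightarrow> f \<in> test_functions U'"
  by (auto simp: test_functions_def)

lemma test_functions_pderiv_dir:
  assumes "f \<in> test_functions U"
  shows "pderiv_dir i f \<in> test_functions U"
proof -
  obtain K where K: "smooth f" "compact K" "K \<subseteq> U" "\<And>x. x \<notin> K \<Longrightarrow> f x = 0"
    using test_functionsD[OF assms] by blast
  show ?thesis
  proof (rule test_functionsI[OF _ K(2,3)])
    fix x assume x: "x \<notin> K"
    have "(f has_derivative (\<lambda>h. 0)) (at x)"
      by (rule has_derivative_transform_within_open[where s="- K" and f="\<lambda>x. 0"])
         (use x K in \<open>auto simp: compact_imp_closed open_Compl\<close>)
    from pderiv_dir_eq[OF this] show "pderiv_dir i f x = 0" by simp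
  qed (use K smooth_pderiv_dir in auto)
qed

lemma test_functions_pderivs: "f \<in> test_functions U \<Longrightarrow> pderivs is f \<in> test_functions U"
  by (induction "is") (auto intro: test_functions_pderiv_dir)

lemma test_functions_mult:
  assumes "smooth f" "g \<in> test_functions U"
  shows "(\<lambda>x. f x * g x) \<in> test_functions U"
proof -
  obtain K where "smooth g" "compact K" "K \<subseteq> U" "\<And>x. x \<notin> K \<Longrightarrow> g x = 0"
    using test_functionsD[OF assms(2)] by blast
  then show ?thesis using assms(1) by (intro test_functionsI[of _ K]) (auto intro: smooth_mult)
qed

lemma test_functions_bounded:
  assumes "f \<in> test_functions U"
  obtains C where "C > 0" "\<And>x. cmod (f x) \<le> C"
proof -
  obtain K where K: "smooth f" "compact K" "K \<subseteq> U" "\<And>x. x \<notin> K \<Longrightarrow> f x = 0"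
    using test_functionsD[OF assms] by blast
  obtain C where "C > 0" "\<And>x. x \<in> K \<Longrightarrow> cmod (f x) \<le> C"
    using smooth_bounded_on[OF K(1) compact_imp_bounded[OF K(2)]] by blast
  then have "cmod (f x) \<le> C" for x using K(4)[of x] by (cases "x \<in> K") auto
  with \<open>C > 0\<close> show thesis using that by blast
qed

lemma test_functions_integrable:
  assumes "f \<in> test_functions U"
  shows "integrable lebesgue f"
proof -
  obtain K where K: "smooth f" "compact K" "K \<subseteq> U" "\<And>x. x \<notin> K \<Longrightarrow> f x = 0"
    using test_functionsD[OF assms] by blast
  have "set_integrable lebesgue K f"
    using K by (intro continuous_set_integrable) (auto intro: smooth_continuous_on compact_imp_bounded lmeasurable_compact fmeasurableD)
  moreover have "(\<lambda>x. indicator K x *\<^sub>R f x) = f" using K by (auto simp: indicator_def)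
  ultimately show ?thesis by (simp add: set_integrable_def)
qed

lemma set_integral_test_function:
  assumes "g \<in> test_functions U"
  shows "(LINT x:U|lebesgue. f x * g x) = (LINT x|lebesgue. f x * g x)"
  unfolding set_lebesgue_integral_def
  by (rule Bochner_Integration.integral_cong) (auto simp: indicator_def test_functions_outside[OF assms])

lemma set_integral_test_function_mono:
  assumes "g \<in> test_functions U" "U \<subseteq> U'"
  shows "(LINT x:U|lebesgue. f x * g x) = (LINT x:U'|lebesgue. f x * g x)"
  unfolding set_integral_test_function[OF assms(1)] set_integral_test_function[OF test_functions_mono[OF assms]] ..

section \<open>Difference quotients and integration by parts\<close>

lemma vector_derivative_norm_bound:
  fixes f :: "real \<Rightarrow> complex"
  assumes "convex S" "\<And>t. t \<in> S \<Longrightarrow> (f has_vector_derivative f' t) (at t within S)"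
    "\<And>t. t \<in> S \<Longrightarrow> cmod (f' t) \<le> C" "a \<in> S" "b \<in> S"
  shows "cmod (f b - f a) \<le> C * \<bar>b - a\<bar>"
proof -
  have "norm (f b - f a) \<le> C * norm (b - a)"
  proof (rule differentiable_bound[where f'="\<lambda>t h. h *\<^sub>R f' t" and S=S])
    fix t assume t: "t \<in> S"
    show "onorm (\<lambda>h. h *\<^sub>R f' t) \<le> C"
    proof (rule onorm_bound)
      show "0 \<le> C" using assms(3)[OF t] norm_ge_zero order_trans by blast
      show "norm (x *\<^sub>R f' t) \<le> C * norm x" for x
        using mult_left_mono[OF assms(3)[OF t], of "norm x"] by (simp add: mult.commute)
    qed
  qed (use assms in \<open>auto simp: has_vector_derivative_def\<close>)
  then show ?thesis by simp
qed

text \<open>Dominated convergence concerns sequences of functions, so derivatives are needed as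
  limits of difference quotients, which can be taken along sequences.\<close>

lemma has_vector_derivative_iff_quotient:
  fixes f :: "real \<Rightarrow> complex"
  shows "(f has_vector_derivative d) (at t within S) \<longleftrightarrow> ((\<lambda>s. (f s - f t) /\<^sub>R (s - t)) \<longlongrightarrow> d) (at t within S)"
proof -
  have "norm ((1 / norm (s - t)) *\<^sub>R (f s - (f t + (s - t) *\<^sub>R d))) = norm ((f s - f t) /\<^sub>R (s - t) - d)"
    if "s \<noteq> t" for s
  proof -
    have e: "f s - (f t + (s - t) *\<^sub>R d) = (s - t) *\<^sub>R ((f s - f t) /\<^sub>R (s - t) - d)"
      using that by (simp add: scaleR_right_diff_distrib)
    show ?thesis unfolding e norm_scaleR using that by simp
  qed
  then have "\<forall>\<^sub>F s in at t within S. norm ((1 / norm (s - t)) *\<^sub>R (f s - (f t + (s - t) *\<^sub>R d))) = norm ((f s - f t) /\<^sub>R (s - t) - d)"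
    by (auto simp: eventually_at_filter)
  then have "((\<lambda>s. norm ((1 / norm (s - t)) *\<^sub>R (f s - (f t + (s - t) *\<^sub>R d)))) \<longlongrightarrow> 0) (at t within S)
      \<longleftrightarrow> ((\<lambda>s. norm ((f s - f t) /\<^sub>R (s - t) - d)) \<longlongrightarrow> 0) (at t within S)"
    by (intro tendsto_cong) auto
  then show ?thesis
    unfolding has_vector_derivative_def has_derivative_within tendsto_norm_zero_iff LIM_zero_iff
    by (simp add: bounded_linear_scaleR_left)
qed

text \<open>Difference quotients of \<open>g\<close> have integral \<open>0\<close> by translation
  invariance of Lebesgue measure, and they converge to the derivative. A bound of the derivative
  dominates them on \<open>cball 0 (R + 1)\<close>; outside this ball they vanish, because the
  shifts have length at most \<open>1\<close>.\<close>

lemma integral_pderiv_dir_eq_0: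
  fixes g :: "real^'n::finite \<Rightarrow> complex"
  assumes g: "g \<in> test_functions U"
  shows "(LINT x|lebesgue. pderiv_dir i g x) = 0"
proof -
  let ?e = "axis i 1 :: real^'n"
  \<comment> \<open>The factor \<open>1\<close> writes the shift as an affine map
    \<open>t + c *\<^sub>R x\<close> with \<open>c = 1\<close>.\<close>
  define q where "q m x = real (Suc m) *\<^sub>R (g ((1 / real (Suc m)) *\<^sub>R ?e + 1 *\<^sub>R x) - g x)" for m x
  note sm = test_functions_smooth[OF g]
  obtain C where C: "C > 0" "\<And>x. cmod (pderiv_dir i g x) \<le> C"
    using test_functions_bounded[OF test_functions_pderiv_dir[OF g]] by blast
  obtain K where K: "compact K" "\<And>x. x \<notin> K \<Longrightarrow> g x = 0"
    using test_functionsD[OF g] by blast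
  obtain R where R: "\<And>x. x \<in> K \<Longrightarrow> norm x \<le> R"
    using compact_imp_bounded[OF K(1)] bounded_iff by metis
  have gi: "integrable lebesgue g" by (rule test_functions_integrable[OF g])
  have gs: "integrable lebesgue (\<lambda>x. g ((1 / real (Suc m)) *\<^sub>R ?e + 1 *\<^sub>R x))" for m
    by (rule lebesgue_integrable_affine[OF _ gi]) simp
  have "(\<integral>x. q m x \<partial>lebesgue) = 0" for m
  proof -
    have "(\<integral>x. g x \<partial>lebesgue) = (\<integral>x. g ((1 / real (Suc m)) *\<^sub>R ?e + 1 *\<^sub>R x) \<partial>lebesgue)"
      by (subst lebesgue_integral_affine[OF _ gi, of 1 "(1 / real (Suc m)) *\<^sub>R ?e"]) auto
    then show ?thesis
      unfolding q_def integral_scaleR_right Bochner_Integration.integral_diff[OF gs[of m] gi] by simp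
  qed
  moreover have "(\<lambda>m. \<integral>x. q m x \<partial>lebesgue) \<longlonglongrightarrow> (\<integral>x. pderiv_dir i g x \<partial>lebesgue)"
  proof (rule integral_dominated_convergence[where w="\<lambda>x. indicator (cball 0 (R + 1)) x * C"])
    show "pderiv_dir i g \<in> borel_measurable lebesgue"
      by (intro smooth_measurable smooth_pderiv_dir sm)
    show "q m \<in> borel_measurable lebesgue" for m
      unfolding q_def using gs[of m] gi by measurable
    have "emeasure lebesgue (cball (0::real^'n) (R + 1)) < \<infinity>"
      by (rule bounded_lebesgue_set_finite) auto
    then show "integrable lebesgue (\<lambda>x::real^'n. indicator (cball 0 (R + 1)) x * C)"
      by auto
    show "AE x in lebesgue. (\<lambda>m. q m x) \<longlonglongrightarrow> pderiv_dir i g x"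
    proof (rule AE_I2)
      fix x
      have "((\<lambda>t. (g (x + t *\<^sub>R ?e) - g x) /\<^sub>R t) \<longlongrightarrow> pderiv_dir i g x) (at 0)"
        using smooth_line_derivative[OF sm, of x i 0] unfolding has_vector_derivative_iff_quotient by simp
      then have "(\<lambda>m. (g (x + (1 / real (Suc m)) *\<^sub>R ?e) - g x) /\<^sub>R (1 / real (Suc m))) \<longlonglongrightarrow> pderiv_dir i g x"
        by (rule filterlim_compose)
           (use LIMSEQ_inverse_real_of_nat in \<open>auto simp: filterlim_at inverse_eq_divide\<close>)
      then show "(\<lambda>m. q m x) \<longlonglongrightarrow> pderiv_dir i g x"
        by (simp add: q_def add.commute)
    qed
    show "AE x in lebesgue. norm (q m x) \<le> indicator (cball 0 (R + 1)) x * C" for m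
    proof (rule AE_I2)
      fix x
      let ?t = "1 / real (Suc m)"
      have 1: "norm (q m x) \<le> C"
      proof -
        have "cmod (g (x + ?t *\<^sub>R ?e) - g (x + 0 *\<^sub>R ?e)) \<le> C * \<bar>?t - 0\<bar>"
          by (rule vector_derivative_norm_bound[OF convex_UNIV smooth_line_derivative[OF sm] C(2)]) auto
        then have "real (Suc m) * cmod (g (x + ?t *\<^sub>R ?e) - g x) \<le> real (Suc m) * (C * ?t)"
          by (intro mult_left_mono) auto
        then show ?thesis by (simp add: q_def add.commute)
      qed
      have 2: "q m x = 0" if "x \<notin> cball 0 (R + 1)"
      proof -
        have "x \<notin> K" using R[of x] that by auto
        moreover have n: "norm x \<le> norm (?t *\<^sub>R ?e + x) + ?t"
          using norm_triangle_ineq4[of "?t *\<^sub>R ?e + x" "?t *\<^sub>R ?e"] by (simp add: norm_axis_1)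
        have "?t *\<^sub>R ?e + x \<notin> K"
        proof
          assume "?t *\<^sub>R ?e + x \<in> K"
          from R[OF this] n have "norm x \<le> R + ?t" by linarith
          moreover have "?t \<le> 1" by simp
          ultimately have "norm x \<le> R + 1" by linarith
          then show False using that by simp
        qed
        ultimately show ?thesis using K by (simp add: q_def)
      qed
      show "norm (q m x) \<le> indicator (cball 0 (R + 1)) x * C"
        using 1 2 by (auto simp: indicator_def)
    qed
  qed
  ultimately show ?thesis by (simp add: LIMSEQ_const_iff)
qed

lemma integration_by_parts_dir:
  fixes f :: "real^'n::finite \<Rightarrow> complex"
  assumes f: "smooth f" and g: "g \<in> test_functions U"
  shows "(LINT x|lebesgue. f x * pderiv_dir i g x) = - (LINT x|lebesgue. pderiv_dir i f x * g x)"
proof -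
  have 1: "pderiv_dir i (\<lambda>x. f x * g x) = (\<lambda>x. pderiv_dir i f x * g x + f x * pderiv_dir i g x)"
    using f g by (intro ext pderiv_dir_mult) (auto intro: smooth_differentiable test_functions_smooth)
  have 2: "integrable lebesgue (\<lambda>x. pderiv_dir i f x * g x)" "integrable lebesgue (\<lambda>x. f x * pderiv_dir i g x)"
    using test_functions_integrable[OF test_functions_mult[OF smooth_pderiv_dir[OF f] g]]
      test_functions_integrable[OF test_functions_mult[OF f test_functions_pderiv_dir[OF g]]] by blast+
  have "(LINT x|lebesgue. pderiv_dir i f x * g x + f x * pderiv_dir i g x) = 0"
    using integral_pderiv_dir_eq_0[OF test_functions_mult[OF f g], of i] unfolding 1 .
  then show ?thesis using 2 by (simp add: eq_neg_iff_add_eq_0 add.commute)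
qed

text \<open>The outermost derivative of \<open>g\<close> is moved first and ends innermost on
  \<open>f\<close>; hence the reversed list.\<close>

lemma integration_by_parts:
  fixes f :: "real^'n::finite \<Rightarrow> complex"
  assumes f: "smooth f" and g: "g \<in> test_functions U"
  shows "(LINT x|lebesgue. f x * pderivs is g x) = (-1) ^ length is * (LINT x|lebesgue. pderivs (rev is) f x * g x)"
  using f
proof (induction "is" arbitrary: f)
  case (Cons i "is")
  have "(LINT x|lebesgue. f x * pderivs (i # is) g x) = - (LINT x|lebesgue. pderiv_dir i f x * pderivs is g x)"
    using integration_by_parts_dir[OF Cons.prems test_functions_pderivs[OF g]] by simp
  then show ?case by (simp add: Cons.IH[OF smooth_pderiv_dir[OF Cons.prems]] pderivs_append)
qed simp

lemma smooth_has_weak_pderivs: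
  assumes "smooth f"
  shows "has_weak_pderivs U is f (pderivs (rev is) f)"
  unfolding has_weak_pderivs_def
  by (auto simp: set_integral_test_function integration_by_parts[OF assms] test_functions_pderivs)

section \<open>Duality with test functions and uniqueness of weak derivatives\<close>

lemma box_bump_test_function: "(\<lambda>x. of_real (box_bump a b m x)) \<in> test_functions (box a b)"
proof (cases "m = 0")
  case True
  have "box_bump a b m x = 0" for x
  proof -
    have "flat_exp 0 (-1) = 0" by (simp add: flat_exp_def)
    then show ?thesis using True unfolding box_bump_def by simp
  qed
  then show ?thesis by (intro test_functionsI[of _ "{}"]) (auto intro: smooth_const)
next
  case False
  let ?K = "cbox (\<chi> i. a $ i + 1 / real m) (\<chi> i. b $ i - 1 / real m)"
  show ?thesis
  proof (rule test_functionsI[of _ ?K])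
    show "?K \<subseteq> box a b"
    proof
      fix x assume x: "x \<in> ?K"
      have "a $ i < x $ i \<and> x $ i < b $ i" for i
      proof -
        have "a $ i + 1 / real m \<le> x $ i \<and> x $ i \<le> b $ i - 1 / real m"
          using x by (simp add: mem_box_cart)
        moreover have "1 / real m > 0" using False by simp
        ultimately show ?thesis by linarith
      qed
      then show "x \<in> box a b" by (simp add: mem_box_cart)
    qed
    show "of_real (box_bump a b m x) = (0::complex)" if "x \<notin> ?K" for x
      using that by (subst box_bump_eq_0) (auto simp: mem_box_cart)
  qed (auto intro: smooth_box_bump)
qed

text \<open>An open set is a countable union of boxes. One minus the product of the factors 1 - bump
  over the first \<open>m\<close> boxes is a smooth substitute for the maximum of the bumps: it
  stays between 0 and 1, is carried by finitely many compact sets and dominates each single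
  bump.\<close>

lemma test_function_cutoff:
  fixes U :: "(real^'n::finite) set"
  assumes U: "open U"
  obtains \<psi> where "\<And>m. (\<lambda>x. of_real (\<psi> m x)) \<in> test_functions U"
    "\<And>m x. 0 \<le> \<psi> m x" "\<And>m x. \<psi> m x \<le> 1" "\<And>x. x \<in> U \<Longrightarrow> (\<lambda>m. \<psi> m x) \<longlonglongrightarrow> 1"
proof (cases "U = {}")
  case True
  show thesis
    by (rule that[of "\<lambda>m x. 0"]) (use True in \<open>auto intro!: test_functionsI[of _ "{}"] smooth_const\<close>)
next
  case False
  obtain \<D> where D: "countable \<D>" "\<D> \<subseteq> Pow U" "\<And>X. X \<in> \<D> \<Longrightarrow> \<exists>a b. X = box a b" "\<Union>\<D> = U"
    using open_countable_Union_open_box[OF U] by blast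
  define Q where "Q = from_nat_into \<D>"
  have "\<D> \<noteq> {}" using D False by auto
  then have rQ: "range Q = \<D>" using D(1) by (simp add: Q_def range_from_nat_into)
  have "\<forall>j. \<exists>a b. Q j = box a b" using D(3) rQ by blast
  then obtain a b where ab: "\<And>j. Q j = box (a j) (b j)" by metis
  define \<psi> where "\<psi> m x = 1 - (\<Prod>j<m. 1 - box_bump (a j) (b j) m x)" for m x
  have p0: "0 \<le> (\<Prod>j<m. 1 - box_bump (a j) (b j) m x)" and p1: "(\<Prod>j<m. 1 - box_bump (a j) (b j) m x) \<le> 1" for m x
    by (auto intro!: prod_nonneg prod_le_1 simp: box_bump_bounds)
  show thesis
  proof (rule that[of \<psi>])
    fix m
    have "\<exists>K. compact K \<and> K \<subseteq> U \<and> (\<forall>x. x \<notin> K \<longrightarrow> box_bump (a j) (b j) m x = 0)" for j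
    proof -
      have "box (a j) (b j) \<subseteq> U" using ab[of j] rQ D(2) by blast
      then show ?thesis
        using test_functionsD[OF box_bump_test_function[of "a j" "b j" m]] by auto
    qed
    then obtain K where K: "\<And>j. compact (K j)" "\<And>j. K j \<subseteq> U" "\<And>j x. x \<notin> K j \<Longrightarrow> box_bump (a j) (b j) m x = 0"
      by metis
    show "(\<lambda>x. of_real (\<psi> m x)) \<in> test_functions U"
    proof (rule test_functionsI[of _ "\<Union>j<m. K j"])
      show "smooth (\<lambda>x. complex_of_real (\<psi> m x))"
        unfolding \<psi>_def of_real_diff of_real_prod of_real_1
        by (intro smooth_diff smooth_prod smooth_const smooth_box_bump)
      show "compact (\<Union>j<m. K j)" using K by (intro compact_UN) auto
      show "complex_of_real (\<psi> m x) = 0" if "x \<notin> (\<Union>j<m. K j)" for x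
        using that K(3) by (simp add: \<psi>_def)
    qed (use K in auto)
  next
    fix x assume "x \<in> U"
    then obtain X where "X \<in> \<D>" "x \<in> X" using D(4) by blast
    then obtain j where "x \<in> Q j" using rQ by auto
    then have j: "x \<in> box (a j) (b j)" by (simp add: ab)
    \<comment> \<open>From \<open>m > j\<close> on, the product contains the factor of the box
      around \<open>x\<close>, and the other factors are at most \<open>1\<close>.\<close>
    have "(\<lambda>m. \<Prod>j<m. 1 - box_bump (a j) (b j) m x) \<longlonglongrightarrow> 0"
    proof (rule tendsto_sandwich[OF _ _ tendsto_const])
      show "(\<lambda>m. 1 - box_bump (a j) (b j) m x) \<longlonglongrightarrow> 0"
        using tendsto_diff[OF tendsto_const box_bump_tendsto[OF j], of 1] by simp
      show "\<forall>\<^sub>F m in sequentially. (\<Prod>j<m. 1 - box_bump (a j) (b j) m x) \<le> 1 - box_bump (a j) (b j) m x"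
        using eventually_gt_at_top[of j]
      proof eventually_elim
        case (elim m)
        have "(\<Prod>j<m. 1 - box_bump (a j) (b j) m x)
            = (1 - box_bump (a j) (b j) m x) * (\<Prod>j\<in>{..<m} - {j}. 1 - box_bump (a j) (b j) m x)"
          using elim by (intro prod.remove) auto
        also have "\<dots> \<le> (1 - box_bump (a j) (b j) m x) * 1"
          by (intro mult_left_mono prod_le_1) (auto simp: box_bump_bounds)
        finally show ?case by simp
      qed
    qed (use p0 in auto)
    then show "(\<lambda>m. \<psi> m x) \<longlonglongrightarrow> 1"
      unfolding \<psi>_def using tendsto_diff[OF tendsto_const, of _ 0 sequentially 1] by fastforce
  qed (use p0 p1 in \<open>auto simp: \<psi>_def\<close>)
qed

lemma smooth_polynomial_function:
  fixes p :: "real^'n::finite \<Rightarrow> complex"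
  assumes "polynomial_function p"
  shows "smooth p"
proof -
  have "real_polynomial_function (Re \<circ> p)" "real_polynomial_function (Im \<circ> p)"
    using assms bounded_linear_Re bounded_linear_Im unfolding polynomial_function_def by blast+
  from this[THEN smooth_real_polynomial]
  have "smooth (\<lambda>x. of_real (Re (p x)) + \<i> * of_real (Im (p x)))"
    by (intro smooth_add smooth_mult smooth_const) (simp_all add: o_def)
  then show ?thesis by (simp add: complex_eq[symmetric])
qed

text \<open>The sign of \<open>h\<close> is an almost everywhere limit of test functions bounded by \<open>1\<close>: approximate it
  by continuous functions, these by polynomials, and cut off.\<close>

lemma L1_duality:
  fixes U :: "(real^'n::finite) set"
  assumes U: "open U" "bounded U" and h: "set_integrable lebesgue U h"
    and B: "\<And>\<eta>. \<eta> \<in> test_functions U \<Longrightarrow> (\<And>x. cmod (\<eta> x) \<le> 1) \<Longrightarrow> cmod (LINT x:U|lebesgue. h x * \<eta> x) \<le> B"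
  shows "(LINT x:U|lebesgue. cmod (h x)) \<le> B"
proof -
  define h' where "h' = (\<lambda>x. indicator U x *\<^sub>R h x)"
  have hi: "integrable lebesgue h'" using h by (simp add: set_integrable_def h'_def)
  have hm: "h' \<in> borel_measurable lebesgue" using hi by auto
  \<comment> \<open>The conjugate makes \<open>h' x * \<sigma> x\<close> equal to
    \<open>cmod (h' x)\<close>, also where \<open>h' x = 0\<close>, as
    \<open>sgn 0 = 0\<close>.\<close>
  define \<sigma> where "\<sigma> = (\<lambda>x. cnj (sgn (h' x)))"
  have sm: "\<sigma> \<in> borel_measurable lebesgue"
  proof -
    have "(\<lambda>x. inverse (complex_of_real (norm (h' x)))) \<in> borel_measurable lebesgue"
      using hm by measurable
    then have "(\<lambda>x. cnj (h' x) * inverse (complex_of_real (norm (h' x)))) \<in> borel_measurable lebesgue"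
      using hm by (intro borel_measurable_times borel_measurable_continuous_on[OF continuous_on_cnj[OF continuous_on_id]]) auto
    then show ?thesis by (simp add: \<sigma>_def sgn_eq divide_inverse)
  qed
  obtain N g where N: "negligible N" and g: "\<And>n. continuous_on UNIV (g n)"
    and lim: "\<And>x. x \<notin> N \<Longrightarrow> (\<lambda>n. g n x) \<longlonglongrightarrow> \<sigma> x"
    using lebesgue_measurable_imp_measurable_on[OF sm, of UNIV] unfolding measurable_on_def by auto
  \<comment> \<open>Radial truncation to the closed unit disc. It does not disturb the limit because
    \<open>cmod (\<sigma> x) \<le> 1\<close>.\<close>
  define \<rho> where "\<rho> n x = g n x / of_real (max 1 (cmod (g n x)))" for n x
  have r1: "cmod (\<rho> n x) \<le> 1" for n x
    by (auto simp: \<rho>_def norm_divide divide_simps)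
  have rc: "continuous_on UNIV (\<rho> n)" for n
    unfolding \<rho>_def using g by (intro continuous_intros) auto
  have s1: "cmod (\<sigma> x) \<le> 1" for x by (auto simp: \<sigma>_def norm_sgn)
  have rl: "(\<lambda>n. \<rho> n x) \<longlonglongrightarrow> \<sigma> x" if "x \<notin> N" for x
  proof -
    have "(\<lambda>n. \<rho> n x) \<longlonglongrightarrow> \<sigma> x / of_real (max 1 (cmod (\<sigma> x)))"
      unfolding \<rho>_def by (intro tendsto_intros lim that) auto
    then show ?thesis using s1[of x] by (simp add: max_absorb1)
  qed
  have "\<exists>p. polynomial_function p \<and> (\<forall>x\<in>closure U. norm (\<rho> n x - p x) < 1 / real (Suc n))" for n
    by (rule Stone_Weierstrass_polynomial_function) (use U rc in \<open>auto simp: compact_closure intro: continuous_on_subset\<close>)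
  then obtain p where p: "\<And>n. polynomial_function (p n)"
    and pr: "\<And>n x. x \<in> closure U \<Longrightarrow> norm (\<rho> n x - p n x) < 1 / real (Suc n)"
    by metis
  obtain \<psi> where c: "\<And>m. (\<lambda>x. of_real (\<psi> m x)) \<in> test_functions U"
    "\<And>m x. 0 \<le> \<psi> m x" "\<And>m x. \<psi> m x \<le> 1" "\<And>x. x \<in> U \<Longrightarrow> (\<lambda>m. \<psi> m x) \<longlonglongrightarrow> 1"
    using test_function_cutoff[OF U(1)] by blast
  \<comment> \<open>On \<open>U\<close> the modulus of \<open>p n\<close> exceeds \<open>1\<close>
    by at most \<open>1 / real (Suc n)\<close>; dividing by one plus this number restores the bound
    \<open>1\<close>.\<close>
  define \<eta> where "\<eta> n x = (of_real (inverse (1 + 1 / real (Suc n))) * p n x) * of_real (\<psi> n x)" for n x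
  have \<eta>: "\<eta> n \<in> test_functions U" for n
    unfolding \<eta>_def by (intro test_functions_mult c smooth_mult smooth_const smooth_polynomial_function p)
  have \<eta>1: "cmod (\<eta> n x) \<le> 1" for n x
  proof (cases "x \<in> U")
    case True
    have "cmod (p n x) \<le> cmod (\<rho> n x) + cmod (\<rho> n x - p n x)"
      by (metis norm_minus_commute norm_triangle_sub)
    also have "\<dots> \<le> 1 + 1 / real (Suc n)"
      using pr[of x n] r1[of n x] True closure_subset[of U] by (intro add_mono) (auto intro: less_imp_le)
    finally have 1: "cmod (p n x) \<le> 1 + 1 / real (Suc n)" .
    have pos: "1 + 1 / real (Suc n) > 0" by (intro add_pos_pos) auto
    have "cmod (\<eta> n x) = inverse (1 + 1 / real (Suc n)) * cmod (p n x) * \<psi> n x"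
      using c(2)[of n x] pos by (simp add: \<eta>_def norm_mult del: of_real_inverse of_real_add of_nat_Suc)
    also have "\<dots> \<le> inverse (1 + 1 / real (Suc n)) * (1 + 1 / real (Suc n)) * 1"
      using 1 pos c by (intro mult_mono) auto
    also have "\<dots> = 1" using pos by simp
    finally show ?thesis .
  qed (simp add: test_functions_outside[OF \<eta>])
  have \<eta>l: "(\<lambda>n. \<eta> n x) \<longlonglongrightarrow> \<sigma> x" if "x \<notin> N" "x \<in> U" for x
  proof -
    have "(\<lambda>n. \<rho> n x - p n x) \<longlonglongrightarrow> 0"
    proof (rule Lim_null_comparison)
      show "\<forall>\<^sub>F n in sequentially. norm (\<rho> n x - p n x) \<le> 1 / real (Suc n)"
        using pr[of x] that closure_subset[of U] by (auto intro!: always_eventually less_imp_le)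
      show "(\<lambda>n. 1 / real (Suc n)) \<longlonglongrightarrow> 0" using LIMSEQ_inverse_real_of_nat by (simp add: inverse_eq_divide)
    qed
    from tendsto_diff[OF rl[OF that(1)] this] have "(\<lambda>n. p n x) \<longlonglongrightarrow> \<sigma> x" by simp
    moreover have "(\<lambda>n. 1 + 1 / real (Suc n)) \<longlonglongrightarrow> 1 + 0"
      using LIMSEQ_inverse_real_of_nat by (intro tendsto_add tendsto_const) (simp only: inverse_eq_divide)
    ultimately have "(\<lambda>n. \<eta> n x) \<longlonglongrightarrow> (of_real (inverse (1 + 0)) * \<sigma> x) * of_real 1"
      unfolding \<eta>_def by (intro tendsto_mult tendsto_of_real tendsto_inverse c that) auto
    then show ?thesis by simp
  qed
  have "(\<lambda>n. \<integral>x. h' x * \<eta> n x \<partial>lebesgue) \<longlonglongrightarrow> (\<integral>x. of_real (cmod (h' x)) \<partial>lebesgue)"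
  proof (rule integral_dominated_convergence[where w="\<lambda>x. cmod (h' x)"])
    show "(\<lambda>x. h' x * \<eta> n x) \<in> borel_measurable lebesgue" for n
      using hm smooth_measurable[OF test_functions_smooth[OF \<eta>]] by measurable
    show "AE x in lebesgue. (\<lambda>n. h' x * \<eta> n x) \<longlonglongrightarrow> of_real (cmod (h' x))"
    proof (rule AE_I')
      show "N \<in> null_sets lebesgue" using N negligible_iff_null_sets by blast
      show "{x \<in> space lebesgue. \<not> (\<lambda>n. h' x * \<eta> n x) \<longlonglongrightarrow> of_real (cmod (h' x))} \<subseteq> N"
      proof clarify
        fix x assume x: "\<not> (\<lambda>n. h' x * \<eta> n x) \<longlonglongrightarrow> of_real (cmod (h' x))"
        show "x \<in> N"
        proof (rule ccontr)
          assume "x \<notin> N"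
          have e: "h' x * \<sigma> x = of_real (cmod (h' x))"
            by (simp add: \<sigma>_def sgn_eq complex_norm_square[symmetric] power2_eq_square)
          show False
          proof (cases "x \<in> U")
            case True
            have "(\<lambda>n. h' x * \<eta> n x) \<longlonglongrightarrow> h' x * \<sigma> x"
              by (intro tendsto_intros \<eta>l \<open>x \<notin> N\<close> True)
            then show False using x e by simp
          next
            case False
            then show False using x by (simp add: h'_def)
          qed
        qed
      qed
    qed
    show "AE x in lebesgue. norm (h' x * \<eta> n x) \<le> cmod (h' x)" for n
      using \<eta>1 by (auto simp: norm_mult mult_left_le)
  qed (use hi hm in \<open>auto intro: integrable_norm\<close>)
  then have "(\<lambda>n. cmod (\<integral>x. h' x * \<eta> n x \<partial>lebesgue)) \<longlonglongrightarrow> cmod (\<integral>x. of_real (cmod (h' x)) \<partial>lebesgue)"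
    by (rule tendsto_norm)
  moreover have "cmod (\<integral>x. h' x * \<eta> n x \<partial>lebesgue) \<le> B" for n
    using B[OF \<eta> \<eta>1, of n] by (simp add: set_lebesgue_integral_def h'_def)
  ultimately have "cmod (\<integral>x. of_real (cmod (h' x)) \<partial>lebesgue) \<le> B"
    by (intro LIMSEQ_le_const2) auto
  then show ?thesis
    unfolding integral_complex_of_real norm_of_real set_lebesgue_integral_def
    by (simp add: h'_def)
qed

lemma set_integral_norm_eq_0_AE:
  assumes h: "set_integrable lebesgue U h" and "(LINT x:U|lebesgue. cmod (h x)) \<le> 0"
  shows "AE x in lebesgue. x \<in> U \<longrightarrow> h x = 0"
proof -
  let ?h = "\<lambda>x. indicator U x *\<^sub>R cmod (h x)"
  have i: "integrable lebesgue ?h"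
    using integrable_norm[OF h[unfolded set_integrable_def]] by simp
  have n: "AE x in lebesgue. 0 \<le> ?h x" by simp
  have "integral\<^sup>L lebesgue ?h \<ge> 0" by (rule integral_nonneg_AE[OF n])
  moreover have "integral\<^sup>L lebesgue ?h \<le> 0" using assms(2) by (simp add: set_lebesgue_integral_def)
  ultimately have "integral\<^sup>L lebesgue ?h = 0" by (rule antisym[rotated])
  then have "AE x in lebesgue. ?h x = 0" using integral_nonneg_eq_0_iff_AE[OF i n] by blast
  then show ?thesis by eventually_elim (auto simp: indicator_def split: if_splits)
qed

text \<open>The fundamental lemma of the calculus of variations, as the case \<open>B = 0\<close> of
  \<open>L1_duality\<close>.\<close>

lemma test_functions_orthogonal_AE:
  fixes U :: "(real^'n::finite) set"
  assumes "open U" "bounded U" "set_integrable lebesgue U h"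
    and "\<And>\<eta>. \<eta> \<in> test_functions U \<Longrightarrow> (LINT x:U|lebesgue. h x * \<eta> x) = 0"
  shows "AE x in lebesgue. x \<in> U \<longrightarrow> h x = 0"
  by (intro set_integral_norm_eq_0_AE L1_duality) (use assms in auto)

subsection \<open>Square-integrable functions on bounded sets\<close>

lemma L2_on_square_integrable: "f \<in> L2_on U \<Longrightarrow> set_integrable lebesgue U (\<lambda>x. (cmod (f x))\<^sup>2)"
  by (simp add: L2_on_def)

lemma L2_on_integrable:
  assumes f: "f \<in> L2_on U" and U: "bounded U" "U \<in> sets lebesgue"
  shows "set_integrable lebesgue U f"
proof -
  have "set_integrable lebesgue U (\<lambda>x. 1 + (cmod (f x))\<^sup>2)"
    by (rule set_integral_add(1)[OF _ L2_on_square_integrable[OF f]])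
       (intro continuous_set_integrable[OF U] continuous_on_const)
  then show ?thesis
    unfolding set_integrable_def
  proof (rule Bochner_Integration.integrable_bound)
    show "(\<lambda>x. indicat_real U x *\<^sub>R f x) \<in> borel_measurable lebesgue"
      using f by (simp add: L2_on_def set_borel_measurable_def)
    have "cmod z \<le> 1 + (cmod z)\<^sup>2" for z
      using sum_power2_ge_zero[of "cmod z - 1/2" 0] by (simp add: power2_eq_square algebra_simps)
    then show "AE x in lebesgue. norm (indicat_real U x *\<^sub>R f x) \<le> norm (indicat_real U x *\<^sub>R (1 + (cmod (f x))\<^sup>2))"
      by (auto simp: indicator_def intro: order_trans[OF _ abs_ge_self])
  qed
qed

text \<open>Young's inequality, from expanding
  \<open>0 \<le> t * (cmod (f x) - 1 / t)\<^sup>2\<close>. With \<open>t\<close> near the square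
  root of \<open>measure lebesgue U\<close>, both terms decay with the measure at the rate that
  Cauchy-Schwarz would give.\<close>

lemma L1_le_L2:
  assumes f: "f \<in> L2_on U" and U: "bounded U" "U \<in> sets lebesgue" and t: "t > 0"
  shows "(LINT x:U|lebesgue. cmod (f x)) \<le> t * (LINT x:U|lebesgue. (cmod (f x))\<^sup>2) + measure lebesgue U / t"
proof -
  have c: "set_integrable lebesgue U (\<lambda>x. 1 / t)" by (intro continuous_set_integrable[OF U]) auto
  have s: "set_integrable lebesgue U (\<lambda>x. t * (cmod (f x))\<^sup>2)"
    using L2_on_square_integrable[OF f] by (intro set_integrable_mult_right) auto
  have 1: "(LINT x:U|lebesgue. cmod (f x)) \<le> (LINT x:U|lebesgue. t * (cmod (f x))\<^sup>2 + 1 / t)"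
  proof (rule set_integral_mono)
    show "set_integrable lebesgue U (\<lambda>x. cmod (f x))"
      by (rule set_integrable_norm[OF L2_on_integrable[OF f U]])
    show "set_integrable lebesgue U (\<lambda>x. t * (cmod (f x))\<^sup>2 + 1 / t)"
      by (rule set_integral_add(1)[OF s c])
    fix x
    have "0 \<le> t * (cmod (f x) - 1 / t)\<^sup>2" using t by simp
    also have "\<dots> = t * (cmod (f x))\<^sup>2 - 2 * cmod (f x) + 1 / t" using t by (simp add: power2_eq_square field_simps)
    finally show "cmod (f x) \<le> t * (cmod (f x))\<^sup>2 + 1 / t" using norm_ge_zero[of "f x"] by linarith
  qed
  have "(LINT x:U|lebesgue. t * (cmod (f x))\<^sup>2 + 1 / t) = t * (LINT x:U|lebesgue. (cmod (f x))\<^sup>2) + (LINT x:U|lebesgue. 1 / t)"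
    using set_integral_add(2)[OF s c] by simp
  moreover have "(LINT x:U|lebesgue. 1 / t) = measure lebesgue U / t"
    unfolding set_lebesgue_integral_def using bounded_lebesgue_set_finite[OF U] U by (simp)
  ultimately show ?thesis using 1 by argo
qed

lemma L2_on_diff:
  assumes "f \<in> L2_on U" "g \<in> L2_on U"
  shows "(\<lambda>x. f x - g x) \<in> L2_on U"
proof -
  have m: "set_borel_measurable lebesgue U (\<lambda>x. f x - g x)"
    using assms unfolding L2_on_def set_borel_measurable_def by (auto simp: scaleR_diff_right)
  have "set_integrable lebesgue U (\<lambda>x. 2 * (cmod (f x))\<^sup>2 + 2 * (cmod (g x))\<^sup>2)"
    using assms by (intro set_integral_add(1) set_integrable_mult_right) (auto simp: L2_on_def)
  then have "set_integrable lebesgue U (\<lambda>x. (cmod (f x - g x))\<^sup>2)"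
    unfolding set_integrable_def
  proof (rule Bochner_Integration.integrable_bound)
    have "(\<lambda>x. (cmod (indicat_real U x *\<^sub>R (f x - g x)))\<^sup>2) \<in> borel_measurable lebesgue"
      using m unfolding set_borel_measurable_def by measurable
    moreover have "(\<lambda>x. (cmod (indicat_real U x *\<^sub>R (f x - g x)))\<^sup>2) = (\<lambda>x. indicat_real U x *\<^sub>R (cmod (f x - g x))\<^sup>2)"
      by (auto simp: indicator_def)
    ultimately show "(\<lambda>x. indicat_real U x *\<^sub>R (cmod (f x - g x))\<^sup>2) \<in> borel_measurable lebesgue" by simp
    have "(cmod (a - b))\<^sup>2 \<le> 2 * (cmod a)\<^sup>2 + 2 * (cmod b)\<^sup>2" for a b
    proof -
      have "(cmod (a - b))\<^sup>2 \<le> (cmod a + cmod b)\<^sup>2" by (intro power_mono norm_triangle_ineq4) auto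
      also have "\<dots> \<le> 2 * (cmod a)\<^sup>2 + 2 * (cmod b)\<^sup>2"
        using sum_squares_bound[of "cmod a" "cmod b"] by (simp add: power2_sum)
      finally show ?thesis .
    qed
    then show "AE x in lebesgue. norm (indicat_real U x *\<^sub>R (cmod (f x - g x))\<^sup>2)
         \<le> norm (indicat_real U x *\<^sub>R (2 * (cmod (f x))\<^sup>2 + 2 * (cmod (g x))\<^sup>2))"
      by (auto simp: indicator_def intro: order_trans[OF _ abs_ge_self])
  qed
  then show ?thesis using m by (simp add: L2_on_def)
qed

lemma smooth_L2_on:
  fixes f :: "real^'n::finite \<Rightarrow> complex"
  assumes f: "smooth f" and U: "bounded U" "U \<in> sets lebesgue"
  shows "f \<in> L2_on U"
proof -
  have "set_borel_measurable lebesgue U f"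
    unfolding set_borel_measurable_def
    using borel_measurable_indicator[OF U(2), where 'b=real] smooth_measurable[OF f] by (rule borel_measurable_scaleR)
  moreover have "set_integrable lebesgue U (\<lambda>x. (cmod (f x))\<^sup>2)"
    by (intro continuous_set_integrable[OF U] continuous_intros smooth_continuous_on f)
  ultimately show ?thesis by (simp add: L2_on_def)
qed

lemma L2_on_subset:
  assumes f: "f \<in> L2_on U" and V: "V \<subseteq> U" "V \<in> sets lebesgue"
  shows "f \<in> L2_on V"
proof -
  have "set_borel_measurable lebesgue V f"
  proof -
    have "(\<lambda>x. indicat_real V x *\<^sub>R (indicat_real U x *\<^sub>R f x)) \<in> borel_measurable lebesgue"
      using borel_measurable_indicator[OF V(2), where 'b=real]
        f[unfolded L2_on_def set_borel_measurable_def, simplified, THEN conjunct1]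
      by (rule borel_measurable_scaleR)
    moreover have "(\<lambda>x. indicat_real V x *\<^sub>R (indicat_real U x *\<^sub>R f x)) = (\<lambda>x. indicat_real V x *\<^sub>R f x)"
    proof
      show "indicat_real V x *\<^sub>R (indicat_real U x *\<^sub>R f x) = indicat_real V x *\<^sub>R f x" for x
        using V by (cases "x \<in> V") auto
    qed
    ultimately show ?thesis by (simp add: set_borel_measurable_def)
  qed
  then show ?thesis using f V set_integrable_subset unfolding L2_on_def by blast
qed

lemma L2_norm_on_power2: "(L2_norm_on U f)\<^sup>2 = (LINT x:U|lebesgue. (cmod (f x))\<^sup>2)"
  unfolding L2_norm_on_def by (auto simp: set_lebesgue_integral_def intro!: real_sqrt_pow2 integral_nonneg_AE)

lemma set_integrable_mult_bounded:
  fixes f h :: "'a::euclidean_space \<Rightarrow> complex"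
  assumes f: "set_integrable lebesgue U f" and h: "h \<in> borel_measurable lebesgue"
    and b: "\<And>x. x \<in> U \<Longrightarrow> cmod (h x) \<le> C"
  shows "set_integrable lebesgue U (\<lambda>x. f x * h x)"
proof -
  have "integrable lebesgue (\<lambda>x. C *\<^sub>R (indicator U x *\<^sub>R f x))" using f unfolding set_integrable_def by (rule integrable_scaleR_right)
  then show ?thesis unfolding set_integrable_def
  proof (rule Bochner_Integration.integrable_bound)
    have "(\<lambda>x. (indicat_real U x *\<^sub>R f x) * h x) \<in> borel_measurable lebesgue"
      using f h unfolding set_integrable_def by measurable
    then show "(\<lambda>x. indicat_real U x *\<^sub>R (f x * h x)) \<in> borel_measurable lebesgue" by simp
    show "AE x in lebesgue. norm (indicat_real U x *\<^sub>R (f x * h x)) \<le> norm (C *\<^sub>R (indicat_real U x *\<^sub>R f x))"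
    proof (rule AE_I2)
      fix x
      show "norm (indicat_real U x *\<^sub>R (f x * h x)) \<le> norm (C *\<^sub>R (indicat_real U x *\<^sub>R f x))"
      proof (cases "x \<in> U")
        case True
        have "cmod (f x) * cmod (h x) \<le> cmod (f x) * \<bar>C\<bar>"
          using b[OF True] by (intro mult_left_mono) auto
        then show ?thesis using True by (simp add: norm_mult mult.commute)
      qed simp
    qed
  qed
qed

lemma set_integrable_mult_smooth:
  fixes f :: "real^'n::finite \<Rightarrow> complex"
  assumes "set_integrable lebesgue U f" "smooth h" "bounded U"
  shows "set_integrable lebesgue U (\<lambda>x. f x * h x)"
proof -
  obtain C where "\<And>x. x \<in> U \<Longrightarrow> cmod (h x) \<le> C" using smooth_bounded_on[OF assms(2,3)] by blast
  then show ?thesis using assms smooth_measurable by (intro set_integrable_mult_bounded) auto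
qed

subsection \<open>Weak derivatives\<close>

lemma has_weak_pderivs_diff:
  fixes U :: "(real^'n::finite) set"
  assumes U: "bounded U"
    and i: "set_integrable lebesgue U f" "set_integrable lebesgue U f'" "set_integrable lebesgue U g" "set_integrable lebesgue U g'"
    and w: "has_weak_pderivs U is f f'" "has_weak_pderivs U is g g'"
  shows "has_weak_pderivs U is (\<lambda>x. f x - g x) (\<lambda>x. f' x - g' x)"
  unfolding has_weak_pderivs_def
proof
  fix \<eta> assume \<eta>: "\<eta> \<in> test_functions U"
  note m = set_integrable_mult_smooth[OF _ _ U]
  have s: "smooth \<eta>" "smooth (pderivs is \<eta>)" using \<eta> by (auto intro: test_functions_smooth smooth_pderivs)
  show "(LINT x:U|lebesgue. (f x - g x) * pderivs is \<eta> x) = (- 1) ^ length is * (LINT x:U|lebesgue. (f' x - g' x) * \<eta> x)"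
    using w \<eta> unfolding has_weak_pderivs_def left_diff_distrib
      set_integral_diff(2)[OF m[OF i(1) s(2)] m[OF i(3) s(2)]] set_integral_diff(2)[OF m[OF i(2) s(1)] m[OF i(4) s(1)]]
    by (simp add: right_diff_distrib)
qed

text \<open>This allows the function selected by \<open>SOME\<close> in \<open>weak_pderivs\<close>
  to be exchanged for any known weak derivative, and so makes \<open>sobolev_norm\<close>
  usable.\<close>

lemma has_weak_pderivs_unique:
  fixes U :: "(real^'n::finite) set"
  assumes U: "open U" "bounded U" and i: "set_integrable lebesgue U g" "set_integrable lebesgue U g'"
    and w: "has_weak_pderivs U is f g" "has_weak_pderivs U is f g'"
  shows "AE x in lebesgue. x \<in> U \<longrightarrow> g x = g' x"
proof -
  have "AE x in lebesgue. x \<in> U \<longrightarrow> g x - g' x = 0"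
  proof (rule test_functions_orthogonal_AE[OF U])
    show "set_integrable lebesgue U (\<lambda>x. g x - g' x)" by (rule set_integral_diff(1)[OF i])
    fix \<eta> assume \<eta>: "\<eta> \<in> test_functions U"
    note m = set_integrable_mult_smooth[OF _ test_functions_smooth[OF \<eta>] U(2)]
    have "(- 1) ^ length is * (LINT x:U|lebesgue. g x * \<eta> x) = (- 1) ^ length is * (LINT x:U|lebesgue. g' x * \<eta> x)"
      using w[unfolded has_weak_pderivs_def, THEN bspec, OF \<eta>] by simp
    then show "(LINT x:U|lebesgue. (g x - g' x) * \<eta> x) = 0"
      unfolding left_diff_distrib set_integral_diff(2)[OF m[OF i(1)] m[OF i(2)]] by simp
  qed
  then show ?thesis by eventually_elim simp
qed

lemma has_weak_pderivs_subset:
  assumes w: "has_weak_pderivs U is f g" and V: "V \<subseteq> U"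
  shows "has_weak_pderivs V is f g"
  unfolding has_weak_pderivs_def
proof
  fix \<eta> assume \<eta>: "\<eta> \<in> test_functions V"
  show "(LINT x:V|lebesgue. f x * pderivs is \<eta> x) = (- 1) ^ length is * (LINT x:V|lebesgue. g x * \<eta> x)"
    using w test_functions_mono[OF \<eta> V]
      set_integral_test_function_mono[OF test_functions_pderivs[OF \<eta>] V, of f "is"] set_integral_test_function_mono[OF \<eta> V, of g]
    unfolding has_weak_pderivs_def by simp
qed

text \<open>The derivative of a test function is a test function, so the identity for
  \<open>is\<close> may be applied to \<open>pderiv_dir i \<eta>\<close>. As \<open>i\<close> acts
  on \<open>\<eta>\<close> first, it stands at the end of the list.\<close>

lemma has_weak_pderivs_step:
  assumes "has_weak_pderivs U is f g" "has_weak_pderivs U (is @ [i]) f h"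
  shows "has_weak_pderivs U [i] g h"
  unfolding has_weak_pderivs_def
proof
  fix \<eta> assume \<eta>: "\<eta> \<in> test_functions U"
  have "(LINT x:U|lebesgue. f x * pderivs is (pderiv_dir i \<eta>) x) = (- 1) ^ length is * (LINT x:U|lebesgue. g x * pderiv_dir i \<eta> x)"
    using assms(1) test_functions_pderiv_dir[OF \<eta>] unfolding has_weak_pderivs_def by blast
  moreover have "(LINT x:U|lebesgue. f x * pderivs is (pderiv_dir i \<eta>) x) = (- 1) ^ Suc (length is) * (LINT x:U|lebesgue. h x * \<eta> x)"
    using assms(2) \<eta> unfolding has_weak_pderivs_def by (simp add: pderivs_append)
  ultimately show "(LINT x:U|lebesgue. g x * pderivs [i] \<eta> x) = (- 1) ^ length [i] * (LINT x:U|lebesgue. h x * \<eta> x)"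
    by (cases "even (length is)") auto
qed

section \<open>A Poincare inequality on convex sets\<close>

text \<open>Differentiation under the integral sign, relative to \<open>S\<close> so as to cover the
  end points of an interval. The mean value inequality turns the bound on \<open>k'\<close> into one
  on the difference quotients. The bound is asked only where \<open>f\<close> is nonzero, which in
  the application is a bounded set.\<close>

lemma has_vector_derivative_integral_dominated:
  fixes f :: "'a::euclidean_space \<Rightarrow> complex" and k :: "real \<Rightarrow> 'a \<Rightarrow> complex"
  assumes f: "integrable lebesgue f" and S: "convex S" "t \<in> S"
    and k: "\<And>s x. s \<in> S \<Longrightarrow> ((\<lambda>s. k s x) has_vector_derivative k' s x) (at s within S)"
    and i: "\<And>s. s \<in> S \<Longrightarrow> integrable lebesgue (\<lambda>x. f x * k s x)"
    and m: "k' t \<in> borel_measurable lebesgue"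
    and C: "\<And>s x. s \<in> S \<Longrightarrow> f x \<noteq> 0 \<Longrightarrow> cmod (k' s x) \<le> C"
  shows "((\<lambda>s. \<integral>x. f x * k s x \<partial>lebesgue) has_vector_derivative (\<integral>x. f x * k' t x \<partial>lebesgue)) (at t within S)"
  unfolding has_vector_derivative_iff_quotient tendsto_at_iff_sequentially
proof (intro allI impI)
  fix X assume X: "\<forall>n. X n \<in> S - {t}" "X \<longlonglongrightarrow> t"
  define q where "q n x = f x * ((k (X n) x - k t x) /\<^sub>R (X n - t))" for n x
  have q: "q n x = inverse (X n - t) *\<^sub>R (f x * k (X n) x - f x * k t x)" for n x
    by (simp add: q_def right_diff_distrib)
  have ii: "integrable lebesgue (\<lambda>x. f x * k (X n) x)" "integrable lebesgue (\<lambda>x. f x * k t x)" for n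
    using i X(1) S(2) by auto
  have "(\<lambda>n. \<integral>x. q n x \<partial>lebesgue) \<longlonglongrightarrow> (\<integral>x. f x * k' t x \<partial>lebesgue)"
  proof (rule integral_dominated_convergence[where w="\<lambda>x. cmod (f x) * C"])
    show "(\<lambda>x. f x * k' t x) \<in> borel_measurable lebesgue" using f m by measurable
    show "q n \<in> borel_measurable lebesgue" for n
      unfolding q by (intro borel_measurable_scaleR borel_measurable_const borel_measurable_diff borel_measurable_integrable ii)
    show "integrable lebesgue (\<lambda>x. cmod (f x) * C)" using f by auto
    show "AE x in lebesgue. (\<lambda>n. q n x) \<longlonglongrightarrow> f x * k' t x"
    proof (rule AE_I2)
      fix x
      have "((\<lambda>s. (k s x - k t x) /\<^sub>R (s - t)) \<longlongrightarrow> k' t x) (at t within S)"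
        using k[OF S(2), of x] by (simp add: has_vector_derivative_iff_quotient)
      then have "((\<lambda>s. (k s x - k t x) /\<^sub>R (s - t)) \<circ> X) \<longlonglongrightarrow> k' t x"
        unfolding tendsto_at_iff_sequentially using X by blast
      then show "(\<lambda>n. q n x) \<longlonglongrightarrow> f x * k' t x"
        unfolding q_def o_def by (intro tendsto_mult tendsto_const)
    qed
    show "AE x in lebesgue. norm (q n x) \<le> cmod (f x) * C" for n
    proof (rule AE_I2)
      fix x
      show "norm (q n x) \<le> cmod (f x) * C"
      proof (cases "f x = 0")
        case False
        have n: "X n \<noteq> t" "X n \<in> S" using X(1) by auto
        have "cmod (k (X n) x - k t x) \<le> C * \<bar>X n - t\<bar>"
          by (rule vector_derivative_norm_bound[OF S(1) k C[OF _ False] S(2) n(2)])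
        then have "cmod ((k (X n) x - k t x) /\<^sub>R (X n - t)) \<le> C"
          using n by (simp add: divide_simps mult.commute)
        then show ?thesis unfolding q_def norm_mult by (intro mult_left_mono) auto
      qed (simp add: q_def)
    qed
  qed
  then show "((\<lambda>s. ((\<integral>x. f x * k s x \<partial>lebesgue) - (\<integral>x. f x * k t x \<partial>lebesgue)) /\<^sub>R (s - t)) \<circ> X) \<longlonglongrightarrow> (\<integral>x. f x * k' t x \<partial>lebesgue)"
    unfolding q o_def integral_scaleR_right Bochner_Integration.integral_diff[OF ii] .
qed

text \<open>Substituting \<open>(1 - \<kappa>) z + \<kappa> y\<close> contracts the support towards
  \<open>z\<close> by the factor \<open>1 / \<kappa>\<close>. Contraction towards a point of the
  closure keeps compact subsets of an open convex set inside it.\<close>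

lemma test_functions_dilation:
  fixes D :: "(real^'n::finite) set"
  assumes D: "open D" "convex D" and z: "z \<in> closure D" and \<eta>: "\<eta> \<in> test_functions D" and \<kappa>: "\<kappa> \<ge> 1"
  shows "(\<lambda>y. \<eta> ((1 - \<kappa>) *\<^sub>R z + \<kappa> *\<^sub>R y)) \<in> test_functions D"
proof -
  obtain K where K: "compact K" "K \<subseteq> D" "\<forall>x. x \<notin> K \<longrightarrow> \<eta> x = 0"
    using test_functionsD[OF \<eta>] by blast
  let ?h = "\<lambda>k. z - (1 / \<kappa>) *\<^sub>R (z - k)"
  show ?thesis
  proof (rule test_functionsI[of _ "?h ` K"])
    show "smooth (\<lambda>y. \<eta> ((1 - \<kappa>) *\<^sub>R z + \<kappa> *\<^sub>R y))"
      using \<kappa> by (intro smooth_affine test_functions_smooth[OF \<eta>]) auto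
    show "compact (?h ` K)" by (intro compact_continuous_image continuous_intros K)
    show "?h ` K \<subseteq> D"
    proof clarify
      fix k assume "k \<in> K"
      then have "k \<in> interior D" using K D by (auto simp: interior_open)
      from mem_interior_closure_convex_shrink[OF D(2) this z, of "1 / \<kappa>"]
      show "?h k \<in> D" using \<kappa> D by (simp add: interior_open)
    qed
    show "\<eta> ((1 - \<kappa>) *\<^sub>R z + \<kappa> *\<^sub>R x) = 0" if "x \<notin> ?h ` K" for x
    proof -
      have "x = ?h ((1 - \<kappa>) *\<^sub>R z + \<kappa> *\<^sub>R x)"
        using \<kappa> by (simp add: algebra_simps)
      then show ?thesis using that K(3) by blast
    qed
  qed
qed

text \<open>The function \<open>\<kappa> \<mapsto> \<integral> f(y) \<kappa>\<^sup>n \<eta>((1 - \<kappa>) z + \<kappa> y) dy\<close> takes the values \<open>\<integral> f(x) \<eta>(x) dx\<close> at \<open>\<kappa> = 1\<close> and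
  \<open>\<integral> f((z + x)/2) \<eta>(x) dx\<close> at \<open>\<kappa> = 2\<close>; the \<open>\<kappa>\<close>-derivative of the kernel is a divergence in \<open>y\<close>, which
  brings in the weak gradient of \<open>f\<close>.\<close>

lemma half_dilation_estimate:
  fixes D :: "(real^'n::finite) set"
  assumes D: "open D" "convex D" "bounded D" and z: "z \<in> closure D" and R: "\<And>y. y \<in> D \<Longrightarrow> norm (y - z) \<le> R"
    and f: "set_integrable lebesgue D f" and g: "\<And>i. set_integrable lebesgue D (g i)"
    and w: "\<And>i. has_weak_pderivs D [i] f (g i)"
  shows "set_integrable lebesgue D (\<lambda>x. f ((1/2) *\<^sub>R z + (1/2) *\<^sub>R x))"
    and "(LINT x:D|lebesgue. cmod (f x - f ((1/2) *\<^sub>R z + (1/2) *\<^sub>R x)))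
           \<le> 2 ^ CARD('n) * R * (\<Sum>i\<in>UNIV. LINT x:D|lebesgue. cmod (g i x))"
proof -
  define f' where "f' = (\<lambda>x. indicator D x *\<^sub>R f x)"
  have fi: "integrable lebesgue f'" using f by (simp add: set_integrable_def f'_def)
  have Ds: "D \<in> sets lebesgue" using D by auto
  define h where "h x = (1/2) *\<^sub>R z + (1/2) *\<^sub>R x" for x
  have hD: "h x \<in> D" if "x \<in> D" for x
  proof -
    have "x \<in> interior D" using that D by (simp add: interior_open)
    from mem_interior_closure_convex_shrink[OF D(2) this z, of "1/2"]
    have "z - (1/2) *\<^sub>R (z - x) \<in> D" using D by (simp add: interior_open)
    moreover have "z - (1/2) *\<^sub>R (z - x) = h x" by (simp add: h_def algebra_simps flip: scaleR_2)
    ultimately show ?thesis by simp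
  qed
  have fhi: "integrable lebesgue (\<lambda>x. f' (h x))"
    unfolding h_def by (rule lebesgue_integrable_affine[OF _ fi]) simp
  have e: "indicator D x *\<^sub>R f' (h x) = indicator D x *\<^sub>R f (h x)" for x
    using hD[of x] by (auto simp: f'_def indicator_def)
  have "integrable lebesgue (\<lambda>x. indicator D x *\<^sub>R f' (h x))"
    using fhi by (rule integrable_mult_indicator[OF Ds])
  then have fhs: "set_integrable lebesgue D (\<lambda>x. f (h x))"
    by (simp add: set_integrable_def e)
  then show "set_integrable lebesgue D (\<lambda>x. f ((1/2) *\<^sub>R z + (1/2) *\<^sub>R x))" by (simp add: h_def)
  have R0: "R \<ge> 0" if "D \<noteq> {}" using R that norm_ge_zero order_trans by blast
  define G where "G = (\<Sum>i\<in>UNIV. LINT x:D|lebesgue. cmod (g i x))"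
  have "(LINT x:D|lebesgue. cmod (f x - f (h x))) \<le> 2 ^ CARD('n) * R * G"
  proof (rule L1_duality[OF D(1,3)])
    show "set_integrable lebesgue D (\<lambda>x. f x - f (h x))"
      by (rule set_integral_diff(1)[OF f fhs])
    fix \<eta> assume \<eta>: "\<eta> \<in> test_functions D" and \<eta>1: "\<And>x. cmod (\<eta> x) \<le> 1"
    note sm = test_functions_smooth[OF \<eta>]
    define a where "a \<kappa> y = (1 - \<kappa>) *\<^sub>R z + \<kappa> *\<^sub>R y" for \<kappa> y
    define k where "k \<kappa> y = of_real \<kappa> ^ CARD('n) * \<eta> (a \<kappa> y)" for \<kappa> y
    \<comment> \<open>The vector field with components \<open>\<theta> \<kappa> i\<close> is
      \<open>\<kappa>^(n-1) (y - z) \<eta>(a \<kappa> y)\<close>. Its divergence is the derivative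
      of \<open>k\<close> in \<open>\<kappa>\<close>: the field \<open>y - z\<close> has divergence
      \<open>n\<close>, and the chain rule supplies the missing factor \<open>\<kappa>\<close> in
      the other term.\<close>
    define \<theta> where "\<theta> \<kappa> i y = (of_real \<kappa> ^ (CARD('n) - 1) * (of_real (y $ i) - of_real (z $ i))) * \<eta> (a \<kappa> y)" for \<kappa> i y
    define k' where "k' \<kappa> y = (\<Sum>i\<in>UNIV. pderiv_dir i (\<theta> \<kappa> i) y)" for \<kappa> y
    have n1: "CARD('n) \<ge> 1" using zero_less_card_finite[where 'a='n] by linarith
    have \<eta>a: "(\<lambda>y. \<eta> (a \<kappa> y)) \<in> test_functions D" if "\<kappa> \<ge> 1" for \<kappa>
      unfolding a_def by (rule test_functions_dilation[OF D(1,2) z \<eta> that])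
    have sl: "smooth (\<lambda>y::real^'n. of_real \<kappa> ^ (CARD('n) - 1) * (of_real (y $ i) - of_real (z $ i)))" for \<kappa> i
      by (intro smooth_mult smooth_const smooth_diff smooth_linear bounded_linear_vec_nth)
    have \<theta>: "\<theta> \<kappa> i \<in> test_functions D" if "\<kappa> \<ge> 1" for \<kappa> i
      unfolding \<theta>_def by (rule test_functions_mult[OF sl \<eta>a[OF that]])
    have p\<theta>: "pderiv_dir i (\<theta> \<kappa> i) y = of_real \<kappa> ^ (CARD('n) - 1) * \<eta> (a \<kappa> y)
        + of_real \<kappa> ^ CARD('n) * (of_real (y $ i) - of_real (z $ i)) * pderiv_dir i \<eta> (a \<kappa> y)" if "\<kappa> \<ge> 1" for \<kappa> i y
    proof -
      have d1: "((\<lambda>y::real^'n. complex_of_real \<kappa> ^ (CARD('n) - 1) * (of_real (y $ i) - of_real (z $ i))) has_derivative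
          (\<lambda>h. of_real \<kappa> ^ (CARD('n) - 1) * (of_real (h $ i)))) (at y)"
      proof -
        have "((\<lambda>y::real^'n. complex_of_real (y $ i)) has_derivative (\<lambda>h. of_real (h $ i))) (at y)"
          by (intro bounded_linear_imp_has_derivative bounded_linear_compose[OF bounded_linear_of_real bounded_linear_vec_nth])
        from has_derivative_mult_right[OF has_derivative_diff[OF this has_derivative_const, of "of_real (z $ i)"],
            of "of_real \<kappa> ^ (CARD('n) - 1)"]
        show ?thesis unfolding diff_zero .
      qed
      have d2: "pderiv_dir i (\<lambda>y. \<eta> (a \<kappa> y)) y = of_real \<kappa> * pderiv_dir i \<eta> (a \<kappa> y)"
        unfolding a_def using pderiv_dir_affine[OF sm, of \<kappa> i "(1 - \<kappa>) *\<^sub>R z"] that by simp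
      have e: "complex_of_real \<kappa> ^ CARD('n) = of_real \<kappa> ^ (CARD('n) - 1) * of_real \<kappa>"
        using n1 by (metis Suc_diff_1 less_eq_Suc_le One_nat_def power_Suc2)
      have "pderiv_dir i (\<theta> \<kappa> i) y = (of_real \<kappa> ^ (CARD('n) - 1) * of_real (axis i 1 $ i)) * \<eta> (a \<kappa> y)
          + (of_real \<kappa> ^ (CARD('n) - 1) * (of_real (y $ i) - of_real (z $ i))) * (of_real \<kappa> * pderiv_dir i \<eta> (a \<kappa> y))"
        unfolding \<theta>_def
          pderiv_dir_mult[OF smooth_differentiable[OF sl] smooth_differentiable[OF test_functions_smooth[OF \<eta>a[OF that]]]]
          pderiv_dir_eq[OF d1] d2 ..
      then show ?thesis unfolding e by (simp only: axis_nth of_real_1 mult_1_left mult_1_right mult_ac)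
    qed
    have k'e: "k' \<kappa> y = of_nat CARD('n) * of_real \<kappa> ^ (CARD('n) - 1) * \<eta> (a \<kappa> y)
        + of_real \<kappa> ^ CARD('n) * (\<Sum>i\<in>UNIV. (of_real (y $ i) - of_real (z $ i)) * pderiv_dir i \<eta> (a \<kappa> y))" if "\<kappa> \<ge> 1" for \<kappa> y
      unfolding k'_def p\<theta>[OF that] by (simp add: sum.distrib sum_distrib_left mult.assoc)
    have kd: "((\<lambda>\<kappa>. k \<kappa> y) has_vector_derivative k' \<kappa> y) (at \<kappa> within {1..2})" if "\<kappa> \<in> {1..2}" for \<kappa> y
    proof -
      have "((\<lambda>\<kappa>. a \<kappa> y) has_derivative (\<lambda>h. h *\<^sub>R (y - z))) (at \<kappa> within {1..2})"
        unfolding a_def by (auto intro!: derivative_eq_intros simp: algebra_simps)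
      from has_derivative_compose[OF this smooth_has_derivative[OF sm]]
      have "((\<lambda>\<kappa>. \<eta> (a \<kappa> y)) has_derivative (\<lambda>h. frechet_derivative \<eta> (at (a \<kappa> y)) (h *\<^sub>R (y - z)))) (at \<kappa> within {1..2})" .
      moreover have "frechet_derivative \<eta> (at (a \<kappa> y)) (h *\<^sub>R (y - z))
          = h *\<^sub>R (\<Sum>i\<in>UNIV. (of_real (y $ i) - of_real (z $ i)) * pderiv_dir i \<eta> (a \<kappa> y))" for h
        unfolding frechet_pderiv_dir[OF smooth_differentiable[OF sm]]
        by (simp add: scaleR_conv_of_real[where 'a=complex] sum_distrib_left mult.assoc)
      ultimately have 1: "((\<lambda>\<kappa>. \<eta> (a \<kappa> y)) has_vector_derivative (\<Sum>i\<in>UNIV. (of_real (y $ i) - of_real (z $ i)) * pderiv_dir i \<eta> (a \<kappa> y))) (at \<kappa> within {1..2})"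
        by (simp add: has_vector_derivative_def)
      have 2: "((\<lambda>\<kappa>. complex_of_real (\<kappa> ^ CARD('n))) has_vector_derivative of_real (of_nat CARD('n) * \<kappa> ^ (CARD('n) - 1))) (at \<kappa> within {1..2})"
        by (rule has_vector_derivative_of_real) (auto intro!: derivative_eq_intros)
      have "((\<lambda>\<kappa>. complex_of_real (\<kappa> ^ CARD('n)) * \<eta> (a \<kappa> y)) has_vector_derivative k' \<kappa> y) (at \<kappa> within {1..2})"
        using has_vector_derivative_mult[OF 2 1] k'e[of \<kappa> y] that by (simp add: algebra_simps)
      then show ?thesis by (simp add: k_def)
    qed
    obtain C0 where C0: "C0 > 0" "\<And>i x. cmod (pderiv_dir i \<eta> x) \<le> C0"
    proof -
      have "\<forall>i. \<exists>C. C > 0 \<and> (\<forall>x. cmod (pderiv_dir i \<eta> x) \<le> C)"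
        using test_functions_bounded[OF test_functions_pderiv_dir[OF \<eta>]] by metis
      then obtain C where C: "\<And>i. C i > 0" "\<And>i x. cmod (pderiv_dir i \<eta> x) \<le> C i" by metis
      have "C i \<le> (\<Sum>i\<in>UNIV. C i)" for i using C(1) by (intro member_le_sum) (auto intro: less_imp_le)
      moreover have "(\<Sum>i\<in>UNIV. C i) > 0" using C(1) by (intro sum_pos) auto
      ultimately show thesis using that C(2) order_trans by meson
    qed
    \<comment> \<open>This bound involves the derivatives of \<open>\<eta>\<close> through
      \<open>C0\<close>; it serves as domination for differentiating under the integral. The
      quantitative bound is \<open>bm\<close>, where the derivative has been moved to
      \<open>g\<close> and only \<open>cmod (\<eta> x) \<le> 1\<close> enters.\<close>
    have kb: "cmod (k' \<kappa> y) \<le> of_nat CARD('n) * 2 ^ (CARD('n) - 1) + 2 ^ CARD('n) * (\<Sum>i\<in>(UNIV::'n set). R * C0)"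
      if k: "\<kappa> \<in> {1..2}" and y: "y \<in> D" for \<kappa> y
    proof -
      have c: "\<bar>y $ i - z $ i\<bar> \<le> R" for i
        using component_le_norm_cart[of "y - z" i] R[OF y] by simp
      have "cmod (k' \<kappa> y) \<le> of_nat CARD('n) * \<kappa> ^ (CARD('n) - 1) * cmod (\<eta> (a \<kappa> y))
        + \<kappa> ^ CARD('n) * (\<Sum>i\<in>UNIV. \<bar>y $ i - z $ i\<bar> * cmod (pderiv_dir i \<eta> (a \<kappa> y)))"
      proof -
        have "cmod (\<Sum>i\<in>UNIV. (of_real (y $ i) - of_real (z $ i)) * pderiv_dir i \<eta> (a \<kappa> y))
           \<le> (\<Sum>i\<in>UNIV. cmod ((of_real (y $ i) - of_real (z $ i)) * pderiv_dir i \<eta> (a \<kappa> y)))"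
          by (rule norm_sum)
        also have "\<dots> = (\<Sum>i\<in>UNIV. \<bar>y $ i - z $ i\<bar> * cmod (pderiv_dir i \<eta> (a \<kappa> y)))"
          by (simp add: norm_mult flip: of_real_diff)
        finally have s: "cmod (\<Sum>i\<in>UNIV. (of_real (y $ i) - of_real (z $ i)) * pderiv_dir i \<eta> (a \<kappa> y)) \<le> (\<Sum>i\<in>UNIV. \<bar>y $ i - z $ i\<bar> * cmod (pderiv_dir i \<eta> (a \<kappa> y)))" .
        have "\<kappa> ^ CARD('n) * cmod (\<Sum>i\<in>UNIV. (of_real (y $ i) - of_real (z $ i)) * pderiv_dir i \<eta> (a \<kappa> y)) \<le> \<kappa> ^ CARD('n) * (\<Sum>i\<in>UNIV. \<bar>y $ i - z $ i\<bar> * cmod (pderiv_dir i \<eta> (a \<kappa> y)))"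
          by (rule mult_left_mono[OF s]) (use k in auto)
        note s' = this
        have keq: "k' \<kappa> y = of_nat CARD('n) * of_real \<kappa> ^ (CARD('n) - 1) * \<eta> (a \<kappa> y)
            + of_real \<kappa> ^ CARD('n) * (\<Sum>i\<in>UNIV. (of_real (y $ i) - of_real (z $ i)) * pderiv_dir i \<eta> (a \<kappa> y))"
          using k by (intro k'e) auto
        have nA: "cmod (of_nat CARD('n) * of_real \<kappa> ^ (CARD('n) - 1) * \<eta> (a \<kappa> y)) = of_nat CARD('n) * \<kappa> ^ (CARD('n) - 1) * cmod (\<eta> (a \<kappa> y))"
          using k by (simp add: norm_mult norm_power)
        have nB: "cmod (of_real \<kappa> ^ CARD('n) * (\<Sum>i\<in>UNIV. (of_real (y $ i) - of_real (z $ i)) * pderiv_dir i \<eta> (a \<kappa> y)))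
            = \<kappa> ^ CARD('n) * cmod (\<Sum>i\<in>UNIV. (of_real (y $ i) - of_real (z $ i)) * pderiv_dir i \<eta> (a \<kappa> y))"
          using k by (simp add: norm_mult norm_power)
        show ?thesis unfolding keq
          by (rule norm_triangle_le) (unfold nA nB, rule add_left_mono[OF s'])
      qed
      also have "\<dots> \<le> of_nat CARD('n) * 2 ^ (CARD('n) - 1) * 1 + 2 ^ CARD('n) * (\<Sum>i\<in>(UNIV::'n set). R * C0)"
        using k c C0 \<eta>1 R0 y by (intro add_mono mult_mono sum_mono power_mono sum_nonneg) auto
      finally show ?thesis by simp
    qed
    have ki: "integrable lebesgue (\<lambda>x. f' x * k \<kappa> x)" if "\<kappa> \<in> {1..2}" for \<kappa>
    proof -
      have "k \<kappa> \<in> test_functions D" unfolding k_def using that by (intro test_functions_mult smooth_const \<eta>a) auto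
      from set_integrable_mult_smooth[OF f test_functions_smooth[OF this] D(3)]
      show ?thesis by (simp add: set_integrable_def f'_def)
    qed
    have sk': "smooth (k' \<kappa>)" if "\<kappa> \<in> {1..2}" for \<kappa>
      unfolding k'_def using that by (intro smooth_sum smooth_pderiv_dir test_functions_smooth[OF \<theta>]) auto
    have dm: "((\<lambda>\<kappa>. \<integral>x. f' x * k \<kappa> x \<partial>lebesgue) has_vector_derivative (\<integral>x. f' x * k' \<kappa> x \<partial>lebesgue)) (at \<kappa> within {1..2})"
      if "\<kappa> \<in> {1..2}" for \<kappa>
      using fi that kd ki smooth_measurable[OF sk'] kb
      by (intro has_vector_derivative_integral_dominated[where C="of_nat CARD('n) * 2 ^ (CARD('n) - 1) + 2 ^ CARD('n) * (\<Sum>i\<in>(UNIV::'n set). R * C0)"])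
         (auto simp: f'_def indicator_def split: if_splits)
    have bm: "cmod (\<integral>x. f' x * k' \<kappa> x \<partial>lebesgue) \<le> 2 ^ CARD('n) * R * G" if k: "\<kappa> \<in> {1..2}" for \<kappa>
    proof -
      have 1: "(\<integral>x. f' x * k' \<kappa> x \<partial>lebesgue) = (\<Sum>i\<in>UNIV. \<integral>x. f' x * pderiv_dir i (\<theta> \<kappa> i) x \<partial>lebesgue)"
      proof -
        have "integrable lebesgue (\<lambda>x. f' x * pderiv_dir i (\<theta> \<kappa> i) x)" for i
          using set_integrable_mult_smooth[OF f smooth_pderiv_dir[OF test_functions_smooth[OF \<theta>]] D(3), of \<kappa>] k
          by (auto simp: set_integrable_def f'_def)
        then show ?thesis unfolding k'_def sum_distrib_left by (intro Bochner_Integration.integral_sum)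
      qed
      have 2: "cmod (\<integral>x. f' x * pderiv_dir i (\<theta> \<kappa> i) x \<partial>lebesgue) \<le> (2 ^ CARD('n) * R) * (LINT x:D|lebesgue. cmod (g i x))" for i
      proof -
        have "(\<integral>x. f' x * pderiv_dir i (\<theta> \<kappa> i) x \<partial>lebesgue) = (LINT x:D|lebesgue. f x * pderivs [i] (\<theta> \<kappa> i) x)"
          by (simp add: set_lebesgue_integral_def f'_def)
        also have "\<dots> = - (LINT x:D|lebesgue. g i x * \<theta> \<kappa> i x)"
          using w[of i] \<theta>[of \<kappa> i] k unfolding has_weak_pderivs_def by simp
        finally have "cmod (\<integral>x. f' x * pderiv_dir i (\<theta> \<kappa> i) x \<partial>lebesgue) = cmod (LINT x:D|lebesgue. g i x * \<theta> \<kappa> i x)" by simp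
        also have "\<dots> \<le> (\<integral>x. cmod (indicator D x *\<^sub>R (g i x * \<theta> \<kappa> i x)) \<partial>lebesgue)"
          unfolding set_lebesgue_integral_def by (rule integral_norm_bound)
        also have "\<dots> \<le> (\<integral>x. (2 ^ CARD('n) * R) *\<^sub>R (indicator D x *\<^sub>R cmod (g i x)) \<partial>lebesgue)"
        proof (rule integral_mono)
          show "integrable lebesgue (\<lambda>x. cmod (indicator D x *\<^sub>R (g i x * \<theta> \<kappa> i x)))"
            using set_integrable_mult_smooth[OF g test_functions_smooth[OF \<theta>] D(3), of \<kappa> i] k
            by (intro integrable_norm) (auto simp: set_integrable_def)
          show "integrable lebesgue (\<lambda>x. (2 ^ CARD('n) * R) *\<^sub>R (indicator D x *\<^sub>R cmod (g i x)))"
            using set_integrable_norm[OF g[of i]] unfolding set_integrable_def by (rule integrable_scaleR_right)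
          fix x
          show "cmod (indicator D x *\<^sub>R (g i x * \<theta> \<kappa> i x)) \<le> (2 ^ CARD('n) * R) *\<^sub>R (indicator D x *\<^sub>R cmod (g i x))"
          proof (cases "x \<in> D")
            case True
            have "0 \<le> R" using R0 True by blast
            moreover have "\<bar>x $ i - z $ i\<bar> \<le> R" using component_le_norm_cart[of "x - z" i] R[OF True] by simp
            moreover have "\<kappa> ^ (CARD('n) - 1) \<le> 2 ^ CARD('n)"
            proof -
              have "\<kappa> ^ (CARD('n) - 1) \<le> 2 ^ (CARD('n) - 1)" using k by (intro power_mono) auto
              also have "\<dots> \<le> (2::real) ^ CARD('n)" by (intro power_increasing) auto
              finally show ?thesis .
            qed
            ultimately have "\<kappa> ^ (CARD('n) - 1) * \<bar>x $ i - z $ i\<bar> * cmod (\<eta> (a \<kappa> x)) \<le> 2 ^ CARD('n) * R * 1"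
              using k \<eta>1 by (intro mult_mono) auto
            then have "cmod (\<theta> \<kappa> i x) \<le> 2 ^ CARD('n) * R"
              using k by (simp add: \<theta>_def norm_mult norm_power flip: of_real_diff)
            then have "cmod (g i x) * cmod (\<theta> \<kappa> i x) \<le> cmod (g i x) * (2 ^ CARD('n) * R)" by (intro mult_left_mono) auto
            then show ?thesis using True by (simp add: norm_mult mult_ac)
          qed simp
        qed
        finally show ?thesis by (simp add: set_lebesgue_integral_def)
      qed
      show ?thesis unfolding 1 G_def sum_distrib_left
        by (rule order_trans[OF norm_sum sum_mono[OF 2]])
    qed
    have "cmod ((\<integral>x. f' x * k 2 x \<partial>lebesgue) - (\<integral>x. f' x * k 1 x \<partial>lebesgue)) \<le> 2 ^ CARD('n) * R * G * \<bar>2 - 1\<bar>"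
      by (rule vector_derivative_norm_bound[OF convex_real_interval(5) dm bm]) auto
    moreover have "(\<integral>x. f' x * k 1 x \<partial>lebesgue) = (LINT x:D|lebesgue. f x * \<eta> x)"
      by (simp add: k_def a_def f'_def set_lebesgue_integral_def)
    moreover have "(\<integral>x. f' x * k 2 x \<partial>lebesgue) = (LINT x:D|lebesgue. f (h x) * \<eta> x)"
    proof -
      \<comment> \<open>The Jacobian \<open>2^(-n)\<close> cancels the factor
        \<open>\<kappa>^n = 2^n\<close> of the kernel.\<close>
      have "(\<integral>x. f' x * k 2 x \<partial>lebesgue) = \<bar>1/2\<bar> ^ DIM(real^'n) *\<^sub>R (\<integral>x. f' ((1/2) *\<^sub>R z + (1/2) *\<^sub>R x) * k 2 ((1/2) *\<^sub>R z + (1/2) *\<^sub>R x) \<partial>lebesgue)"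
        by (rule lebesgue_integral_affine[OF _ ki]) auto
      also have "(\<lambda>x. f' ((1/2) *\<^sub>R z + (1/2) *\<^sub>R x) * k 2 ((1/2) *\<^sub>R z + (1/2) *\<^sub>R x)) = (\<lambda>x. 2 ^ CARD('n) * (indicator D x *\<^sub>R (f (h x) * \<eta> x)))"
      proof
        fix x
        have "a 2 ((1/2) *\<^sub>R z + (1/2) *\<^sub>R x) = x" by (simp add: a_def scaleR_add_right)
        then show "f' ((1/2) *\<^sub>R z + (1/2) *\<^sub>R x) * k 2 ((1/2) *\<^sub>R z + (1/2) *\<^sub>R x) = 2 ^ CARD('n) * (indicator D x *\<^sub>R (f (h x) * \<eta> x))"
          using hD[of x] test_functions_outside[OF \<eta>, of x]
          by (auto simp: k_def f'_def h_def indicator_def)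
      qed
      finally show ?thesis
        by (simp add: set_lebesgue_integral_def power_divide scaleR_conv_of_real)
    qed
    moreover have "(LINT x:D|lebesgue. (f x - f (h x)) * \<eta> x) = (LINT x:D|lebesgue. f x * \<eta> x) - (LINT x:D|lebesgue. f (h x) * \<eta> x)"
      unfolding left_diff_distrib
      by (rule set_integral_diff(2)[OF set_integrable_mult_smooth[OF f sm D(3)] set_integrable_mult_smooth[OF fhs sm D(3)]])
    ultimately show "cmod (LINT x:D|lebesgue. (f x - f (h x)) * \<eta> x) \<le> 2 ^ CARD('n) * R * G"
      by (simp add: norm_minus_commute)
  qed
  then show "(LINT x:D|lebesgue. cmod (f x - f ((1/2) *\<^sub>R z + (1/2) *\<^sub>R x)))
           \<le> 2 ^ CARD('n) * R * (\<Sum>i\<in>UNIV. LINT x:D|lebesgue. cmod (g i x))"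
    by (simp add: h_def G_def)
qed

text \<open>Fubini's theorem in \<open>poincare_borel\<close> rests on joint measurability of
  \<open>f ((z + x) / 2)\<close> in \<open>(x, z)\<close>, which is immediate for a Borel function;
  so a Borel representative is fixed first.\<close>

lemma complex_borel_version:
  fixes f :: "'a::euclidean_space \<Rightarrow> complex"
  assumes "f \<in> borel_measurable lebesgue"
  obtains F where "F \<in> borel_measurable borel" "AE x in lebesgue. f x = F x"
proof -
  have r: "(\<lambda>x. Re (f x)) \<in> borel_measurable (completion lborel)" "(\<lambda>x. Im (f x)) \<in> borel_measurable (completion lborel)"
    using assms by (auto intro: measurable_compose[OF _ borel_measurable_Re] measurable_compose[OF _ borel_measurable_Im])
  obtain F1 where F1: "F1 \<in> borel_measurable lborel" "AE x in lborel. Re (f x) = F1 x"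
    using completion_ex_borel_measurable_real[OF r(1)] by blast
  obtain F2 where F2: "F2 \<in> borel_measurable lborel" "AE x in lborel. Im (f x) = F2 x"
    using completion_ex_borel_measurable_real[OF r(2)] by blast
  show thesis
  proof (rule that[of "\<lambda>x. Complex (F1 x) (F2 x)"])
    have [measurable]: "F1 \<in> borel_measurable borel" "F2 \<in> borel_measurable borel"
      using F1(1) F2(1) by auto
    show "(\<lambda>x. Complex (F1 x) (F2 x)) \<in> borel_measurable borel"
      unfolding Complex_eq by measurable
    have "AE x in lborel. f x = Complex (F1 x) (F2 x)"
      using F1(2) F2(2) by eventually_elim (simp add: complex_eq_iff)
    then show "AE x in lebesgue. f x = Complex (F1 x) (F2 x)" by (rule AE_completion)
  qed
qed

lemma set_integral_AE_cong:
  fixes f f' :: "'a::euclidean_space \<Rightarrow> complex"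
  assumes "AE x in lebesgue. x \<in> U \<longrightarrow> f x = f' x"
    "(\<lambda>x. indicator U x *\<^sub>R f x) \<in> borel_measurable lebesgue" "(\<lambda>x. indicator U x *\<^sub>R f' x) \<in> borel_measurable lebesgue"
    and h: "h \<in> borel_measurable lebesgue"
  shows "(LINT x:U|lebesgue. f x * h x) = (LINT x:U|lebesgue. f' x * h x)"
  unfolding set_lebesgue_integral_def
proof (rule integral_cong_AE)
  show "AE x in lebesgue. indicat_real U x *\<^sub>R (f x * h x) = indicat_real U x *\<^sub>R (f' x * h x)"
    using assms(1) by eventually_elim (auto simp: indicator_def)
  have "(\<lambda>x. (indicat_real U x *\<^sub>R f x) * h x) \<in> borel_measurable lebesgue" using assms(2) h by measurable
  then show "(\<lambda>x. indicat_real U x *\<^sub>R (f x * h x)) \<in> borel_measurable lebesgue" by simp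
  have "(\<lambda>x. (indicat_real U x *\<^sub>R f' x) * h x) \<in> borel_measurable lebesgue" using assms(3) h by measurable
  then show "(\<lambda>x. indicat_real U x *\<^sub>R (f' x * h x)) \<in> borel_measurable lebesgue" by simp
qed

lemma has_weak_pderivs_AE_cong:
  fixes U :: "(real^'n::finite) set"
  assumes "AE x in lebesgue. x \<in> U \<longrightarrow> f x = f' x" and f: "set_integrable lebesgue U f" "set_integrable lebesgue U f'"
    and w: "has_weak_pderivs U is f g"
  shows "has_weak_pderivs U is f' g"
  unfolding has_weak_pderivs_def
proof
  fix \<eta> assume \<eta>: "\<eta> \<in> test_functions U"
  have "(LINT x:U|lebesgue. f x * pderivs is \<eta> x) = (LINT x:U|lebesgue. f' x * pderivs is \<eta> x)"
    using f by (intro set_integral_AE_cong[OF assms(1) _ _ smooth_measurable[OF smooth_pderivs[OF test_functions_smooth[OF \<eta>]]]])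
      (auto simp: set_integrable_def)
  then show "(LINT x:U|lebesgue. f' x * pderivs is \<eta> x) = (- 1) ^ length is * (LINT x:U|lebesgue. g x * \<eta> x)"
    using w \<eta> unfolding has_weak_pderivs_def by simp
qed

lemma set_nn_integral_lborel_eq:
  fixes f :: "'a::euclidean_space \<Rightarrow> complex"
  assumes U: "U \<in> sets borel" and m: "f \<in> borel_measurable borel" and i: "set_integrable lebesgue U f"
  shows "(\<integral>\<^sup>+x. indicator U x * ennreal (cmod (f x)) \<partial>lborel) = ennreal (LINT x:U|lebesgue. cmod (f x))"
proof -
  have "(\<integral>\<^sup>+x. indicator U x * ennreal (cmod (f x)) \<partial>lborel) = (\<integral>\<^sup>+x. indicator U x * ennreal (cmod (f x)) \<partial>lebesgue)"
    using U m by (intro nn_integral_completion[symmetric]) measurable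
  also have "\<dots> = (\<integral>\<^sup>+x. ennreal (indicator U x *\<^sub>R cmod (f x)) \<partial>lebesgue)"
    by (intro nn_integral_cong) (auto simp: indicator_def)
  also have "\<dots> = ennreal (LINT x:U|lebesgue. cmod (f x))"
    unfolding set_lebesgue_integral_def
    by (rule nn_integral_eq_integral) (use set_integrable_norm[OF i] in \<open>auto simp: set_integrable_def\<close>)
  finally show ?thesis .
qed

text \<open>Averaging the half-dilation estimate over the centre \<open>z\<close> and comparing \<open>f x\<close> and \<open>f z\<close> with the
  value of \<open>f\<close> at the midpoint.\<close>

lemma poincare_borel:
  fixes D :: "(real^'n::finite) set"
  assumes D: "open D" "convex D" "bounded D" "D \<noteq> {}" and R: "\<And>y z. y \<in> D \<Longrightarrow> z \<in> D \<Longrightarrow> norm (y - z) \<le> R"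
    and f: "set_integrable lebesgue D f" "f \<in> borel_measurable borel" and g: "\<And>i. set_integrable lebesgue D (g i)"
    and w: "\<And>i. has_weak_pderivs D [i] f (g i)"
  shows "\<exists>c. (LINT x:D|lebesgue. cmod (f x - c)) \<le> 2 * (2 ^ CARD('n) * R * (\<Sum>i\<in>UNIV. LINT x:D|lebesgue. cmod (g i x)))"
proof -
  define B where "B = 2 ^ CARD('n) * R * (\<Sum>i\<in>UNIV. LINT x:D|lebesgue. cmod (g i x))"
  have [measurable]: "f \<in> borel_measurable borel" "D \<in> sets borel" using f D by auto
  \<comment> \<open>\<open>H x z\<close> and \<open>H z x\<close> refer to the same midpoint, so the
    bound \<open>H1\<close> for fixed \<open>z\<close> controls both iterated integrals once the
    variables are exchanged.\<close>
  define H where "H x z = (indicator D x * indicator D z :: ennreal) * ennreal (cmod (f x - f ((1/2) *\<^sub>R z + (1/2) *\<^sub>R x)))" for x z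
  have Hm[measurable]: "case_prod H \<in> borel_measurable (borel \<Otimes>\<^sub>M borel)"
    unfolding H_def by measurable
  have R0: "R \<ge> 0" using R D(4) norm_ge_zero order_trans by blast
  have B0: "B \<ge> 0" unfolding B_def using R0
    by (intro mult_nonneg_nonneg sum_nonneg) (auto simp: set_lebesgue_integral_def intro!: integral_nonneg_AE)
  have H1: "(\<integral>\<^sup>+x. H x z \<partial>lborel) \<le> ennreal B * indicator D z" for z
  proof (cases "z \<in> D")
    case True
    have "z \<in> closure D" using True closure_subset by blast
    from half_dilation_estimate[OF D(1,2,3) this R[OF _ True] f(1) g w]
    have i: "set_integrable lebesgue D (\<lambda>x. f ((1 / 2) *\<^sub>R z + (1 / 2) *\<^sub>R x))"
      and b: "(LINT x:D|lebesgue. cmod (f x - f ((1 / 2) *\<^sub>R z + (1 / 2) *\<^sub>R x))) \<le> B"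
      by (auto simp: B_def)
    have "(\<integral>\<^sup>+x. H x z \<partial>lborel) = (\<integral>\<^sup>+x. indicator D x * ennreal (cmod (f x - f ((1 / 2) *\<^sub>R z + (1 / 2) *\<^sub>R x))) \<partial>lborel)"
      using True by (simp add: H_def)
    also have "\<dots> = ennreal (LINT x:D|lebesgue. cmod (f x - f ((1 / 2) *\<^sub>R z + (1 / 2) *\<^sub>R x)))"
      by (rule set_nn_integral_lborel_eq) (use set_integral_diff(1)[OF f(1) i] in auto)
    finally show ?thesis using b True by (simp add: ennreal_leI)
  qed (simp add: H_def)
  have HD: "(\<integral>\<^sup>+z. \<integral>\<^sup>+x. H x z \<partial>lborel \<partial>lborel) \<le> ennreal B * emeasure lborel D"
  proof -
    have "(\<integral>\<^sup>+z. \<integral>\<^sup>+x. H x z \<partial>lborel \<partial>lborel) \<le> (\<integral>\<^sup>+z. ennreal B * indicator D z \<partial>lborel)"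
      by (rule nn_integral_mono) (rule H1)
    also have "\<dots> = ennreal B * emeasure lborel D" by (simp add: nn_integral_cmult_indicator)
    finally show ?thesis .
  qed
  have HD': "(\<integral>\<^sup>+z. \<integral>\<^sup>+x. H z x \<partial>lborel \<partial>lborel) \<le> ennreal B * emeasure lborel D"
  proof -
    have "(\<integral>\<^sup>+z. \<integral>\<^sup>+x. H z x \<partial>lborel \<partial>lborel) = (\<integral>\<^sup>+x. \<integral>\<^sup>+z. H z x \<partial>lborel \<partial>lborel)"
      by (rule lborel_pair.Fubini') measurable
    with HD show ?thesis by simp
  qed
  define G where "G z = (\<integral>\<^sup>+x. indicator D x * ennreal (cmod (f x - f z)) \<partial>lborel)" for z
  have Gm[measurable]: "G \<in> borel_measurable borel"
    unfolding G_def by measurable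
  have GH: "indicator D z * G z \<le> (\<integral>\<^sup>+x. H x z \<partial>lborel) + (\<integral>\<^sup>+x. H z x \<partial>lborel)" for z
  proof -
    have "indicator D z * G z = (\<integral>\<^sup>+x. indicator D z * (indicator D x * ennreal (cmod (f x - f z))) \<partial>lborel)"
      unfolding G_def by (rule nn_integral_cmult[symmetric]) measurable
    also have "\<dots> \<le> (\<integral>\<^sup>+x. H x z + H z x \<partial>lborel)"
    proof (rule nn_integral_mono)
      fix x
      show "indicator D z * (indicator D x * ennreal (cmod (f x - f z))) \<le> H x z + H z x"
      proof (cases "x \<in> D \<and> z \<in> D")
        case True
        have "cmod (f x - f z) \<le> cmod (f x - f ((1/2) *\<^sub>R z + (1/2) *\<^sub>R x)) + cmod (f z - f ((1/2) *\<^sub>R x + (1/2) *\<^sub>R z))"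
          using norm_triangle_ineq4[of "f x - f ((1/2) *\<^sub>R z + (1/2) *\<^sub>R x)" "f z - f ((1/2) *\<^sub>R x + (1/2) *\<^sub>R z)"]
          by (simp add: add.commute)
        then have "ennreal (cmod (f x - f z)) \<le> ennreal (cmod (f x - f ((1/2) *\<^sub>R z + (1/2) *\<^sub>R x))) + ennreal (cmod (f z - f ((1/2) *\<^sub>R x + (1/2) *\<^sub>R z)))"
          by (simp add: ennreal_leI flip: ennreal_plus)
        then show ?thesis using True by (simp add: H_def)
      qed (auto simp: indicator_def)
    qed
    also have "\<dots> = (\<integral>\<^sup>+x. H x z \<partial>lborel) + (\<integral>\<^sup>+x. H z x \<partial>lborel)"
      by (rule nn_integral_add) measurable
    finally show ?thesis .
  qed
  have GD: "(\<integral>\<^sup>+z. indicator D z * G z \<partial>lborel) \<le> ennreal (2 * B) * emeasure lborel D"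
  proof -
    have "(\<integral>\<^sup>+z. indicator D z * G z \<partial>lborel) \<le> (\<integral>\<^sup>+z. (\<integral>\<^sup>+x. H x z \<partial>lborel) + (\<integral>\<^sup>+x. H z x \<partial>lborel) \<partial>lborel)"
      by (rule nn_integral_mono) (rule GH)
    also have "\<dots> = (\<integral>\<^sup>+z. \<integral>\<^sup>+x. H x z \<partial>lborel \<partial>lborel) + (\<integral>\<^sup>+z. \<integral>\<^sup>+x. H z x \<partial>lborel \<partial>lborel)"
      by (rule nn_integral_add) measurable
    also have "\<dots> \<le> ennreal B * emeasure lborel D + ennreal B * emeasure lborel D"
      by (rule add_mono[OF HD HD'])
    also have "\<dots> = ennreal (2 * B) * emeasure lborel D"
      using B0 by (simp add: distrib_right[symmetric] flip: ennreal_plus)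
    finally show ?thesis .
  qed
  have Dfin: "emeasure lborel D < \<infinity>" using D(3) emeasure_bounded_finite by auto
  \<comment> \<open>The constant will be \<open>f z\<close> for a point \<open>z\<close> where
    \<open>G\<close> does not exceed the bound on its mean. If \<open>G\<close> were larger on all
    of \<open>D\<close>, its integral would be strictly too large, since \<open>D\<close> has
    positive measure.\<close>
  have "\<exists>z\<in>D. G z \<le> ennreal (2 * B)"
  proof (rule ccontr)
    assume "\<not> (\<exists>z\<in>D. G z \<le> ennreal (2 * B))"
    then have gt: "\<And>z. z \<in> D \<Longrightarrow> ennreal (2 * B) < G z" by (auto simp: not_le)
    have e: "(\<integral>\<^sup>+z. ennreal (2 * B) * indicator D z \<partial>lborel) = ennreal (2 * B) * emeasure lborel D"
      by (simp add: nn_integral_cmult_indicator)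
    have "(\<integral>\<^sup>+z. ennreal (2 * B) * indicator D z \<partial>lborel) < (\<integral>\<^sup>+z. indicator D z * G z \<partial>lborel)"
    proof (rule nn_integral_less)
      show "(\<integral>\<^sup>+z. ennreal (2 * B) * indicator D z \<partial>lborel) \<noteq> \<infinity>"
        using Dfin unfolding e by (simp add: ennreal_mult_eq_top_iff)
      show "AE z in lborel. ennreal (2 * B) * indicator D z \<le> indicator D z * G z"
        using gt by (auto simp: indicator_def less_imp_le)
      show "\<not> (AE z in lborel. indicator D z * G z \<le> ennreal (2 * B) * indicator D z)"
      proof
        assume "AE z in lborel. indicator D z * G z \<le> ennreal (2 * B) * indicator D z"
        then have "AE z in lborel. z \<notin> D"
        proof eventually_elim
          case (elim z)
          then show ?case using gt[of z] by (auto simp: indicator_def split: if_splits)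
        qed
        then have "emeasure lborel D = 0"
          by (subst (asm) AE_iff_measurable[of D]) auto
        then have "D \<in> null_sets lborel" by auto
        then have "negligible D" using null_sets_completionI negligible_iff_null_sets by blast
        then show False using D(1,4) open_not_negligible by blast
      qed
    qed measurable
    then show False using GD unfolding e by simp
  qed
  then obtain z where z: "z \<in> D" "G z \<le> ennreal (2 * B)" by blast
  have "set_integrable lebesgue D (\<lambda>x. f x - f z)"
    using D by (intro set_integral_diff(1)[OF f(1)] continuous_set_integrable) auto
  from set_nn_integral_lborel_eq[OF _ _ this] have "G z = ennreal (LINT x:D|lebesgue. cmod (f x - f z))"
    unfolding G_def by simp
  then have "(LINT x:D|lebesgue. cmod (f x - f z)) \<le> 2 * B"
    using z(2) B0 by (simp add: ennreal_le_iff)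
  then show ?thesis unfolding B_def by blast
qed

lemma poincare:
  fixes D :: "(real^'n::finite) set"
  assumes D: "open D" "convex D" "bounded D" "D \<noteq> {}" and R: "\<And>y z. y \<in> D \<Longrightarrow> z \<in> D \<Longrightarrow> norm (y - z) \<le> R"
    and f: "set_integrable lebesgue D f" and g: "\<And>i. set_integrable lebesgue D (g i)"
    and w: "\<And>i. has_weak_pderivs D [i] f (g i)"
  shows "\<exists>c. (LINT x:D|lebesgue. cmod (f x - c)) \<le> 2 * (2 ^ CARD('n) * R * (\<Sum>i\<in>UNIV. LINT x:D|lebesgue. cmod (g i x)))"
proof -
  have fm: "(\<lambda>x. indicator D x *\<^sub>R f x) \<in> borel_measurable lebesgue"
    using f by (auto simp: set_integrable_def)
  obtain F where F: "F \<in> borel_measurable borel" "AE x in lebesgue. indicator D x *\<^sub>R f x = F x"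
    by (rule complex_borel_version[OF fm])
  have FL: "F \<in> borel_measurable lebesgue"
    by (rule measurable_completion) (simp add: F(1))
  have Ds: "D \<in> sets lebesgue" using D by auto
  have ae: "AE x in lebesgue. x \<in> D \<longrightarrow> f x = F x"
    using F(2) by eventually_elim (auto simp: indicator_def)
  have Fm: "(\<lambda>x. indicator D x *\<^sub>R F x) \<in> borel_measurable lebesgue"
    using borel_measurable_indicator[OF Ds, where 'b=real] FL by (rule borel_measurable_scaleR)
  have Fi: "set_integrable lebesgue D F"
    unfolding set_integrable_def
    by (rule integrable_cong_AE_imp[OF f[unfolded set_integrable_def] Fm])
       (use ae in \<open>eventually_elim, auto simp: indicator_def\<close>)
  obtain c where c: "(LINT x:D|lebesgue. cmod (F x - c)) \<le> 2 * (2 ^ CARD('n) * R * (\<Sum>i\<in>UNIV. LINT x:D|lebesgue. cmod (g i x)))"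
    using poincare_borel[OF D R Fi F(1) g has_weak_pderivs_AE_cong[OF ae f Fi w]] by auto
  have "(LINT x:D|lebesgue. cmod (f x - c)) = (LINT x:D|lebesgue. cmod (F x - c))"
    unfolding set_lebesgue_integral_def
  proof (rule integral_cong_AE)
    have ci: "set_integrable lebesgue D (\<lambda>x. c)" using D by (intro continuous_set_integrable) auto
    show "(\<lambda>x. indicat_real D x *\<^sub>R cmod (f x - c)) \<in> borel_measurable lebesgue"
      using set_integrable_norm[OF set_integral_diff(1)[OF f ci]] by (auto simp: set_integrable_def)
    show "(\<lambda>x. indicat_real D x *\<^sub>R cmod (F x - c)) \<in> borel_measurable lebesgue"
      using set_integrable_norm[OF set_integral_diff(1)[OF Fi ci]] by (auto simp: set_integrable_def)
    show "AE x in lebesgue. indicat_real D x *\<^sub>R cmod (f x - c) = indicat_real D x *\<^sub>R cmod (F x - c)"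
      using ae by eventually_elim (auto simp: indicator_def)
  qed
  with c have "(LINT x:D|lebesgue. cmod (f x - c)) \<le> 2 * (2 ^ CARD('n) * R * (\<Sum>i\<in>UNIV. LINT x:D|lebesgue. cmod (g i x)))"
    by simp
  then show ?thesis by (rule exI)
qed

section \<open>Limits of means at a boundary point\<close>

lemma translate_scale_image: "(\<lambda>y. t + r *\<^sub>R y) ` Q = (+) t ` ((*\<^sub>R) r ` Q)"
  by (simp add: image_image)

lemma open_translate_scale:
  fixes Q :: "'a::real_normed_vector set"
  shows "open Q \<Longrightarrow> r \<noteq> 0 \<Longrightarrow> open ((\<lambda>y. t + r *\<^sub>R y) ` Q)"
  unfolding translate_scale_image by (intro open_translation open_scaling)

lemma bounded_translate_scale:
  fixes Q :: "'a::real_normed_vector set"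
  shows "bounded Q \<Longrightarrow> bounded ((\<lambda>y. t + r *\<^sub>R y) ` Q)"
  unfolding translate_scale_image by (intro bounded_translation bounded_scaling)

lemma set_integral_translate_scale:
  fixes g :: "'a::euclidean_space \<Rightarrow> 'b::{banach, second_countable_topology}"
  assumes r: "r \<noteq> 0" and g: "set_integrable lebesgue ((\<lambda>y. t + r *\<^sub>R y) ` Q) g"
  shows "(LINT x:(\<lambda>y. t + r *\<^sub>R y) ` Q|lebesgue. g x) = \<bar>r\<bar> ^ DIM('a) *\<^sub>R (LINT y:Q|lebesgue. g (t + r *\<^sub>R y))"
proof -
  have i: "indicator ((\<lambda>y. t + r *\<^sub>R y) ` Q) (t + r *\<^sub>R y) = (indicator Q y :: real)" for y
    using r by (auto simp: indicator_def)
  show ?thesis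
    using lebesgue_integral_affine[OF r g[unfolded set_integrable_def], of t] by (simp add: set_lebesgue_integral_def i)
qed

lemma set_integral_subset_mono:
  fixes f :: "'a::euclidean_space \<Rightarrow> real"
  assumes "set_integrable lebesgue B f" "A \<in> sets lebesgue" "A \<subseteq> B" "\<And>x. 0 \<le> f x"
  shows "(LINT x:A|lebesgue. f x) \<le> (LINT x:B|lebesgue. f x)"
  unfolding set_lebesgue_integral_def
proof (rule integral_mono)
  show "integrable lebesgue (\<lambda>x. indicat_real A x *\<^sub>R f x)"
    using set_integrable_subset[OF assms(1,2,3)] by (simp add: set_integrable_def)
  show "integrable lebesgue (\<lambda>x. indicat_real B x *\<^sub>R f x)" using assms(1) by (simp add: set_integrable_def)
  show "indicat_real A x *\<^sub>R f x \<le> indicat_real B x *\<^sub>R f x" for x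
    using assms(3,4) by (auto simp: indicator_def)
qed

lemma set_integral_pointwise_nonneg: "(\<And>x. 0 \<le> f x) \<Longrightarrow> 0 \<le> (LINT x:A|M. (f x :: real))"
  unfolding set_lebesgue_integral_def by (rule integral_nonneg_AE) (auto simp: indicator_def)

lemma set_integral_const_eq: "bounded A \<Longrightarrow> A \<in> sets lebesgue \<Longrightarrow> (LINT x:A|lebesgue. (c::real)) = c * measure lebesgue (A :: 'a::euclidean_space set)"
  using bounded_lebesgue_set_finite[of A] by (simp add: set_lebesgue_integral_def)

lemma measure_translate_scale:
  fixes Q :: "'a::euclidean_space set"
  assumes "open Q" "bounded Q" "r > 0"
  shows "measure lebesgue ((\<lambda>y. t + r *\<^sub>R y) ` Q) = r ^ DIM('a) * measure lebesgue Q"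
proof -
  have o: "open ((\<lambda>y. t + r *\<^sub>R y) ` Q)" "bounded ((\<lambda>y. t + r *\<^sub>R y) ` Q)"
    using assms by (auto intro: open_translate_scale bounded_translate_scale)
  then have "set_integrable lebesgue ((\<lambda>y. t + r *\<^sub>R y) ` Q) (\<lambda>x. 1::real)"
    by (intro continuous_set_integrable) auto
  from set_integral_translate_scale[OF _ this] assms(3)
  have "(LINT x:(\<lambda>y. t + r *\<^sub>R y) ` Q|lebesgue. 1::real) = r ^ DIM('a) * (LINT x:Q|lebesgue. 1)" by simp
  then show ?thesis
    using set_integral_const_eq[of "(\<lambda>y. t + r *\<^sub>R y) ` Q" 1] set_integral_const_eq[of Q 1] o assms by simp
qed

lemma measure_open_pos:
  fixes Q :: "'a::euclidean_space set"
  assumes "open Q" "bounded Q" "Q \<noteq> {}"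
  shows "measure lebesgue Q > 0"
proof -
  have "\<not> negligible Q" using assms open_not_negligible by blast
  moreover have "Q \<in> lmeasurable" using assms by (intro bounded_set_imp_lmeasurable) auto
  ultimately have "measure lebesgue Q \<noteq> 0" using negligible_iff_measure0 by blast
  then show ?thesis by (simp add: less_le)
qed

lemma sobolev_pderivs:
  assumes "f \<in> sobolev 2 U"
  obtains g g2 where "\<And>i. g i \<in> L2_on U" "\<And>i j. g2 i j \<in> L2_on U"
    "\<And>i. has_weak_pderivs U [i] f (g i)" "\<And>i j. has_weak_pderivs U [j] (g i) (g2 i j)"
proof -
  have "\<forall>is. length is \<le> 2 \<longrightarrow> (\<exists>g\<in>L2_on U. has_weak_pderivs U is f g)"
    using assms by (simp add: sobolev_def)
  then have "\<forall>i. \<exists>g\<in>L2_on U. has_weak_pderivs U [i] f g" "\<forall>i j. \<exists>g\<in>L2_on U. has_weak_pderivs U [i, j] f g"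
    by auto
  then obtain g g2 where "\<And>i. g i \<in> L2_on U" "\<And>i. has_weak_pderivs U [i] f (g i)"
    "\<And>i j. g2 i j \<in> L2_on U" "\<And>i j. has_weak_pderivs U [i, j] f (g2 i j)"
    by metis
  note g = this
  have "has_weak_pderivs U [j] (g i) (g2 i j)" for i j
    using has_weak_pderivs_step[of U "[i]" f "g i" j "g2 i j"] g by simp
  with g show thesis using that by blast
qed

text \<open>A radius lies between consecutive powers of \<open>1/2\<close>, and \<open>E\<close> is
  monotone. Replacing the radius by the larger power costs at most a factor \<open>2 ^ n\<close>,
  hence the \<open>e / 2 ^ n\<close> in the proof.\<close>

lemma shrinking_mean_from_dyadic:
  fixes E :: "real \<Rightarrow> real"
  assumes E: "\<And>r s. 0 < r \<Longrightarrow> r \<le> s \<Longrightarrow> s \<le> 1 \<Longrightarrow> 0 \<le> E r \<and> E r \<le> E s"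
    and l: "(\<lambda>k. E ((1/2) ^ k) * (2 ^ n) ^ k) \<longlonglongrightarrow> 0"
  shows "((\<lambda>r. E r / r ^ n) \<longlongrightarrow> 0) (at_right 0)"
  unfolding tendsto_iff
proof (intro allI impI)
  fix e :: real assume e: "e > 0"
  have "e / 2 ^ n > 0" using e by simp
  with l have "\<forall>\<^sub>F k in sequentially. dist (E ((1/2) ^ k) * (2 ^ n) ^ k) 0 < e / 2 ^ n"
    unfolding tendsto_iff by blast
  then obtain N where N: "\<And>k. k \<ge> N \<Longrightarrow> \<bar>E ((1/2) ^ k) * (2 ^ n) ^ k\<bar> < e / 2 ^ n"
    by (auto simp: eventually_sequentially)
  have "dist (E r / r ^ n) 0 < e" if r: "0 < r" "r < (1/2) ^ N" for r
  proof -
    have "\<exists>k. (1/2) ^ k < r" using real_arch_pow_inv[OF r(1), of "1/2"] by auto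
    then obtain m where m: "(1/2) ^ m < r" "\<And>k. k < m \<Longrightarrow> \<not> (1/2) ^ k < r"
      using exists_least_iff[of "\<lambda>k. (1/2) ^ k < r"] by blast
    have mN: "N < m"
    proof (rule ccontr)
      assume "\<not> N < m"
      then have "((1/2) :: real) ^ N \<le> (1/2) ^ m" by (intro power_decreasing) auto
      then show False using m(1) r(2) by linarith
    qed
    then obtain k where k: "m = Suc k" "N \<le> k" by (metis less_eq_Suc_le Suc_le_D Suc_le_mono)
    have rk: "r \<le> (1/2) ^ k" using m(2)[of k] k by auto
    have k1: "((1/2) :: real) ^ k \<le> 1" by (simp add: power_le_one)
    have "E r \<le> E ((1/2) ^ k)" "0 \<le> E r" using E[OF r(1) rk k1] by auto
    moreover have "E ((1/2) ^ k) * (2 ^ n) ^ k < e / 2 ^ n" using N[OF k(2)] by auto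
    ultimately have "E r * (2 ^ n) ^ k < e / 2 ^ n"
      by (smt (verit) mult_right_mono zero_le_power)
    then have "E r < e / 2 ^ n / (2 ^ n) ^ k" by (subst pos_less_divide_eq) auto
    also have "\<dots> = e * ((1/2) ^ m) ^ n"
    proof -
      have "((1 / 2 :: real) ^ m) ^ n = 1 / (2 ^ n) ^ m"
        by (simp add: power_divide mult.commute flip: power_mult)
      then show ?thesis by (simp add: k(1))
    qed
    also have "\<dots> \<le> e * r ^ n" using m(1) e by (intro mult_left_mono power_mono) auto
    finally show ?thesis using r(1) \<open>0 \<le> E r\<close> by (simp add: divide_simps)
  qed
  then show "\<forall>\<^sub>F r in at_right 0. dist (E r / r ^ n) 0 < e"
    unfolding eventually_at_right_field by (intro exI[of _ "(1/2) ^ N"]) auto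
qed

text \<open>Rescaling by \<open>1/2\<close>, the mean of the gradient over \<open>D r\<close> grows at most like \<open>r powr (- 1/2)\<close> because
  the dimension is at most three, so the Poincare constants of \<open>f\<close> on the dyadic sets form a
  geometrically convergent sequence.\<close>

lemma sobolev2_mean_limit:
  fixes Q :: "(real^'n::finite) set"
  assumes Q: "open Q" "convex Q" "bounded Q" "Q \<noteq> {}" "0 \<in> closure Q" and n3: "CARD('n) \<le> 3"
    and f: "f \<in> sobolev 2 ((\<lambda>y. xc + y) ` Q)"
  shows "\<exists>c. ((\<lambda>r. (LINT x:(\<lambda>y. xc + r *\<^sub>R y) ` Q|lebesgue. cmod (f x - c)) / r ^ CARD('n)) \<longlongrightarrow> 0) (at_right 0)"
proof -
  define D where "D r = (\<lambda>y. xc + r *\<^sub>R y) ` Q" for r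
  let ?n = "CARD('n)"
  obtain M where M: "M > 0" "\<And>y. y \<in> Q \<Longrightarrow> norm y \<le> M" using Q(3) bounded_pos by metis
  have Dprops: "open (D r)" "convex (D r)" "bounded (D r)" "D r \<noteq> {}" "xc \<in> closure (D r)" if "r > 0" for r
  proof -
    show "open (D r)" "bounded (D r)" unfolding D_def
      using that Q by (auto intro: open_translate_scale bounded_translate_scale)
    show "convex (D r)" unfolding D_def translate_scale_image using Q by (intro convex_translation convex_scaling)
    show "D r \<noteq> {}" using Q by (auto simp: D_def)
    have "r *\<^sub>R 0 \<in> closure ((*\<^sub>R) r ` Q)" using Q(5) closure_scaleR[of r Q] by blast
    then have "xc + 0 \<in> closure ((+) xc ` ((*\<^sub>R) r ` Q))" unfolding closure_translation by auto
    then show "xc \<in> closure (D r)" unfolding D_def translate_scale_image by simp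
  qed
  have Dmeas: "D r \<in> sets lebesgue" if "r > 0" for r using Dprops(1)[OF that] by auto
  \<comment> \<open>Convexity with \<open>0\<close> in the closure makes \<open>Q\<close> stable
    under contraction towards \<open>0\<close>, so the dilates increase.\<close>
  have Dmono: "D r \<subseteq> D s" if "0 < r" "r \<le> s" for r s
  proof
    fix x assume "x \<in> D r"
    then obtain y where y: "y \<in> Q" "x = xc + r *\<^sub>R y" by (auto simp: D_def)
    then have "y \<in> interior Q" using Q by (simp add: interior_open)
    from mem_interior_closure_convex_shrink[OF Q(2) this Q(5), of "r / s"]
    have "(r / s) *\<^sub>R y \<in> Q" using that Q(1) by (simp add: interior_open)
    moreover have "x = xc + s *\<^sub>R ((r / s) *\<^sub>R y)" using y that by simp
    ultimately show "x \<in> D s" unfolding D_def by blast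
  qed
  have DR: "norm (x - xc) \<le> r * M" if "x \<in> D r" "r > 0" for x r
    using that M by (auto simp: D_def)
  have DR2: "norm (x - y) \<le> 2 * (r * M)" if "x \<in> D r" "y \<in> D r" "r > 0" for x y r
    using norm_triangle_ineq4[of "x - xc" "y - xc"] DR[OF that(1,3)] DR[OF that(2,3)] by simp
  define mQ where "mQ = measure lebesgue Q"
  have mQ: "mQ > 0" unfolding mQ_def by (rule measure_open_pos[OF Q(1,3,4)])
  have mD: "measure lebesgue (D r) = r ^ ?n * mQ" if "r > 0" for r
    using measure_translate_scale[OF Q(1,3) that] by (simp add: D_def mQ_def)
  have U: "(\<lambda>y. xc + y) ` Q = D 1" by (simp add: D_def)
  obtain g g2 where gL: "\<And>i. g i \<in> L2_on (D 1)" and g2L: "\<And>i j. g2 i j \<in> L2_on (D 1)"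
    and gw: "\<And>i. has_weak_pderivs (D 1) [i] f (g i)" and g2w: "\<And>i j. has_weak_pderivs (D 1) [j] (g i) (g2 i j)"
    using sobolev_pderivs[OF f] unfolding U by blast
  have fL: "f \<in> L2_on (D 1)" using f by (simp add: sobolev_def U)
  have int: "set_integrable lebesgue (D r) h" if "h \<in> L2_on (D 1)" "0 < r" "r \<le> 1" for r h
    using L2_on_integrable[OF L2_on_subset[OF that(1) Dmono[OF that(2,3)] Dmeas[OF that(2)]] Dprops(3)[OF that(2)] Dmeas[OF that(2)]] .
  have cint: "set_integrable lebesgue (D r) (\<lambda>x. c::complex)" if "0 < r" for r c
    using Dprops(3)[OF that] Dmeas[OF that] by (intro continuous_set_integrable) auto
  have wD: "has_weak_pderivs (D r) is h h'" if "has_weak_pderivs (D 1) is h h'" "0 < r" "r \<le> 1" for r h h' "is"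
    using has_weak_pderivs_subset[OF that(1) Dmono[OF that(2,3)]] .
  define I where "I r h = (LINT x:D r|lebesgue. cmod (h x))" for r and h :: "real^'n \<Rightarrow> complex"
  have I0: "I r h \<ge> 0" for r h unfolding I_def by (rule set_integral_pointwise_nonneg) simp
  \<comment> \<open>\<open>\<rho> ^ k\<close> is the square root of the radius \<open>r k\<close>,
    so that half-integral powers of the radius become natural powers of
    \<open>\<rho>\<close>.\<close>
  define \<rho> :: real where "\<rho> = sqrt (1/2)"
  have \<rho>: "0 < \<rho>" "\<rho> < 1" "\<rho>\<^sup>2 = 1/2" by (auto simp: \<rho>_def)
  have half: "(1/2) ^ k = (\<rho> ^ k)\<^sup>2" for k by (simp add: \<rho>(3)[symmetric] flip: power_mult) (simp add: mult.commute)
  define r where "r k = ((1/2) :: real) ^ k" for k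
  have r: "0 < r k" "r k \<le> 1" for k by (auto simp: r_def power_le_one)
  have rS: "r (Suc k) = r k / 2" for k by (simp add: r_def)
  have r\<rho>: "r k = (\<rho> ^ k)\<^sup>2" for k by (simp add: r_def half)
  define K where "K = (\<Sum>i\<in>UNIV. \<Sum>j\<in>UNIV. (LINT x:D 1|lebesgue. (cmod (g2 i j x))\<^sup>2) + mQ)"
  have K0: "K \<ge> 0" unfolding K_def using mQ by (intro sum_nonneg add_nonneg_nonneg set_integral_pointwise_nonneg) auto
  \<comment> \<open>Young's inequality with \<open>t = r^(n/2)\<close>, up to a constant the square
    root of the measure of \<open>D r\<close>.\<close>
  have I2: "(\<Sum>i\<in>UNIV. \<Sum>j\<in>UNIV. I (r k) (g2 i j)) \<le> (\<rho> ^ k) ^ ?n * K" for k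
  proof -
    have "I (r k) (g2 i j) \<le> (\<rho> ^ k) ^ ?n * ((LINT x:D 1|lebesgue. (cmod (g2 i j x))\<^sup>2) + mQ)" for i j
    proof -
      have t: "(\<rho> ^ k) ^ ?n > 0" using \<rho> by simp
      have "I (r k) (g2 i j) \<le> (\<rho> ^ k) ^ ?n * (LINT x:D (r k)|lebesgue. (cmod (g2 i j x))\<^sup>2) + measure lebesgue (D (r k)) / (\<rho> ^ k) ^ ?n"
        unfolding I_def
        by (rule L1_le_L2[OF L2_on_subset[OF g2L Dmono[OF r] Dmeas[OF r(1)]] Dprops(3)[OF r(1)] Dmeas[OF r(1)] t])
      also have "measure lebesgue (D (r k)) / (\<rho> ^ k) ^ ?n = (\<rho> ^ k) ^ ?n * mQ"
      proof -
        have "measure lebesgue (D (r k)) = (\<rho> ^ k) ^ ?n * (\<rho> ^ k) ^ ?n * mQ"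
          unfolding mD[OF r(1)] unfolding r\<rho> by (simp only: power2_eq_square power_mult_distrib)
        then show ?thesis using t by simp
      qed
      also have "(\<rho> ^ k) ^ ?n * (LINT x:D (r k)|lebesgue. (cmod (g2 i j x))\<^sup>2) \<le> (\<rho> ^ k) ^ ?n * (LINT x:D 1|lebesgue. (cmod (g2 i j x))\<^sup>2)"
        using t by (intro mult_left_mono set_integral_subset_mono L2_on_square_integrable[OF g2L] Dmeas Dmono r) auto
      finally show ?thesis by (simp add: distrib_left)
    qed
    then show ?thesis unfolding K_def sum_distrib_left by (intro sum_mono)
  qed
  \<comment> \<open>The half-dilation about \<open>xc\<close> maps \<open>D (r k)\<close> onto
    \<open>D (r (Suc k))\<close>; the factor \<open>2 ^ ?n\<close> on the left is its
    Jacobian.\<close>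
  have halve: "2 ^ ?n * I (r (Suc k)) (g i) \<le> I (r k) (g i) + 2 ^ ?n * (r k * M) * (\<Sum>j\<in>UNIV. I (r k) (g2 i j))" for k i
  proof -
    let ?h = "\<lambda>x. (1/2) *\<^sub>R xc + (1/2) *\<^sub>R x"
    have im: "?h ` D (r k) = D (r (Suc k))"
    proof -
      have "(1/2) *\<^sub>R xc + (1/2) *\<^sub>R (xc + r k *\<^sub>R y) = xc + (r k / 2) *\<^sub>R y" for y
      proof -
        have "(1/2) *\<^sub>R xc + (1/2) *\<^sub>R xc = xc" by (simp flip: scaleR_left_distrib)
        then show ?thesis by (simp add: scaleR_right_distrib flip: add.assoc)
      qed
      then show ?thesis by (simp add: D_def image_image rS)
    qed
    note est = half_dilation_estimate[OF Dprops(1-3)[OF r(1)] Dprops(5)[OF r(1)] DR[OF _ r(1)] int[OF gL r] int[OF g2L r] wD[OF g2w r]]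
    have est1: "set_integrable lebesgue (D (r k)) (\<lambda>x. g i (?h x))" by (rule est(1))
    have est2: "(LINT x:D (r k)|lebesgue. cmod (g i x - g i (?h x))) \<le> 2 ^ ?n * (r k * M) * (\<Sum>j\<in>UNIV. LINT x:D (r k)|lebesgue. cmod (g2 i j x))"
      by (rule est(2))
    have ci: "set_integrable lebesgue (?h ` D (r k)) (\<lambda>x. cmod (g i x))"
      unfolding im by (rule set_integrable_norm[OF int[OF gL r]])
    have "2 ^ ?n * I (r (Suc k)) (g i) = (LINT x:D (r k)|lebesgue. cmod (g i (?h x)))"
      unfolding I_def im[symmetric] by (subst set_integral_translate_scale[OF _ ci]) (simp_all add: power_divide)
    also have "\<dots> \<le> (LINT x:D (r k)|lebesgue. cmod (g i x) + cmod (g i x - g i (?h x)))"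
    proof (rule set_integral_mono)
      show "set_integrable lebesgue (D (r k)) (\<lambda>x. cmod (g i (?h x)))" by (rule set_integrable_norm[OF est1])
      show "set_integrable lebesgue (D (r k)) (\<lambda>x. cmod (g i x) + cmod (g i x - g i (?h x)))"
        by (intro set_integral_add(1) set_integrable_norm set_integral_diff(1) int[OF gL r] est1)
      show "cmod (g i (?h x)) \<le> cmod (g i x) + cmod (g i x - g i (?h x))" for x
        by (metis norm_triangle_sub norm_minus_commute)
    qed
    also have "\<dots> = I (r k) (g i) + (LINT x:D (r k)|lebesgue. cmod (g i x - g i (?h x)))"
      unfolding I_def by (intro set_integral_add(2) set_integrable_norm set_integral_diff(1) int[OF gL r] est1)
    finally show ?thesis using est2 by (simp add: I_def)
  qed
  \<comment> \<open>\<open>(2 ^ ?n) ^ k\<close> is \<open>1 / r k ^ ?n\<close>; up to the constant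
    \<open>mQ\<close>, \<open>A k\<close> is therefore a mean of the gradient over
    \<open>D (r k)\<close>.\<close>
  define A where "A k = (2 ^ ?n) ^ k * (\<Sum>i\<in>UNIV. I (r k) (g i))" for k
  define C where "C = 2 ^ ?n * M * K"
  have C0: "C \<ge> 0" using K0 M by (simp add: C_def)
  \<comment> \<open>The mean gradient changes by the order of
    \<open>r^(-n) * r * r^(n/2) = r^(1 - n/2)\<close>. For \<open>n \<le> 3\<close> and
    \<open>r \<le> 1\<close> this is at most \<open>r^(-1/2) = 1 / \<rho>^k\<close>. The restriction
    on the dimension enters here.\<close>
  have \<rho>3: "(2 ^ ?n) ^ k * (r k * (\<rho> ^ k) ^ ?n) \<le> 1 / \<rho> ^ k" for k
  proof -
    have q: "0 < \<rho> ^ k" "\<rho> ^ k \<le> 1" using \<rho> by (auto intro: power_le_one)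
    have 2: "(2::real) ^ ?n = 1 / (\<rho> ^ ?n * \<rho> ^ ?n)"
    proof -
      have "\<rho> * \<rho> = 1 / 2" using \<rho>(3) by (simp only: power2_eq_square)
      then have "(\<rho> * \<rho>) ^ ?n = (1 / 2) ^ ?n" by (rule arg_cong)
      then show ?thesis by (simp add: power_mult_distrib power_divide)
    qed
    have "(2 ^ ?n) ^ k * (r k * (\<rho> ^ k) ^ ?n) = (\<rho> ^ k)\<^sup>2 / (\<rho> ^ k) ^ ?n"
      unfolding 2 r\<rho> using q \<rho>(1)
      by (simp add: power_divide power_mult_distrib power2_eq_square divide_simps flip: power_mult) (simp add: mult.commute)
    also have "\<dots> \<le> (\<rho> ^ k)\<^sup>2 / (\<rho> ^ k) ^ 3"
      using q n3 by (intro divide_left_mono power_decreasing mult_pos_pos) auto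
    also have "\<dots> = 1 / \<rho> ^ k" using q by (simp add: power2_eq_square power3_eq_cube)
    finally show ?thesis .
  qed
  have AS: "A (Suc k) \<le> A k + C / \<rho> ^ k" for k
  proof -
    have "A (Suc k) = (2 ^ ?n) ^ k * (\<Sum>i\<in>UNIV. 2 ^ ?n * I (r (Suc k)) (g i))"
      by (simp add: A_def sum_distrib_left mult_ac)
    also have "\<dots> \<le> (2 ^ ?n) ^ k * (\<Sum>i\<in>UNIV. I (r k) (g i) + 2 ^ ?n * (r k * M) * (\<Sum>j\<in>UNIV. I (r k) (g2 i j)))"
      by (intro mult_left_mono sum_mono halve) auto
    also have "\<dots> = A k + (2 ^ ?n) ^ k * (2 ^ ?n * (r k * M) * (\<Sum>i\<in>UNIV. \<Sum>j\<in>UNIV. I (r k) (g2 i j)))"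
      by (simp add: A_def sum.distrib sum_distrib_left distrib_left)
    also have "\<dots> \<le> A k + (2 ^ ?n) ^ k * (2 ^ ?n * (r k * M) * ((\<rho> ^ k) ^ ?n * K))"
      using M r(1)[of k] by (intro add_left_mono mult_left_mono I2) auto
    also have "\<dots> = A k + C * ((2 ^ ?n) ^ k * (r k * (\<rho> ^ k) ^ ?n))"
      by (simp add: C_def mult_ac)
    also have "\<dots> \<le> A k + C * (1 / \<rho> ^ k)"
      by (intro add_left_mono mult_left_mono \<rho>3 C0)
    finally show ?thesis by simp
  qed
  \<comment> \<open>Chosen to sum the geometric growth: it is large enough for \<open>k = 0\<close>,
    and \<open>C2 * (1 / \<rho> - 1) \<ge> C\<close> absorbs one increment.\<close>
  define C2 where "C2 = A 0 + C / (1 / \<rho> - 1)"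
  have \<rho>1: "1 / \<rho> - 1 > 0" using \<rho> by simp
  have A0: "A k \<ge> 0" for k unfolding A_def by (intro mult_nonneg_nonneg sum_nonneg I0) auto
  have C20: "C2 \<ge> 0" "C \<le> C2 * (1 / \<rho> - 1)"
  proof -
    show "C2 \<ge> 0" unfolding C2_def using A0 C0 \<rho>1 by (intro add_nonneg_nonneg divide_nonneg_nonneg) auto
    have "C2 * (1 / \<rho> - 1) = A 0 * (1 / \<rho> - 1) + C"
      unfolding C2_def distrib_right using \<rho>1 by (metis less_irrefl nonzero_divide_eq_eq)
    moreover have "A 0 * (1 / \<rho> - 1) \<ge> 0" using A0[of 0] \<rho>1 by simp
    ultimately show "C \<le> C2 * (1 / \<rho> - 1)" by linarith
  qed
  have Ab: "A k \<le> C2 / \<rho> ^ k" for k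
  proof (induction k)
    case 0
    show ?case using C0 \<rho>1 unfolding C2_def by simp
  next
    case (Suc k)
    have "A (Suc k) \<le> (C2 + C) / \<rho> ^ k" using AS[of k] Suc by (simp add: add_divide_distrib)
    also have "\<dots> \<le> (C2 + C2 * (1 / \<rho> - 1)) / \<rho> ^ k" using C20 \<rho> by (intro divide_right_mono) auto
    also have "\<dots> = C2 / \<rho> ^ Suc k" using \<rho> by (simp add: field_simps)
    finally show ?case .
  qed
  have "\<forall>k. \<exists>c. (LINT x:D (r k)|lebesgue. cmod (f x - c)) \<le> 2 * (2 ^ ?n * (2 * (r k * M)) * (\<Sum>i\<in>UNIV. LINT x:D (r k)|lebesgue. cmod (g i x)))"
    by (intro allI poincare Dprops r DR2 int[OF fL] int[OF gL] wD[OF gw]) auto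
  then obtain c where c: "\<And>k. I (r k) (\<lambda>x. f x - c k) \<le> 2 * (2 ^ ?n * (2 * (r k * M)) * (\<Sum>i\<in>UNIV. I (r k) (g i)))"
    unfolding I_def by metis
  define C3 where "C3 = 2 * 2 ^ ?n * 2 * M * C2"
  \<comment> \<open>The Poincare inequality contributes \<open>r k = \<rho>^(2k)\<close> against the
    growth \<open>1 / \<rho>^k\<close> of \<open>A\<close>.\<close>
  have cb: "(2 ^ ?n) ^ k * I (r k) (\<lambda>x. f x - c k) \<le> C3 * \<rho> ^ k" for k
  proof -
    have "(2 ^ ?n) ^ k * I (r k) (\<lambda>x. f x - c k) \<le> (2 ^ ?n) ^ k * (2 * (2 ^ ?n * (2 * (r k * M)) * (\<Sum>i\<in>UNIV. I (r k) (g i))))"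
      by (intro mult_left_mono c) auto
    also have "\<dots> = 2 * 2 ^ ?n * 2 * M * r k * A k" by (simp add: A_def mult_ac)
    also have "\<dots> \<le> 2 * 2 ^ ?n * 2 * M * r k * (C2 / \<rho> ^ k)" using M r(1)[of k] by (intro mult_left_mono Ab) auto
    also have "\<dots> = C3 * \<rho> ^ k" using \<rho>(1) by (simp add: C3_def r\<rho> power2_eq_square)
    finally show ?thesis .
  qed
  have Itri: "I s (\<lambda>x. a - b) \<le> I s (\<lambda>x. f x - a) + I s (\<lambda>x. f x - b)" if "0 < s" "s \<le> 1" for s a b
  proof -
    have "I s (\<lambda>x. a - b) \<le> (LINT x:D s|lebesgue. cmod (f x - a) + cmod (f x - b))"
      unfolding I_def
    proof (rule set_integral_mono)
      show "set_integrable lebesgue (D s) (\<lambda>x. cmod (a - b))" by (rule set_integrable_norm[OF cint[OF that(1)]])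
      show "set_integrable lebesgue (D s) (\<lambda>x. cmod (f x - a) + cmod (f x - b))"
        by (intro set_integral_add(1) set_integrable_norm set_integral_diff(1) int[OF fL] cint that)
      show "cmod (a - b) \<le> cmod (f x - a) + cmod (f x - b)" for x
        using norm_triangle_ineq4[of "f x - b" "f x - a"] by simp
    qed
    also have "\<dots> = I s (\<lambda>x. f x - a) + I s (\<lambda>x. f x - b)"
      unfolding I_def by (intro set_integral_add(2) set_integrable_norm set_integral_diff(1) int[OF fL] cint that)
    finally show ?thesis .
  qed
  have Iconst: "I s (\<lambda>x. a) = cmod a * (s ^ ?n * mQ)" if "0 < s" for s a
    unfolding I_def using set_integral_const_eq[OF Dprops(3)[OF that] Dmeas[OF that]] mD[OF that] by simp
  have Imono: "I s h \<le> I t h" if "set_integrable lebesgue (D t) h" "0 < s" "s \<le> t" "t \<le> 1" for s t h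
    unfolding I_def using that by (intro set_integral_subset_mono set_integrable_norm Dmeas Dmono) auto
  have fci: "set_integrable lebesgue (D s) (\<lambda>x. f x - a)" if "0 < s" "s \<le> 1" for s a
    by (intro set_integral_diff(1) int[OF fL] cint that)
  have rn: "(2 ^ ?n) ^ k * r k ^ ?n = 1" for k
    unfolding r_def by (simp add: power_divide mult.commute flip: power_mult)
  \<comment> \<open>Both constants are compared with \<open>f\<close> on the smaller set; the
    estimate from the larger set loses the ratio \<open>2 ^ n\<close> of the measures.\<close>
  have step: "cmod (c (Suc k) - c k) \<le> ((2 ^ ?n + 1) * C3 / mQ) * \<rho> ^ k" for k
  proof -
    have "(2 ^ ?n) ^ Suc k * I (r (Suc k)) (\<lambda>x. c (Suc k) - c k)
        \<le> (2 ^ ?n) ^ Suc k * (I (r (Suc k)) (\<lambda>x. f x - c (Suc k)) + I (r k) (\<lambda>x. f x - c k))"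
    proof (intro mult_left_mono order_trans[OF Itri[OF r]] add_left_mono Imono[OF fci[OF r] r(1) _ r(2)])
      show "r (Suc k) \<le> r k" using r(1)[of k] by (simp add: rS)
    qed auto
    also have "\<dots> = (2 ^ ?n) ^ Suc k * I (r (Suc k)) (\<lambda>x. f x - c (Suc k)) + 2 ^ ?n * ((2 ^ ?n) ^ k * I (r k) (\<lambda>x. f x - c k))"
      by (simp add: distrib_left mult.assoc)
    also have "\<dots> \<le> C3 * \<rho> ^ Suc k + 2 ^ ?n * (C3 * \<rho> ^ k)"
      by (intro add_mono cb mult_left_mono) auto
    also have "\<dots> \<le> C3 * \<rho> ^ k + 2 ^ ?n * (C3 * \<rho> ^ k)"
    proof -
      have "C3 \<ge> 0" using M C20 by (simp add: C3_def)
      then have "C3 * \<rho> ^ Suc k \<le> C3 * \<rho> ^ k" using \<rho> by (intro mult_left_mono power_decreasing) auto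
      then show ?thesis by simp
    qed
    finally have "(2 ^ ?n) ^ Suc k * I (r (Suc k)) (\<lambda>x. c (Suc k) - c k) \<le> (2 ^ ?n + 1) * C3 * \<rho> ^ k"
      by (simp add: algebra_simps)
    moreover have "(2 ^ ?n) ^ Suc k * I (r (Suc k)) (\<lambda>x. c (Suc k) - c k) = cmod (c (Suc k) - c k) * mQ * ((2 ^ ?n) ^ Suc k * r (Suc k) ^ ?n)"
      unfolding Iconst[OF r(1)] by (simp only: mult_ac)
    ultimately have "cmod (c (Suc k) - c k) * mQ \<le> (2 ^ ?n + 1) * C3 * \<rho> ^ k" unfolding rn by simp
    then show ?thesis using mQ by (simp add: field_simps)
  qed
  have "summable (\<lambda>k. c (Suc k) - c k)"
  proof (rule summable_comparison_test')
    show "summable (\<lambda>k. ((2 ^ ?n + 1) * C3 / mQ) * \<rho> ^ k)"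
      using \<rho> by (intro summable_mult summable_geometric) auto
  qed (use step in auto)
  from summable_LIMSEQ[OF this] obtain l where "(\<lambda>k. c k - c 0) \<longlonglongrightarrow> l"
    by (auto simp: sum_lessThan_telescope)
  from tendsto_add[OF this tendsto_const[of "c 0"]] have cl: "c \<longlonglongrightarrow> l + c 0" by simp
  define d where "d = l + c 0"
  have "(\<lambda>k. I ((1/2) ^ k) (\<lambda>x. f x - d) * (2 ^ ?n) ^ k) \<longlonglongrightarrow> 0"
  proof (rule tendsto_sandwich[OF _ _ tendsto_const])
    show "\<forall>\<^sub>F k in sequentially. 0 \<le> I ((1/2) ^ k) (\<lambda>x. f x - d) * (2 ^ ?n) ^ k" using I0 by auto
    have "(\<lambda>k. C3 * \<rho> ^ k + cmod (c k - d) * mQ) \<longlonglongrightarrow> C3 * 0 + cmod (d - d) * mQ"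
      using \<rho> cl unfolding d_def by (intro tendsto_intros LIMSEQ_realpow_zero) auto
    then show "(\<lambda>k. C3 * \<rho> ^ k + cmod (c k - d) * mQ) \<longlonglongrightarrow> 0" by simp
    have "I (r k) (\<lambda>x. f x - d) * (2 ^ ?n) ^ k \<le> C3 * \<rho> ^ k + cmod (c k - d) * mQ" for k
    proof -
      have "I (r k) (\<lambda>x. f x - d) \<le> (LINT x:D (r k)|lebesgue. cmod (f x - c k) + cmod (c k - d))"
        unfolding I_def
      proof (rule set_integral_mono)
        show "cmod (f x - d) \<le> cmod (f x - c k) + cmod (c k - d)" for x
          using norm_triangle_ineq[of "f x - c k" "c k - d"] by simp
      qed (intro set_integral_add(1) set_integrable_norm fci r cint)+
      also have "\<dots> = I (r k) (\<lambda>x. f x - c k) + I (r k) (\<lambda>x. c k - d)"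
        unfolding I_def by (intro set_integral_add(2) set_integrable_norm fci r cint)
      finally have "I (r k) (\<lambda>x. f x - d) * (2 ^ ?n) ^ k \<le> (I (r k) (\<lambda>x. f x - c k) + I (r k) (\<lambda>x. c k - d)) * (2 ^ ?n) ^ k"
        by (intro mult_right_mono) auto
      also have "\<dots> = (2 ^ ?n) ^ k * I (r k) (\<lambda>x. f x - c k) + cmod (c k - d) * mQ * ((2 ^ ?n) ^ k * r k ^ ?n)"
        unfolding Iconst[OF r(1)] by (simp add: algebra_simps)
      finally show ?thesis unfolding rn using cb[of k] by simp
    qed
    then show "\<forall>\<^sub>F k in sequentially. I ((1/2) ^ k) (\<lambda>x. f x - d) * (2 ^ ?n) ^ k \<le> C3 * \<rho> ^ k + cmod (c k - d) * mQ"
      by (simp add: r_def)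
  qed
  from shrinking_mean_from_dyadic[OF _ this] have "((\<lambda>r. I r (\<lambda>x. f x - d) / r ^ ?n) \<longlongrightarrow> 0) (at_right 0)"
    using I0 Imono fci by fastforce
  then show ?thesis unfolding I_def D_def by blast
qed

section \<open>The space \<open>H\<^sup>2\<^sub>0\<close>\<close>

lemma weak_pderivs_props:
  assumes "g \<in> L2_on U" "has_weak_pderivs U is f g"
  shows "weak_pderivs U is f \<in> L2_on U" "has_weak_pderivs U is f (weak_pderivs U is f)"
proof -
  have "\<exists>g. g \<in> L2_on U \<and> has_weak_pderivs U is f g" using assms by blast
  from someI_ex[OF this] show "weak_pderivs U is f \<in> L2_on U" "has_weak_pderivs U is f (weak_pderivs U is f)"
    unfolding weak_pderivs_def by auto
qed

lemma L2_norm_weak_pderivs_le_sobolev_norm: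
  fixes U :: "(real^'n::finite) set"
  assumes "length is \<le> m"
  shows "L2_norm_on U (weak_pderivs U is f) \<le> sobolev_norm m U f"
proof -
  have fin: "finite {is :: 'n list. length is \<le> m}"
    using finite_lists_length_le[of "UNIV :: 'n set" m] by simp
  have "(L2_norm_on U (weak_pderivs U is f))\<^sup>2 \<le> (\<Sum>is | length is \<le> m. (L2_norm_on U (weak_pderivs U is f))\<^sup>2)"
    using assms fin by (intro member_le_sum) auto
  then show ?thesis unfolding sobolev_norm_def by (rule real_le_rsqrt)
qed

text \<open>The norm is expressed through weak derivatives picked by \<open>SOME\<close>. By
  uniqueness the one of \<open>u - \<eta>\<close> along \<open>is\<close> is, almost everywhere,
  \<open>G\<close> minus a classical derivative of \<open>\<eta>\<close>; so a small norm becomes L1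
  smallness of explicit functions. The estimate for \<open>u\<close> itself is the case of the empty
  list.\<close>

lemma sobolev_0_approx:
  fixes U :: "(real^'n::finite) set"
  assumes U: "open U" "bounded U" and u: "u \<in> sobolev_0 m U" and l: "length is \<le> m"
    and G: "G \<in> L2_on U" "has_weak_pderivs U is u G" and e: "e > 0"
  obtains \<eta> where "\<eta> \<in> test_functions U"
    "(LINT x:U|lebesgue. cmod (u x - \<eta> x)) \<le> e * (1 + measure lebesgue U)"
    "(LINT x:U|lebesgue. cmod (G x - pderivs (rev is) \<eta> x)) \<le> e * (1 + measure lebesgue U)"
proof -
  have Us: "U \<in> sets lebesgue" using U by auto
  obtain \<eta> where \<eta>: "\<eta> \<in> test_functions U" and n: "sobolev_norm m U (\<lambda>x. u x - \<eta> x) < e"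
    using u e unfolding sobolev_0_def by blast
  have uL: "u \<in> L2_on U" using u by (simp add: sobolev_0_def sobolev_def)
  note sm = test_functions_smooth[OF \<eta>]
  have key: "(LINT x:U|lebesgue. cmod (H x - pderivs (rev js) \<eta> x)) \<le> e * (1 + measure lebesgue U)"
    if j: "length js \<le> m" and H: "H \<in> L2_on U" "has_weak_pderivs U js u H" for js H
  proof -
    define H' where "H' = (\<lambda>x. H x - pderivs (rev js) \<eta> x)"
    have eL: "\<eta> \<in> L2_on U" "pderivs (rev js) \<eta> \<in> L2_on U"
      using sm by (auto intro!: smooth_L2_on smooth_pderivs U Us)
    have H'L: "H' \<in> L2_on U" unfolding H'_def by (rule L2_on_diff[OF H(1) eL(2)])
    note i = L2_on_integrable[OF _ U(2) Us]
    have w: "has_weak_pderivs U js (\<lambda>x. u x - \<eta> x) H'"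
      unfolding H'_def
      by (rule has_weak_pderivs_diff[OF U(2) i[OF uL] i[OF H(1)] i[OF eL(1)] i[OF eL(2)] H(2) smooth_has_weak_pderivs[OF sm]])
    define W where "W = weak_pderivs U js (\<lambda>x. u x - \<eta> x)"
    note W = weak_pderivs_props[OF H'L w, folded W_def]
    have ae: "AE x in lebesgue. x \<in> U \<longrightarrow> W x = H' x"
      by (rule has_weak_pderivs_unique[OF U i[OF W(1)] i[OF H'L] W(2) w])
    have "L2_norm_on U W \<le> e"
      using L2_norm_weak_pderivs_le_sobolev_norm[OF j, of U "\<lambda>x. u x - \<eta> x"] n by (simp add: W_def)
    then have "(L2_norm_on U W)\<^sup>2 \<le> e\<^sup>2"
      by (intro power_mono) (auto simp: L2_norm_on_def set_integral_pointwise_nonneg)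
    then have W2: "(LINT x:U|lebesgue. (cmod (W x))\<^sup>2) \<le> e\<^sup>2" by (simp add: L2_norm_on_power2)
    have "(LINT x:U|lebesgue. cmod (H' x)) = (LINT x:U|lebesgue. cmod (W x))"
      unfolding set_lebesgue_integral_def
    proof (rule integral_cong_AE)
      show "(\<lambda>x. indicat_real U x *\<^sub>R cmod (H' x)) \<in> borel_measurable lebesgue"
        using set_integrable_norm[OF i[OF H'L]] by (auto simp: set_integrable_def)
      show "(\<lambda>x. indicat_real U x *\<^sub>R cmod (W x)) \<in> borel_measurable lebesgue"
        using set_integrable_norm[OF i[OF W(1)]] by (auto simp: set_integrable_def)
      show "AE x in lebesgue. indicat_real U x *\<^sub>R cmod (H' x) = indicat_real U x *\<^sub>R cmod (W x)"
        using ae by eventually_elim (auto simp: indicator_def)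
    qed
    \<comment> \<open>The parameter \<open>1 / e\<close> makes both terms linear in
      \<open>e\<close>.\<close>
    also have "\<dots> \<le> (1 / e) * (LINT x:U|lebesgue. (cmod (W x))\<^sup>2) + measure lebesgue U / (1 / e)"
      using e by (intro L1_le_L2[OF W(1) U(2) Us]) auto
    also have "\<dots> \<le> (1 / e) * e\<^sup>2 + measure lebesgue U / (1 / e)"
      using e W2 by (intro add_right_mono mult_left_mono) auto
    also have "\<dots> = e * (1 + measure lebesgue U)" using e by (simp add: power2_eq_square algebra_simps)
    finally show ?thesis by (simp add: H'_def)
  qed
  have "has_weak_pderivs U [] u u" by (simp add: has_weak_pderivs_def)
  from that[OF \<eta> _ key[OF l G]] key[OF _ uL this] show thesis by simp
qed

lemma set_integral_mult_bound:
  fixes f h :: "'a::euclidean_space \<Rightarrow> complex"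
  assumes f: "set_integrable lebesgue U f" and h: "h \<in> borel_measurable lebesgue"
    and b: "\<And>x. x \<in> U \<Longrightarrow> cmod (h x) \<le> C"
  shows "cmod (LINT x:U|lebesgue. f x * h x) \<le> C * (LINT x:U|lebesgue. cmod (f x))"
proof -
  have "cmod (LINT x:U|lebesgue. f x * h x) \<le> (LINT x:U|lebesgue. cmod (f x * h x))"
    by (rule set_integral_norm_bound[OF set_integrable_mult_bounded[OF f h b]])
  also have "\<dots> \<le> (LINT x:U|lebesgue. C * cmod (f x))"
    unfolding set_lebesgue_integral_def
  proof (rule integral_mono)
    show "integrable lebesgue (\<lambda>x. indicat_real U x *\<^sub>R cmod (f x * h x))"
      using set_integrable_norm[OF set_integrable_mult_bounded[OF f h b]] by (simp add: set_integrable_def)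
    show "integrable lebesgue (\<lambda>x. indicat_real U x *\<^sub>R (C * cmod (f x)))"
      using set_integrable_mult_right[OF set_integrable_norm[OF f], of C] by (simp add: set_integrable_def)
    show "indicat_real U x *\<^sub>R cmod (f x * h x) \<le> indicat_real U x *\<^sub>R (C * cmod (f x))" for x
      using mult_right_mono[OF b[of x], of "cmod (f x)"] by (auto simp: indicator_def norm_mult mult.commute)
  qed
  also have "\<dots> = C * (LINT x:U|lebesgue. cmod (f x))" by simp
  finally show ?thesis .
qed

text \<open>For a test function in place of \<open>u\<close> this is classical, whatever
  \<open>h\<close> does at the boundary. Both sides are continuous in the L1 norms of
  \<open>u\<close> and \<open>G\<close>, as \<open>h\<close> and its derivatives are bounded on the
  bounded set \<open>U\<close>. This is the absence of boundary terms in Green's formula.\<close>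

lemma sobolev_0_integration_by_parts:
  fixes U :: "(real^'n::finite) set"
  assumes U: "open U" "bounded U" and u: "u \<in> sobolev_0 m U" and l: "length is \<le> m"
    and G: "G \<in> L2_on U" "has_weak_pderivs U is u G" and h: "smooth h"
  shows "(LINT x:U|lebesgue. u x * pderivs is h x) = (-1) ^ length is * (LINT x:U|lebesgue. G x * h x)"
proof -
  have Us: "U \<in> sets lebesgue" using U by auto
  have uL: "u \<in> L2_on U" using u by (simp add: sobolev_0_def sobolev_def)
  note i = L2_on_integrable[OF _ U(2) Us]
  have hs: "smooth (pderivs is h)" by (rule smooth_pderivs[OF h])
  obtain C1 where C1: "C1 > 0" "\<And>x. x \<in> U \<Longrightarrow> cmod (h x) \<le> C1" using smooth_bounded_on[OF h U(2)] by blast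
  obtain C2 where C2: "C2 > 0" "\<And>x. x \<in> U \<Longrightarrow> cmod (pderivs is h x) \<le> C2" using smooth_bounded_on[OF hs U(2)] by blast
  define d where "d = (LINT x:U|lebesgue. u x * pderivs is h x) - (-1) ^ length is * (LINT x:U|lebesgue. G x * h x)"
  define M where "M = (C1 + C2) * (1 + measure lebesgue U)"
  have M: "M > 0" using C1 C2 unfolding M_def by (intro mult_pos_pos add_pos_nonneg) auto
  have "cmod d \<le> e * M" if e: "e > 0" for e
  proof -
    obtain \<eta> where \<eta>: "\<eta> \<in> test_functions U"
      and b: "(LINT x:U|lebesgue. cmod (u x - \<eta> x)) \<le> e * (1 + measure lebesgue U)"
        "(LINT x:U|lebesgue. cmod (G x - pderivs (rev is) \<eta> x)) \<le> e * (1 + measure lebesgue U)"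
      using sobolev_0_approx[OF U u l G e] by blast
    note sm = test_functions_smooth[OF \<eta>]
    have ei: "set_integrable lebesgue U \<eta>" "set_integrable lebesgue U (pderivs (rev is) \<eta>)"
      using sm by (auto intro!: i smooth_L2_on smooth_pderivs U Us)
    have ibp: "(LINT x:U|lebesgue. \<eta> x * pderivs is h x) = (-1) ^ length is * (LINT x:U|lebesgue. pderivs (rev is) \<eta> x * h x)"
    proof -
      have "(LINT x:U|lebesgue. h x * pderivs (rev is) \<eta> x) = (-1) ^ length is * (LINT x:U|lebesgue. pderivs is h x * \<eta> x)"
        using integration_by_parts[OF h \<eta>, of "rev is"]
        by (simp add: set_integral_test_function[OF \<eta>] set_integral_test_function[OF test_functions_pderivs[OF \<eta>]])
      then show ?thesis by (cases "even (length is)") (auto simp: mult.commute)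
    qed
    have 1: "(LINT x:U|lebesgue. (u x - \<eta> x) * pderivs is h x) = (LINT x:U|lebesgue. u x * pderivs is h x) - (LINT x:U|lebesgue. \<eta> x * pderivs is h x)"
      unfolding left_diff_distrib
      by (rule set_integral_diff(2)[OF set_integrable_mult_smooth[OF i[OF uL] hs U(2)] set_integrable_mult_smooth[OF ei(1) hs U(2)]])
    have 2: "(LINT x:U|lebesgue. (G x - pderivs (rev is) \<eta> x) * h x) = (LINT x:U|lebesgue. G x * h x) - (LINT x:U|lebesgue. pderivs (rev is) \<eta> x * h x)"
      unfolding left_diff_distrib
      by (rule set_integral_diff(2)[OF set_integrable_mult_smooth[OF i[OF G(1)] h U(2)] set_integrable_mult_smooth[OF ei(2) h U(2)]])
    have "d = (LINT x:U|lebesgue. (u x - \<eta> x) * pderivs is h x) - (-1) ^ length is * (LINT x:U|lebesgue. (G x - pderivs (rev is) \<eta> x) * h x)"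
      unfolding d_def 1 2 right_diff_distrib ibp by simp
    then have "cmod d \<le> cmod (LINT x:U|lebesgue. (u x - \<eta> x) * pderivs is h x) + cmod (LINT x:U|lebesgue. (G x - pderivs (rev is) \<eta> x) * h x)"
      using norm_triangle_ineq4[of "LINT x:U|lebesgue. (u x - \<eta> x) * pderivs is h x" "(-1) ^ length is * (LINT x:U|lebesgue. (G x - pderivs (rev is) \<eta> x) * h x)"]
      by (simp add: norm_mult norm_power)
    also have "\<dots> \<le> C2 * (LINT x:U|lebesgue. cmod (u x - \<eta> x)) + C1 * (LINT x:U|lebesgue. cmod (G x - pderivs (rev is) \<eta> x))"
      by (intro add_mono set_integral_mult_bound set_integral_diff(1) i[OF uL] i[OF G(1)] ei smooth_measurable h hs C1 C2)
    also have "\<dots> \<le> C2 * (e * (1 + measure lebesgue U)) + C1 * (e * (1 + measure lebesgue U))"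
      using C1 C2 by (intro add_mono mult_left_mono b) auto
    also have "\<dots> = e * M" by (simp add: M_def algebra_simps)
    finally show ?thesis .
  qed
  note small = this
  have "d = 0"
  proof (rule ccontr)
    assume "d \<noteq> 0"
    then have "cmod d / (2 * M) > 0" using M by simp
    from small[OF this] have "cmod d \<le> cmod d / 2" using M by simp
    then show False using \<open>d \<noteq> 0\<close> by simp
  qed
  then show ?thesis by (simp add: d_def)
qed

lemma L2_on_zero_extension:
  assumes f: "f \<in> L2_on U" and W: "W \<in> sets lebesgue"
  shows "(\<lambda>x. indicator U x * f x) \<in> L2_on W"
proof -
  have fm: "(\<lambda>x. indicat_real U x *\<^sub>R f x) \<in> borel_measurable lebesgue"
    and fi: "integrable lebesgue (\<lambda>x. indicat_real U x *\<^sub>R (cmod (f x))\<^sup>2)"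
    using f by (auto simp: L2_on_def set_borel_measurable_def set_integrable_def)
  have "(\<lambda>x. indicat_real W x *\<^sub>R (indicat_real U x *\<^sub>R f x)) \<in> borel_measurable lebesgue"
    using borel_measurable_indicator[OF W, where 'b=real] fm by (rule borel_measurable_scaleR)
  moreover have "(\<lambda>x. indicat_real W x *\<^sub>R (indicat_real U x *\<^sub>R f x)) = (\<lambda>x. indicat_real W x *\<^sub>R (indicator U x * f x))"
    by (auto simp: indicator_def)
  moreover have "integrable lebesgue (\<lambda>x. indicat_real W x *\<^sub>R (indicat_real U x *\<^sub>R (cmod (f x))\<^sup>2))"
    by (rule integrable_mult_indicator[OF W fi])
  moreover have "(\<lambda>x. indicat_real W x *\<^sub>R (indicat_real U x *\<^sub>R (cmod (f x))\<^sup>2)) = (\<lambda>x. indicat_real W x *\<^sub>R (cmod (indicator U x * f x))\<^sup>2)"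
    by (auto simp: indicator_def)
  ultimately show ?thesis by (simp add: L2_on_def set_borel_measurable_def set_integrable_def)
qed

text \<open>A test function on \<open>W\<close> need not vanish near the boundary of
  \<open>U\<close>, but it is smooth, and \<open>sobolev_0_integration_by_parts\<close> admits every
  smooth function. So the zero extensions of the weak derivatives are weak derivatives of the zero
  extension.\<close>

lemma sobolev_0_zero_extension:
  fixes U W :: "(real^'n::finite) set"
  assumes U: "open U" "bounded U" and u: "u \<in> sobolev_0 m U" and W: "open W"
  shows "(\<lambda>x. indicator U x * u x) \<in> sobolev m W"
  unfolding sobolev_def
proof (intro CollectI conjI allI impI)
  have Ws: "W \<in> sets lebesgue" using W by auto
  have uS: "u \<in> sobolev m U" using u by (simp add: sobolev_0_def)
  show "(\<lambda>x. indicator U x * u x) \<in> L2_on W"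
    using uS by (intro L2_on_zero_extension Ws) (simp add: sobolev_def)
  fix "is" :: "'n list" assume l: "length is \<le> m"
  then obtain G where G: "G \<in> L2_on U" "has_weak_pderivs U is u G"
    using uS by (auto simp: sobolev_def)
  have "has_weak_pderivs W is (\<lambda>x. indicator U x * u x) (\<lambda>x. indicator U x * G x)"
    unfolding has_weak_pderivs_def
  proof
    fix \<eta> assume \<eta>: "\<eta> \<in> test_functions W"
    have e: "(LINT x:W|lebesgue. (indicator U x * f x) * g x) = (LINT x:U|lebesgue. f x * g x)"
      if "g \<in> test_functions W" for f g
      unfolding set_lebesgue_integral_def
      using test_functions_outside[OF that] by (intro Bochner_Integration.integral_cong) (auto simp: indicator_def)
    show "(LINT x:W|lebesgue. indicator U x * u x * pderivs is \<eta> x) = (- 1) ^ length is * (LINT x:W|lebesgue. indicator U x * G x * \<eta> x)"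
      unfolding e[OF \<eta>] e[OF test_functions_pderivs[OF \<eta>]]
      by (rule sobolev_0_integration_by_parts[OF U u l G test_functions_smooth[OF \<eta>]])
  qed
  with L2_on_zero_extension[OF G(1) Ws]
  show "\<exists>g\<in>L2_on W. has_weak_pderivs W is (\<lambda>x. indicator U x * u x) g" by blast
qed

lemma translate_scale_unit_ball:
  fixes xc :: "'a::euclidean_space"
  assumes "r > 0"
  shows "(\<lambda>y. xc + r *\<^sub>R y) ` ball 0 1 = ball xc r"
proof -
  have "(\<lambda>y. xc + r *\<^sub>R y) ` ball 0 1 = (+) xc ` ((*\<^sub>R) r ` ball 0 1)" by (rule translate_scale_image)
  also have "\<dots> = ball xc r" using assms by (simp add: ball_translation[symmetric] ball_scale)
  finally show ?thesis .
qed

text \<open>The zero extension of \<open>u\<close> is again \<open>H\<^sup>2\<close>, so its means converge; as it vanishes on a half ball,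
  the limit is \<open>0\<close>.\<close>

lemma sobolev_0_mean_limit:
  fixes U :: "(real^'n::finite) set"
  assumes U: "open U" "bounded U" "convex U" and n3: "CARD('n) \<le> 3" and u: "u \<in> sobolev_0 2 U" and xc: "xc \<notin> U"
  shows "((\<lambda>r. (LINT x:(ball xc r \<inter> U)|lebesgue. cmod (u x)) / r ^ CARD('n)) \<longlongrightarrow> 0) (at_right 0)"
proof -
  define u' where "u' = (\<lambda>x. indicator U x * u x)"
  define Q where "Q = ball (0::real^'n) 1"
  have Qr: "(\<lambda>y. xc + r *\<^sub>R y) ` Q = ball xc r" if "r > 0" for r
    using translate_scale_unit_ball[OF that] by (simp add: Q_def)
  have "u' \<in> sobolev 2 ((\<lambda>y. xc + y) ` Q)"
    using sobolev_0_zero_extension[OF U(1,2) u, of "ball xc 1"] Qr[of 1] by (simp add: u'_def)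
  moreover have "0 \<in> closure Q" "open Q" "convex Q" "bounded Q" "Q \<noteq> {}" by (auto simp: Q_def)
  ultimately obtain c where c: "((\<lambda>r. (LINT x:(\<lambda>y. xc + r *\<^sub>R y) ` Q|lebesgue. cmod (u' x - c)) / r ^ CARD('n)) \<longlongrightarrow> 0) (at_right 0)"
    using sobolev2_mean_limit[of Q u' xc] n3 by blast
  have ball: "((\<lambda>r. (LINT x:ball xc r|lebesgue. cmod (u' x - c)) / r ^ CARD('n)) \<longlongrightarrow> 0) (at_right 0)"
    using c by (rule Lim_transform_eventually) (auto simp: eventually_at_filter Qr)
  have ui: "set_integrable lebesgue (ball xc r) u'" for r
    unfolding u'_def using u by (intro L2_on_integrable L2_on_zero_extension) (auto simp: sobolev_0_def sobolev_def)
  have ci: "set_integrable lebesgue (ball xc r) (\<lambda>x. d::complex)" for r d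
    by (intro continuous_set_integrable) auto
  have "c = 0"
  proof (cases "U = {}")
    case True
    have "(\<lambda>r. (LINT x:ball xc r|lebesgue. cmod (u' x - c)) / r ^ CARD('n)) = (\<lambda>r. cmod c * measure lebesgue (ball xc r) / r ^ CARD('n))"
      using True set_integral_const_eq[of "ball xc _" "cmod c"] by (simp add: u'_def)
    moreover have "\<forall>\<^sub>F r in at_right 0. cmod c * measure lebesgue (ball xc r) / r ^ CARD('n) = cmod c * measure lebesgue Q"
      using measure_translate_scale[of Q _ xc] Qr by (auto simp: eventually_at_filter Q_def)
    ultimately have "((\<lambda>r::real. cmod c * measure lebesgue Q) \<longlongrightarrow> 0) (at_right 0)"
      using ball by (simp add: tendsto_cong)
    then have "cmod c * measure lebesgue Q = 0" by (simp add: tendsto_const_iff)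
    moreover have "measure lebesgue Q > 0" unfolding Q_def by (intro measure_open_pos) auto
    ultimately show ?thesis by simp
  next
    case False
    obtain a b where a: "a \<noteq> 0" "\<forall>x\<in>U. a \<bullet> x \<le> b" "\<forall>x\<in>{xc}. a \<bullet> x \<ge> b"
      using separating_hyperplane_sets[of U "{xc}"] U xc False by auto
    \<comment> \<open>The half of the unit ball that points away from \<open>U\<close> across the
      separating hyperplane; attached to \<open>xc\<close>, all its dilates avoid
      \<open>U\<close>.\<close>
    define P where "P = Q \<inter> {y. a \<bullet> y > 0}"
    have P: "open P" "bounded P" "P \<noteq> {}"
    proof -
      show "open P" unfolding P_def Q_def by (intro open_Int open_ball open_halfspace_gt)
      show "bounded P" unfolding P_def Q_def by auto
      have "(1 / (2 * norm a)) *\<^sub>R a \<in> P" using a(1) by (simp add: P_def Q_def)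
      then show "P \<noteq> {}" by blast
    qed
    have mP: "measure lebesgue P > 0" by (rule measure_open_pos[OF P])
    have lb: "cmod c * measure lebesgue P \<le> (LINT x:ball xc r|lebesgue. cmod (u' x - c)) / r ^ CARD('n)" if r: "r > 0" for r
    proof -
      let ?H = "(\<lambda>y. xc + r *\<^sub>R y) ` P"
      have H: "?H \<subseteq> ball xc r" using Qr[OF r] by (auto simp: P_def)
      have "x \<notin> U" if xH: "x \<in> ?H" for x
      proof -
        obtain y where y: "y \<in> P" "x = xc + r *\<^sub>R y" using xH by blast
        then have "a \<bullet> x > a \<bullet> xc" using r by (simp add: P_def inner_add_right)
        then show ?thesis using a by force
      qed
      then have u0: "indicat_real ?H x *\<^sub>R cmod (u' x - c) = indicat_real ?H x *\<^sub>R cmod c" for x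
        by (auto simp: u'_def indicator_def)
      have oH: "open ?H" "bounded ?H" using P r by (auto intro: open_translate_scale bounded_translate_scale)
      have "cmod c * measure lebesgue P * r ^ CARD('n) = cmod c * measure lebesgue ?H"
        using measure_translate_scale[OF P(1,2) r, of xc] by simp
      also have "\<dots> = (LINT x:?H|lebesgue. cmod (u' x - c))"
        using set_integral_const_eq[of ?H "cmod c"] oH unfolding set_lebesgue_integral_def u0 by simp
      also have "\<dots> \<le> (LINT x:ball xc r|lebesgue. cmod (u' x - c))"
        using oH by (intro set_integral_subset_mono H set_integrable_norm set_integral_diff(1) ui ci) auto
      finally show ?thesis using r by (simp add: pos_le_divide_eq)
    qed
    have "cmod c * measure lebesgue P \<le> 0"
      by (rule tendsto_lowerbound[OF ball]) (use lb in \<open>auto simp: eventually_at_filter\<close>)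
    then show ?thesis using mP by (simp add: mult_le_0_iff)
  qed
  have "(LINT x:ball xc r|lebesgue. cmod (u' x - c)) = (LINT x:(ball xc r \<inter> U)|lebesgue. cmod (u x))" for r
    unfolding set_lebesgue_integral_def \<open>c = 0\<close> u'_def
    by (intro Bochner_Integration.integral_cong) (auto simp: indicator_def)
  then show ?thesis using ball by simp
qed

text \<open>The sum \<open>S\<close> of the pure second weak derivatives is the weak Laplacian of
  \<open>u\<close>. The equation is given for test functions only; it forces \<open>S = F\<close>
  almost everywhere, and \<open>S\<close> may be paired with any smooth \<open>h\<close>.\<close>

lemma laplacian_orthogonal_harmonic:
  fixes U :: "(real^'n::finite) set"
  assumes U: "open U" "bounded U" and u: "u \<in> sobolev_0 2 U" and F: "set_integrable lebesgue U F"
    and eq: "\<And>\<eta>. \<eta> \<in> test_functions U \<Longrightarrow> (LINT x:U|lebesgue. u x * laplacian \<eta> x) = (LINT x:U|lebesgue. F x * \<eta> x)"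
    and h: "smooth h" "\<And>x. laplacian h x = 0"
  shows "(LINT x:U|lebesgue. F x * h x) = 0"
proof -
  have Us: "U \<in> sets lebesgue" using U by auto
  have uS: "u \<in> sobolev 2 U" using u by (simp add: sobolev_0_def)
  then have uL: "u \<in> L2_on U" by (simp add: sobolev_def)
  note i = L2_on_integrable[OF _ U(2) Us]
  have "\<forall>j. \<exists>G\<in>L2_on U. has_weak_pderivs U [j, j] u G"
    using uS by (auto simp: sobolev_def)
  then obtain G where G: "\<And>j. G j \<in> L2_on U" "\<And>j. has_weak_pderivs U [j, j] u (G j)" by metis
  define S where "S x = (\<Sum>j\<in>UNIV. G j x)" for x
  have Sg: "set_integrable lebesgue U (\<lambda>x. S x * g x)"
    and Sl: "(LINT x:U|lebesgue. S x * g x) = (LINT x:U|lebesgue. u x * laplacian g x)" if g: "smooth g" for g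
  proof -
    have m: "set_integrable lebesgue U (\<lambda>x. G j x * g x)" for j
      by (rule set_integrable_mult_smooth[OF i[OF G(1)] g U(2)])
    show "set_integrable lebesgue U (\<lambda>x. S x * g x)"
      unfolding S_def sum_distrib_right 
      using Bochner_Integration.integrable_sum[where I=UNIV and M=lebesgue and f="\<lambda>j x. indicator U x *\<^sub>R (G j x * g x)"] m
      by (simp add: set_integrable_def scaleR_sum_right)
    have "(LINT x:U|lebesgue. S x * g x) = (\<Sum>j\<in>UNIV. LINT x:U|lebesgue. G j x * g x)"
      unfolding S_def sum_distrib_right 
      using Bochner_Integration.integral_sum[where I=UNIV and M=lebesgue and f="\<lambda>j x. indicator U x *\<^sub>R (G j x * g x)"] m
      by (simp add: set_integrable_def set_lebesgue_integral_def scaleR_sum_right)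
    also have "\<dots> = (\<Sum>j\<in>UNIV. LINT x:U|lebesgue. u x * pderivs [j, j] g x)"
      using sobolev_0_integration_by_parts[OF U u _ G g] by (intro sum.cong) auto
    also have "\<dots> = (LINT x:U|lebesgue. (\<Sum>j\<in>UNIV. u x * pderivs [j, j] g x))"
      using Bochner_Integration.integral_sum[where I=UNIV and M=lebesgue and f="\<lambda>j x. indicator U x *\<^sub>R (u x * pderivs [j, j] g x)"]
        set_integrable_mult_smooth[OF i[OF uL] smooth_pderivs[OF g] U(2)]
      by (simp only: set_integrable_def set_lebesgue_integral_def scaleR_sum_right)
    finally show "(LINT x:U|lebesgue. S x * g x) = (LINT x:U|lebesgue. u x * laplacian g x)"
      by (simp only: laplacian_def sum_distrib_left)
  qed
  have Si: "set_integrable lebesgue U S" using Sg[OF smooth_const[of 1]] by simp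
  have "AE x in lebesgue. x \<in> U \<longrightarrow> S x - F x = 0"
  proof (rule test_functions_orthogonal_AE[OF U set_integral_diff(1)[OF Si F]])
    fix \<eta> assume \<eta>: "\<eta> \<in> test_functions U"
    note sm = test_functions_smooth[OF \<eta>]
    show "(LINT x:U|lebesgue. (S x - F x) * \<eta> x) = 0"
      unfolding left_diff_distrib set_integral_diff(2)[OF Sg[OF sm] set_integrable_mult_smooth[OF F sm U(2)]] Sl[OF sm] eq[OF \<eta>] by simp
  qed
  then have ae: "AE x in lebesgue. x \<in> U \<longrightarrow> F x = S x" by eventually_elim auto
  have "(LINT x:U|lebesgue. F x * h x) = (LINT x:U|lebesgue. S x * h x)"
    using F Si by (intro set_integral_AE_cong[OF ae] smooth_measurable[OF h(1)]) (auto simp: set_integrable_def)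
  also have "\<dots> = 0" unfolding Sl[OF h(1)] by (simp add: h(2) set_lebesgue_integral_def)
  finally show ?thesis .
qed

section \<open>Vertices\<close>

text \<open>Near the vertex \<open>xc\<close> the set \<open>\<Omega>\<close> is the image of the positive orthant under \<open>T\<close>, and
  \<open>exp (a \<bullet> x + \<i> (b \<bullet> x))\<close> is a harmonic function that decays on the tangent cone.\<close>

locale simplicial_corner =
  fixes \<Omega> :: "(real^'n::finite) set" and xc :: "real^'n" and T N :: "real^'n \<Rightarrow> real^'n"
    and \<epsilon> :: real and a b :: "real^'n"
  assumes linear_T: "linear T" and linear_N: "linear N"
    and NT: "N (T y) = y" and TN: "T (N x) = x"
    and \<epsilon>_pos: "\<epsilon> > 0"
    and norm_ab: "norm a = norm b" and orth_ab: "a \<bullet> b = 0"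
    and a_neg: "a \<bullet> T (axis i 1) < 0"
    and \<Omega>_cone: "x \<in> \<Omega> \<Longrightarrow> N (x - xc) $ i > 0"
    and box_\<Omega>: "(\<And>i. 0 < N (x - xc) $ i \<and> N (x - xc) $ i < \<epsilon>) \<Longrightarrow> x \<in> \<Omega>"

text \<open>An extreme point of a closed box has every coordinate at an end of its interval, since
  otherwise it is the midpoint of a segment in the box. Reflecting the coordinates at the upper end
  turns the edges at the vertex into positive axes.\<close>

lemma cuboid_corner:
  fixes \<Omega> :: "(real^'n::finite) set"
  assumes c: "cuboid \<Omega>" and v: "vertex_of xc \<Omega>"
  shows "\<exists>T N \<epsilon> a b. simplicial_corner \<Omega> xc T N \<epsilon> a b"
proof -
  obtain T :: "real^'n \<Rightarrow> real^'n" and c l u where n: "CARD('n) = 3" and ne: "\<Omega> \<noteq> {}"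
    and T: "orthogonal_transformation T" and \<Omega>: "\<Omega> = (\<lambda>x. c + T x) ` box l u"
    using c unfolding cuboid_def by blast
  have linT: "linear T" and injT: "inj T"
    using T by (auto simp: orthogonal_transformation_linear orthogonal_transformation_inj)
  have lu: "l $ i < u $ i" for i
  proof -
    obtain y where "y \<in> box l u" using ne \<Omega> by auto
    then show ?thesis by (force simp: mem_box_cart intro: less_trans)
  qed
  have cl: "closure \<Omega> = (\<lambda>x. c + T x) ` cbox l u"
  proof -
    have "box l u \<noteq> {}" using ne \<Omega> by auto
    have "\<Omega> = (+) c ` (T ` box l u)" by (simp add: \<Omega> image_image)
    then have "closure \<Omega> = (+) c ` (T ` closure (box l u))"
      by (simp add: closure_translation closure_injective_linear_image[OF linT injT])
    then show ?thesis using \<open>box l u \<noteq> {}\<close> by (simp add: closure_box image_image)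
  qed
  have ext: "xc extreme_point_of (closure \<Omega>)" using v by (simp add: vertex_of_def)
  then obtain p where p: "p \<in> cbox l u" "xc = c + T p"
    unfolding extreme_point_of_def cl by blast
  have pv: "p $ i = l $ i \<or> p $ i = u $ i" for i
  proof (rule ccontr)
    assume "\<not> ?thesis"
    then have i: "l $ i < p $ i" "p $ i < u $ i" using p(1) by (auto simp: mem_box_cart less_le)
    define d where "d = min (p $ i - l $ i) (u $ i - p $ i)"
    have d: "d > 0" "l $ i \<le> p $ i - d" "p $ i + d \<le> u $ i" using i by (auto simp: d_def)
    let ?q1 = "p + d *\<^sub>R axis i 1" and ?q2 = "p - d *\<^sub>R axis i 1"
    have q: "?q1 \<in> cbox l u" "?q2 \<in> cbox l u"
      using p(1) d by (auto simp: mem_box_cart axis_def algebra_simps)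
    then have "c + T ?q1 \<in> closure \<Omega>" "c + T ?q2 \<in> closure \<Omega>" unfolding cl by blast+
    moreover have "xc \<in> open_segment (c + T ?q1) (c + T ?q2)"
    proof -
      have "xc = midpoint (c + T ?q1) (c + T ?q2)"
        unfolding p(2) midpoint_def
        by (simp add: linear_add[OF linT] linear_diff[OF linT] scaleR_right_distrib scaleR_right_diff_distrib flip: scaleR_left_distrib)
      moreover have "T ?q1 \<noteq> T ?q2"
      proof
        assume "T ?q1 = T ?q2"
        then have "?q1 = ?q2" using injT by (simp add: inj_eq)
        then have "?q1 $ i = ?q2 $ i" by (rule arg_cong)
        then show False using d(1) by (simp add: axis_def)
      qed
      ultimately show ?thesis by (simp add: midpoint_in_open_segment)
    qed
    ultimately show False using ext unfolding extreme_point_of_def by blast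
  qed
  define \<sigma> where "\<sigma> i = (if p $ i = l $ i then 1 else -1 :: real)" for i
  have \<sigma>2: "\<sigma> i * \<sigma> i = 1" for i by (simp add: \<sigma>_def)
  define S where "S y = (\<chi> i. \<sigma> i * y $ i)" for y :: "real^'n"
  have linS: "linear S" by (rule linearI) (auto simp: S_def vec_eq_iff algebra_simps)
  have SS: "S (S y) = y" for y by (simp add: S_def vec_eq_iff \<sigma>2 flip: mult.assoc)
  have Sin: "S x \<bullet> S y = x \<bullet> y" for x y
  proof -
    have "\<sigma> i * x $ i * (\<sigma> i * y $ i) = x $ i * y $ i" for i
      using \<sigma>2[of i] by (metis (no_types, opaque_lifting) mult.assoc mult.commute mult.left_commute mult_1)
    then show ?thesis unfolding S_def inner_vec_def by (simp only: vec_lambda_beta inner_real_def)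
  qed
  define Ti where "Ti = inv T"
  have oTi: "orthogonal_transformation Ti" unfolding Ti_def by (rule orthogonal_transformation_inv[OF T])
  have surjT: "surj T" using T by (simp add: orthogonal_transformation_surj)
  have TTi: "T (Ti x) = x" "Ti (T x) = x" for x
    unfolding Ti_def using injT surjT by (auto simp: surj_f_inv_f)
  have Tin: "T x \<bullet> T y = x \<bullet> y" for x y using T by (simp add: orthogonal_transformation_def)
  define T' where "T' = T \<circ> S"
  define N' where "N' = S \<circ> Ti"
  \<comment> \<open>The shortest edge: coordinates below it stay clear of the opposite
    faces.\<close>
  define \<epsilon> where "\<epsilon> = Min (range (\<lambda>i. u $ i - l $ i))"
  have \<epsilon>: "\<epsilon> > 0" "\<epsilon> \<le> u $ i - l $ i" for i
    unfolding \<epsilon>_def using lu by auto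
  have T'in: "T' x \<bullet> T' y = x \<bullet> y" for x y by (simp add: T'_def Tin Sin)
  have N'd: "N' (c + T q - xc) $ i = \<sigma> i * (q $ i - p $ i)" for q i
  proof -
    have "Ti (c + T q - xc) = q - p" unfolding p(2) by (simp add: linear_diff[OF linT, symmetric] TTi)
    then show ?thesis by (simp add: N'_def S_def)
  qed
  obtain i j k :: 'n where ijk: "UNIV = {i, j, k}" "i \<noteq> j" "j \<noteq> k" "i \<noteq> k"
    using n unfolding card_3_iff by auto
  \<comment> \<open>All entries of \<open>\<alpha>\<close> must be negative, and
    \<open>\<beta>\<close> orthogonal to it with the same length. \<open>\<beta>\<close> is
    proportional to the difference of the axes \<open>j\<close> and \<open>k\<close>, on which
    \<open>\<alpha>\<close> has equal entries, and both vectors have squared length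
    \<open>3/2\<close>.\<close>
  define \<alpha> :: "real^'n" where "\<alpha> = (\<chi> m. if m = i then -1 else -1/2)"
  define \<beta> :: "real^'n" where "\<beta> = (\<chi> m. if m = i then 0 else if m = j then sqrt 3 / 2 else - (sqrt 3 / 2))"
  have sum3: "(\<Sum>m\<in>UNIV. f m) = f i + f j + f k" for f :: "'n \<Rightarrow> real"
    unfolding ijk(1) using ijk(2-4) by (simp add: add.assoc)
  have ab: "\<alpha> \<bullet> \<beta> = 0" "\<alpha> \<bullet> \<alpha> = \<beta> \<bullet> \<beta>"
    using ijk by (auto simp: inner_vec_def sum3 \<alpha>_def \<beta>_def)
  have "simplicial_corner \<Omega> xc T' N' \<epsilon> (T' \<alpha>) (T' \<beta>)"
  proof (rule simplicial_corner.intro)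
    show "linear T'" unfolding T'_def by (rule linear_compose[OF linS linT])
    show "linear N'" unfolding N'_def
      by (rule linear_compose[OF orthogonal_transformation_linear[OF oTi] linS])
    show "N' (T' y) = y" "T' (N' x) = x" for x y by (simp_all add: N'_def T'_def TTi SS)
    show "norm (T' \<alpha>) = norm (T' \<beta>)" by (simp add: norm_eq_sqrt_inner T'in ab)
    show "T' \<alpha> \<bullet> T' \<beta> = 0" by (simp add: T'in ab)
    show "T' \<alpha> \<bullet> T' (axis m 1) < 0" for m by (simp add: T'in inner_axis \<alpha>_def)
    show "N' (x - xc) $ m > 0" if xO: "x \<in> \<Omega>" for x m
    proof -
      obtain q where q: "q \<in> box l u" "x = c + T q" using xO \<Omega> by auto
      then have "l $ m < q $ m" "q $ m < u $ m" by (auto simp: mem_box_cart)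
      then show ?thesis unfolding q(2) N'd using pv[of m] by (auto simp: \<sigma>_def)
    qed
    show "x \<in> \<Omega>" if "\<And>m. 0 < N' (x - xc) $ m \<and> N' (x - xc) $ m < \<epsilon>" for x
    proof -
      define q where "q = Ti (x - c)"
      have x: "x = c + T q" by (simp add: q_def TTi)
      have "l $ m < q $ m \<and> q $ m < u $ m" for m
        using that[of m] \<epsilon>(2)[of m] pv[of m] lu[of m] unfolding x N'd by (auto simp: \<sigma>_def split: if_splits)
      then have "q \<in> box l u" by (simp add: mem_box_cart)
      then show ?thesis unfolding \<Omega> x by blast
    qed
  qed (use \<epsilon> in auto)
  then show ?thesis by blast
qed

text \<open>In the plane the cone at a vertex is spanned by the two generators of extreme slope, the
  slope being measured against a functional that is positive on all vectors from the vertex to the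
  other generators.\<close>

lemma convex_polygon_corner:
  fixes \<Omega> :: "(real^'n::finite) set"
  assumes c: "convex_polygon \<Omega>" and v: "vertex_of xc \<Omega>"
  shows "\<exists>T N \<epsilon> a b. simplicial_corner \<Omega> xc T N \<epsilon> a b"
proof -
  obtain P where n: "CARD('n) = 2" and ne: "\<Omega> \<noteq> {}" and P: "polytope P" and \<Omega>: "\<Omega> = interior P"
    using c unfolding convex_polygon_def by blast
  obtain V where V: "finite V" "P = convex hull V" using P unfolding polytope_def by blast
  have "closure \<Omega> = P"
    using ne convex_closure_interior[OF polytope_imp_convex[OF P]] polytope_imp_closed[OF P] unfolding \<Omega> by simp
  then have ext: "xc extreme_point_of P" using v by (simp add: vertex_of_def)
  have xV: "xc \<in> V" using ext extreme_point_of_convex_hull V by blast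
  \<comment> \<open>An extreme point is not in the hull of the remaining generators. Separating it
    from that hull yields the positive functional \<open>e\<close>.\<close>
  define H where "H = convex hull (V - {xc})"
  have "convex (P - {xc})" using ext polytope_imp_convex[OF P] extreme_point_of_stillconvex by blast
  moreover have "V - {xc} \<subseteq> P - {xc}" using V(2) hull_subset[of V convex] by blast
  ultimately have "H \<subseteq> P - {xc}" unfolding H_def by (rule hull_minimal[rotated])
  then have "xc \<notin> H" by blast
  moreover have "convex H" "closed H"
    unfolding H_def using V(1) by (auto intro!: compact_imp_closed finite_imp_compact_convex_hull)
  ultimately obtain e d where e: "e \<bullet> xc < d" "\<forall>x\<in>H. e \<bullet> x > d"
    using separating_hyperplane_closed_point[of H xc] by blast
  define W where "W = (\<lambda>v. v - xc) ` (V - {xc})"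
  have hW: "e \<bullet> w > 0" if wW: "w \<in> W" for w
  proof -
    obtain v where v: "v \<in> V - {xc}" "w = v - xc" using wW unfolding W_def by blast
    then have "v \<in> H" unfolding H_def by (intro hull_inc)
    then have "e \<bullet> v > d" using e(2) by blast
    then show ?thesis using e(1) v(2) by (simp add: inner_diff_right)
  qed
  have finW: "finite W" unfolding W_def using V by auto
  obtain i j :: 'n where ij: "UNIV = {i, j}" "i \<noteq> j" using n unfolding card_2_iff by auto
  have sum2: "(\<Sum>m\<in>UNIV. f m) = f i + f j" for f :: "'n \<Rightarrow> real"
    unfolding ij(1) using ij(2) by simp
  have P_nonempty_interior: "interior P \<noteq> {}" using ne \<Omega> by simp
  \<comment> \<open>Otherwise \<open>P\<close> would lie in a hyperplane and have empty interior.
    Below this shows that other generators exist at all, and that they do not share one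
    slope.\<close>
  have hyper: "False" if f: "f \<noteq> 0" and z: "\<And>w. w \<in> W \<Longrightarrow> f \<bullet> w = 0" for f
  proof -
    have "f \<bullet> v = f \<bullet> xc" if "v \<in> V" for v
    proof (cases "v = xc")
      case False
      then have "v - xc \<in> W" using that by (auto simp: W_def)
      from z[OF this] show ?thesis by (simp add: inner_diff_right)
    qed auto
    then have "P \<subseteq> {x. f \<bullet> x = f \<bullet> xc}" unfolding V(2) by (intro hull_minimal convex_hyperplane) auto
    then have "interior P \<subseteq> interior {x. f \<bullet> x = f \<bullet> xc}" by (rule interior_mono)
    then show False using P_nonempty_interior interior_hyperplane[OF f] by auto
  qed
  have Wne: "W \<noteq> {}" using hyper[of "axis i 1"] by (auto simp: axis_eq_0_iff)
  have e0: "e \<noteq> 0" using Wne hW by fastforce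
  \<comment> \<open>\<open>e\<close> turned by a right angle. Besides measuring slopes it is the
    vector \<open>b\<close> of the harmonic exponential, with \<open>a = - e\<close>.\<close>
  define e' :: "real^'n" where "e' = (\<chi> m. if m = i then - (e $ j) else e $ i)"
  have e'i: "e' $ i = - (e $ j)" "e' $ j = e $ i" using ij by (auto simp: e'_def)
  have ee: "e \<bullet> e' = 0" "e' \<bullet> e' = e \<bullet> e" by (auto simp: inner_vec_def sum2 e'i)
  define \<sigma> where "\<sigma> w = (e' \<bullet> w) / (e \<bullet> w)" for w
  have s: "e' \<bullet> w = \<sigma> w * (e \<bullet> w)" if "w \<in> W" for w using hW[OF that] by (simp add: \<sigma>_def)
  obtain p where p: "p \<in> W" "\<And>w. w \<in> W \<Longrightarrow> \<sigma> w \<le> \<sigma> p"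
    using finite_imageI[OF finW, of \<sigma>] Wne Max_in[of "\<sigma> ` W"] Max_ge[of "\<sigma> ` W"] by (metis (no_types, lifting) imageE image_eqI image_is_empty)
  obtain q where q: "q \<in> W" "\<And>w. w \<in> W \<Longrightarrow> \<sigma> q \<le> \<sigma> w"
    using finite_imageI[OF finW, of \<sigma>] Wne Min_in[of "\<sigma> ` W"] Min_le[of "\<sigma> ` W"] by (metis (no_types, lifting) imageE image_eqI image_is_empty)
  define D where "D = \<sigma> p - \<sigma> q"
  have D: "D > 0"
  proof (rule ccontr)
    assume "\<not> D > 0"
    then have eq: "\<sigma> w = \<sigma> p" if "w \<in> W" for w using p(2)[OF that] q(2)[OF that] by (simp add: D_def)
    have "e' - \<sigma> p *\<^sub>R e \<noteq> 0"
    proof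
      assume "e' - \<sigma> p *\<^sub>R e = 0"
      then have "(e' - \<sigma> p *\<^sub>R e) \<bullet> e' = 0" by simp
      then have "e' \<bullet> e' = 0" by (simp add: inner_diff_left ee)
      then show False using e0 ee by simp
    qed
    then show False
      by (rule hyper) (use s eq in \<open>simp add: inner_diff_left\<close>)
  qed
  define hp where "hp = e \<bullet> p"
  define hq where "hq = e \<bullet> q"
  have h: "hp > 0" "hq > 0" using hW p q by (auto simp: hp_def hq_def)
  define T where "T y = (y $ i) *\<^sub>R p + (y $ j) *\<^sub>R q" for y :: "real^'n"
  \<comment> \<open>The inverse of \<open>T\<close> by Cramer's rule: in the coordinates
    \<open>e \<bullet> x\<close> and \<open>e' \<bullet> x\<close> the vectors \<open>p\<close> and
    \<open>q\<close> read \<open>hp (1, \<sigma> p)\<close> and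
    \<open>hq (1, \<sigma> q)\<close>.\<close>
  define N where "N x = (\<chi> m. if m = i then (e' \<bullet> x - \<sigma> q * (e \<bullet> x)) / (D * hp) else (\<sigma> p * (e \<bullet> x) - e' \<bullet> x) / (D * hq))" for x :: "real^'n"
  have Ni: "N x $ i = (e' \<bullet> x - \<sigma> q * (e \<bullet> x)) / (D * hp)" "N x $ j = (\<sigma> p * (e \<bullet> x) - e' \<bullet> x) / (D * hq)" for x
    using ij by (auto simp: N_def)
  have linT: "linear T" by (rule linearI) (auto simp: T_def algebra_simps)
  have linN: "linear N" by (rule linearI) (auto simp: N_def vec_eq_iff inner_add_right algebra_simps add_divide_distrib diff_divide_distrib)
  have vecI: "x = y" if "x $ i = y $ i" "x $ j = y $ j" for x y :: "real^'n"
    unfolding vec_eq_iff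
  proof
    fix m
    have "m = i \<or> m = j" using ij(1) by auto
    then show "x $ m = y $ m" using that by auto
  qed
  have NT: "N (T y) = y" for y
  proof (rule vecI)
    have 1: "e \<bullet> T y = y $ i * hp + y $ j * hq" by (simp add: T_def inner_add_right hp_def hq_def)
    have 2: "e' \<bullet> T y = y $ i * (\<sigma> p * hp) + y $ j * (\<sigma> q * hq)"
      by (simp add: T_def inner_add_right hp_def hq_def s p q)
    have "e' \<bullet> T y - \<sigma> q * (e \<bullet> T y) = y $ i * (D * hp)" unfolding 1 2 D_def by (simp add: algebra_simps)
    then show "N (T y) $ i = y $ i" using D h by (simp add: Ni)
    have "\<sigma> p * (e \<bullet> T y) - e' \<bullet> T y = y $ j * (D * hq)" unfolding 1 2 D_def by (simp add: algebra_simps)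
    then show "N (T y) $ j = y $ j" using D h by (simp add: Ni)
  qed
  then have "N \<circ> T = id" by auto
  then have "T \<circ> N = id" using linear_inverse_left[OF linT linN] by blast
  then have TN: "T (N x) = x" for x by (metis comp_apply id_apply)
  have Nw: "N w $ m \<ge> 0" if "w \<in> W" for w m
  proof -
    have "m = i \<or> m = j" using ij(1) by auto
    moreover have "(e' \<bullet> w - \<sigma> q * (e \<bullet> w)) \<ge> 0" "(\<sigma> p * (e \<bullet> w) - e' \<bullet> w) \<ge> 0"
      using s[OF that] hW[OF that] p(2)[OF that] q(2)[OF that] by (auto simp: mult_right_mono)
    ultimately show ?thesis using D h by (auto simp: Ni)
  qed
  have NP: "N (x - xc) $ m \<ge> 0" if "x \<in> P" for x m
  proof -
    have "P \<subseteq> {x. N (x - xc) $ m \<ge> 0}"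
      unfolding V(2)
    proof (rule hull_minimal)
      show "V \<subseteq> {x. N (x - xc) $ m \<ge> 0}"
      proof
        fix v assume v: "v \<in> V"
        show "v \<in> {x. N (x - xc) $ m \<ge> 0}"
        proof (cases "v = xc")
          case True then show ?thesis by (simp add: linear_0[OF linN])
        next
          case False
          then have "v - xc \<in> W" using v by (auto simp: W_def)
          then show ?thesis using Nw by simp
        qed
      qed
      show "convex {x. N (x - xc) $ m \<ge> 0}"
        unfolding convex_alt
      proof clarify
        fix x y and t :: real assume xy: "0 \<le> N (x - xc) $ m" "0 \<le> N (y - xc) $ m" and t: "0 \<le> t" "t \<le> 1"
        have "((1 - t) *\<^sub>R x + t *\<^sub>R y) - xc = (1 - t) *\<^sub>R (x - xc) + t *\<^sub>R (y - xc)" by (simp add: algebra_simps)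
        then have "N (((1 - t) *\<^sub>R x + t *\<^sub>R y) - xc) $ m = (1 - t) * N (x - xc) $ m + t * N (y - xc) $ m"
          by (simp add: linear_add[OF linN] linear_scale[OF linN])
        then show "0 \<le> N (((1 - t) *\<^sub>R x + t *\<^sub>R y) - xc) $ m" using xy t by simp
      qed
    qed
    then show ?thesis using that by blast
  qed
  \<comment> \<open>With both coordinates below \<open>1/2\<close> their sum is below
    \<open>1\<close>, so the point lies in the triangle with vertices \<open>xc\<close>,
    \<open>xc + p\<close> and \<open>xc + q\<close>.\<close>
  have "simplicial_corner \<Omega> xc T N (1/2) (- e) e'"
  proof (rule simplicial_corner.intro)
    show "norm (- e) = norm e'" by (simp add: norm_eq_sqrt_inner ee)
    show "- e \<bullet> e' = 0" by (simp add: ee)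
    show "- e \<bullet> T (axis m 1) < 0" for m
    proof -
      have "m = i \<or> m = j" using ij(1) by auto
      then show ?thesis using ij(2) h by (auto simp: T_def axis_def hp_def hq_def)
    qed
    \<comment> \<open>\<open>NP\<close> gives a weak inequality on \<open>P\<close>. Applied to a
      point of \<open>P\<close> shifted slightly against the edge \<open>m\<close>, it becomes
      strict at the interior point \<open>x\<close>.\<close>
    show "N (x - xc) $ m > 0" if x: "x \<in> \<Omega>" for x m
    proof -
      have "open \<Omega>" by (simp add: \<Omega>)
      then obtain r where r: "r > 0" "cball x r \<subseteq> \<Omega>" using x open_contains_cball by blast
      have T0: "T (axis m 1) \<noteq> 0" using NT[of "axis m 1"] linear_0[OF linN] by (auto simp: axis_eq_0_iff)
      define t where "t = r / norm (T (axis m 1))"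
      have t: "t > 0" using r T0 by (simp add: t_def)
      have "x - t *\<^sub>R T (axis m 1) \<in> cball x r" using r T0 by (simp add: dist_norm t_def)
      then have "x - t *\<^sub>R T (axis m 1) \<in> P" using r(2) \<Omega> interior_subset by blast
      from NP[OF this, of m] have "N ((x - xc) - t *\<^sub>R T (axis m 1)) $ m \<ge> 0" by (simp add: algebra_simps)
      then have "N (x - xc) $ m - t \<ge> 0"
        by (simp add: linear_diff[OF linN] linear_scale[OF linN] NT axis_def)
      then show ?thesis using t by simp
    qed
    show "x \<in> \<Omega>" if x: "\<And>m. 0 < N (x - xc) $ m \<and> N (x - xc) $ m < 1/2" for x
    proof -
      define Tri where "Tri = {x. 0 < N (x - xc) $ i} \<inter> {x. 0 < N (x - xc) $ j} \<inter> {x. N (x - xc) $ i + N (x - xc) $ j < 1}"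
      have cN: "continuous_on UNIV (\<lambda>x. N (x - xc))"
        by (intro linear_continuous_on_compose[OF _ linN] continuous_intros)
      have "open Tri" unfolding Tri_def
        by (intro open_Int open_Collect_less continuous_intros cN)
      moreover have "Tri \<subseteq> P"
      proof
        fix y assume y: "y \<in> Tri"
        define A where "A = N (y - xc) $ i"
        define B where "B = N (y - xc) $ j"
        have AB: "A > 0" "B > 0" "A + B < 1" using y by (auto simp: Tri_def A_def B_def)
        have "y = xc + A *\<^sub>R p + B *\<^sub>R q" using TN[of "y - xc"] by (simp add: T_def A_def B_def algebra_simps)
        also have "\<dots> = (1 - A - B) *\<^sub>R xc + A *\<^sub>R (xc + p) + B *\<^sub>R (xc + q)" by (simp add: algebra_simps)
        also have "\<dots> \<in> convex hull {xc, xc + p, xc + q}"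
          unfolding convex_hull_3 using AB by force
        also have "\<dots> \<subseteq> P" unfolding V(2)
          by (rule hull_mono) (use p q xV in \<open>auto simp: W_def\<close>)
        finally show "y \<in> P" .
      qed
      ultimately have "Tri \<subseteq> \<Omega>" unfolding \<Omega> by (simp add: interior_maximal)
      moreover have "x \<in> Tri" using x[of i] x[of j] by (auto simp: Tri_def)
      ultimately show ?thesis by blast
    qed
  qed (use linT linN NT TN in auto)
  then show ?thesis by blast
qed

section \<open>Exponentially weighted integrals\<close>

lemma power_le_fact_exp:
  fixes t :: real
  assumes "t \<ge> 0"
  shows "t ^ n \<le> fact n * exp t"
proof -
  have "(\<Sum>k\<in>{n}. t ^ k /\<^sub>R fact k) \<le> exp t"
    unfolding exp_def using summable_exp_generic[of t] assms by (intro sum_le_suminf) auto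
  then show ?thesis by (simp add: field_simps)
qed

text \<open>Half of the exponential decay absorbs the power, and the other half leaves a geometric
  series.\<close>

lemma summable_exp_power:
  fixes \<delta> :: real
  assumes \<delta>: "\<delta> > 0"
  shows "summable (\<lambda>j. exp (- \<delta> * real j) * real (Suc j) ^ n)"
proof (rule summable_comparison_test')
  let ?C = "fact n * (2 / \<delta>) ^ n * exp (\<delta> / 2)"
  show "summable (\<lambda>j. ?C * exp (- \<delta> / 2) ^ j)"
    using \<delta> by (intro summable_mult summable_geometric) auto
  show "norm (exp (- \<delta> * real j) * real (Suc j) ^ n) \<le> ?C * exp (- \<delta> / 2) ^ j" for j
  proof -
    have "real (Suc j) ^ n = (2 / \<delta>) ^ n * (\<delta> / 2 * real (Suc j)) ^ n"
    proof -
      have "real (Suc j) = 2 / \<delta> * (\<delta> / 2 * real (Suc j))" using \<delta> by simp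
      then show ?thesis by (metis power_mult_distrib)
    qed
    also have "\<dots> \<le> (2 / \<delta>) ^ n * (fact n * exp (\<delta> / 2 * real (Suc j)))"
      using \<delta> by (intro mult_left_mono power_le_fact_exp) auto
    finally have "exp (- \<delta> * real j) * real (Suc j) ^ n \<le> exp (- \<delta> * real j) * ((2 / \<delta>) ^ n * (fact n * exp (\<delta> / 2 * real (Suc j))))"
      by (intro mult_left_mono) auto
    also have "\<dots> = fact n * (2 / \<delta>) ^ n * (exp (- \<delta> * real j) * exp (\<delta> / 2 * real (Suc j)))"
      by (simp only: mult_ac)
    also have "exp (- \<delta> * real j) * exp (\<delta> / 2 * real (Suc j)) = exp (\<delta> / 2) * exp (- \<delta> / 2) ^ j"
      unfolding exp_of_nat_mult[symmetric] exp_add[symmetric] by (simp add: field_simps)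
    finally show ?thesis by (simp add: mult.assoc)
  qed
qed

text \<open>Comparison with a sum of indicators of balls of radius \<open>j + 1\<close> weighted by
  \<open>exp (- \<delta> j)\<close>: the measures of the balls grow only polynomially.\<close>

lemma integrable_exp_neg_norm:
  assumes \<delta>: "\<delta> > 0"
  shows "integrable lebesgue (\<lambda>y::'a::euclidean_space. exp (- \<delta> * norm y))"
proof (rule integrableI_bounded)
  show "(\<lambda>y::'a. exp (- \<delta> * norm y)) \<in> borel_measurable lebesgue"
    by (intro continuous_borel_measurable_lebesgue continuous_intros)
  let ?m = "measure lebesgue (ball (0::'a) 1)"
  let ?f = "\<lambda>j y. ennreal (exp (- \<delta> * real j)) * indicator (ball (0::'a) (real (Suc j))) y"
  have le: "ennreal (norm (exp (- \<delta> * norm y))) \<le> (\<Sum>j. ?f j y)" for y :: 'a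
  proof -
    define j where "j = nat \<lfloor>norm y\<rfloor>"
    have j: "real j \<le> norm y" "norm y < real (Suc j)"
    proof -
      have "real j = of_int \<lfloor>norm y\<rfloor>" by (simp add: j_def)
      then show "real j \<le> norm y" "norm y < real (Suc j)"
        using real_of_int_floor_add_one_gt[of "norm y"] of_int_floor_le[of "norm y"] unfolding of_nat_Suc by linarith+
    qed
    have "ennreal (norm (exp (- \<delta> * norm y))) \<le> ?f j y"
      using j \<delta> by (auto simp: indicator_def intro!: ennreal_leI)
    also have "\<dots> = sum (\<lambda>j. ?f j y) {j}"
      by (simp only: sum.insert sum.empty finite.emptyI empty_iff not_False_eq_True add_0_right)
    also have "\<dots> \<le> (\<Sum>j. ?f j y)" by (rule sum_le_suminf) auto
    finally show ?thesis .
  qed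
  have mb: "emeasure lebesgue (ball (0::'a) (real (Suc j))) = ennreal (real (Suc j) ^ DIM('a) * ?m)" for j
  proof -
    have "ball (0::'a) (real (Suc j)) \<in> lmeasurable" by simp
    then have "emeasure lebesgue (ball (0::'a) (real (Suc j))) = ennreal (measure lebesgue (ball (0::'a) (real (Suc j))))"
      by (rule emeasure_eq_measure2)
    moreover have "measure lebesgue (ball (0::'a) (real (Suc j))) = real (Suc j) ^ DIM('a) * ?m"
      using measure_translate_scale[of "ball (0::'a) 1" "real (Suc j)" 0] translate_scale_unit_ball[of "real (Suc j)" "0::'a"]
      by simp
    ultimately show ?thesis by simp
  qed
  have "(\<integral>\<^sup>+y. ennreal (norm (exp (- \<delta> * norm (y::'a)))) \<partial>lebesgue) \<le> (\<integral>\<^sup>+y. (\<Sum>j. ?f j y) \<partial>lebesgue)"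
    by (rule nn_integral_mono) (rule le)
  also have "\<dots> = (\<Sum>j. \<integral>\<^sup>+y. ?f j y \<partial>lebesgue)"
    by (intro nn_integral_suminf borel_measurable_times_ennreal borel_measurable_const borel_measurable_indicator) auto
  also have "\<dots> = (\<Sum>j. ennreal (exp (- \<delta> * real j) * real (Suc j) ^ DIM('a) * ?m))"
    by (intro suminf_cong) (simp add: nn_integral_cmult_indicator mb ennreal_mult' mult.assoc del: of_nat_Suc)
  also have "\<dots> = ennreal (\<Sum>j. exp (- \<delta> * real j) * real (Suc j) ^ DIM('a) * ?m)"
    by (intro suminf_ennreal2 summable_mult2 summable_exp_power \<delta>) auto
  also have "\<dots> < \<infinity>" by simp
  finally show "(\<integral>\<^sup>+y. ennreal (norm (exp (- \<delta> * norm (y::'a)))) \<partial>lebesgue) < \<infinity>" .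
qed

lemma set_integrable_mult_exp_neg:
  fixes f :: "'a::euclidean_space \<Rightarrow> real"
  assumes f: "set_integrable lebesgue U f" and c: "c \<ge> 0"
  shows "set_integrable lebesgue U (\<lambda>x. f x * exp (- c * norm (x - z)))"
  unfolding set_integrable_def
proof (rule Bochner_Integration.integrable_bound[OF f[unfolded set_integrable_def]])
  have "(\<lambda>x. exp (- c * norm (x - z))) \<in> borel_measurable lebesgue"
    by (intro continuous_borel_measurable_lebesgue continuous_intros)
  then have "(\<lambda>x. (indicat_real U x *\<^sub>R f x) * exp (- c * norm (x - z))) \<in> borel_measurable lebesgue"
    using f unfolding set_integrable_def by (intro borel_measurable_times) auto
  then show "(\<lambda>x. indicat_real U x *\<^sub>R (f x * exp (- c * norm (x - z)))) \<in> borel_measurable lebesgue"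
    by (simp add: mult.assoc)
  show "AE x in lebesgue. norm (indicat_real U x *\<^sub>R (f x * exp (- c * norm (x - z)))) \<le> norm (indicat_real U x *\<^sub>R f x)"
    using c by (auto simp: indicator_def abs_mult intro!: mult_left_le)
qed

text \<open>Split \<open>\<Omega>\<close> into shells of width \<open>1 / m\<close> around \<open>xc\<close>.\<close>

lemma exp_weighted_integral_tendsto_0:
  fixes f :: "real^'n::finite \<Rightarrow> real"
  assumes \<Omega>: "bounded \<Omega>" "\<Omega> \<in> sets lebesgue" and f: "set_integrable lebesgue \<Omega> f" "\<And>x. 0 \<le> f x"
    and lim: "((\<lambda>r. (LINT x:(ball xc r \<inter> \<Omega>)|lebesgue. f x) / r ^ CARD('n)) \<longlongrightarrow> 0) (at_right 0)" and \<delta>: "\<delta> > 0"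
  shows "(\<lambda>m. real m ^ CARD('n) * (LINT x:\<Omega>|lebesgue. f x * exp (- \<delta> * (real m * norm (x - xc))))) \<longlonglongrightarrow> 0"
proof -
  let ?n = "CARD('n)"
  define \<Phi> where "\<Phi> r = (LINT x:(ball xc r \<inter> \<Omega>)|lebesgue. f x)" for r
  have bs: "ball xc r \<inter> \<Omega> \<in> sets lebesgue" for r using \<Omega>(2) by auto
  have bi: "set_integrable lebesgue (ball xc r \<inter> \<Omega>) f" for r
    by (rule set_integrable_subset[OF f(1) bs]) auto
  have \<Phi>0: "\<Phi> r \<ge> 0" for r unfolding \<Phi>_def by (rule set_integral_pointwise_nonneg) (rule f(2))
  have \<Phi>1: "\<Phi> r \<le> (LINT x:\<Omega>|lebesgue. f x)" for r
    unfolding \<Phi>_def by (intro set_integral_subset_mono f bs) auto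
  have n0: "?n > 0" by simp
  \<comment> \<open>For small radii the bound follows from \<open>lim\<close>, for the others from
    the finite total mass of \<open>f\<close>. All radii are covered because, for fixed
    \<open>m\<close>, shells of large index reach arbitrarily far.\<close>
  obtain M where M: "\<And>r. r > 0 \<Longrightarrow> \<Phi> r \<le> M * r ^ ?n" "M \<ge> 0"
  proof -
    have "\<forall>\<^sub>F r in at_right 0. \<Phi> r / r ^ ?n < 1"
      using order_tendstoD(2)[OF lim, of 1] by (simp add: \<Phi>_def)
    then obtain r1 where r1: "r1 > 0" "\<And>r. 0 < r \<Longrightarrow> r < r1 \<Longrightarrow> \<Phi> r / r ^ ?n < 1"
      by (auto simp: eventually_at_right_field)
    define M where "M = max 1 ((LINT x:\<Omega>|lebesgue. f x) / r1 ^ ?n)"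
    have "\<Phi> r \<le> M * r ^ ?n" if r: "r > 0" for r
    proof (cases "r < r1")
      case True
      then have "\<Phi> r \<le> 1 * r ^ ?n" using r1(2)[OF r True] r by (simp add: divide_simps)
      also have "\<dots> \<le> M * r ^ ?n" using r by (intro mult_right_mono) (auto simp: M_def)
      finally show ?thesis .
    next
      case False
      have I0: "(LINT x:\<Omega>|lebesgue. f x) \<ge> 0" using \<Phi>0[of 1] \<Phi>1[of 1] by simp
      have "\<Phi> r \<le> (LINT x:\<Omega>|lebesgue. f x) / r1 ^ ?n * r1 ^ ?n" using \<Phi>1 r1(1) by simp
      also have "\<dots> \<le> M * r ^ ?n" using r1(1) False I0 by (intro mult_mono power_mono) (auto simp: M_def)
      finally show ?thesis .
    qed
    moreover have "M \<ge> 0" by (simp add: M_def)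
    ultimately show thesis using that by blast
  qed
  \<comment> \<open>\<open>a j m\<close> bounds the rescaled contribution of the shell where
    \<open>real m * norm (x - xc)\<close> has integer part \<open>j\<close>: the weight is largest
    at the inner radius, and the shell lies in the ball of radius
    \<open>(j + 1) / m\<close>.\<close>
  define a where "a j m = exp (- \<delta> * real j) * (real m ^ ?n * \<Phi> (real (Suc j) / real m))" for j m :: nat
  have a0: "a j m \<ge> 0" for j m unfolding a_def using \<Phi>0 by simp
  have ab: "a j m \<le> exp (- \<delta> * real j) * real (Suc j) ^ ?n * M" for j m
  proof (cases "m = 0")
    case True
    then show ?thesis using n0 M(2) by (simp add: a_def power_0_left)
  next
    case False
    then have "real m ^ ?n * \<Phi> (real (Suc j) / real m) \<le> real m ^ ?n * (M * (real (Suc j) / real m) ^ ?n)"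
      by (intro mult_left_mono M(1)) auto
    also have "\<dots> = real (Suc j) ^ ?n * M" using False by (simp add: power_divide)
    finally show ?thesis unfolding a_def mult.assoc by (intro mult_left_mono) auto
  qed
  have al: "(\<lambda>m. a j m) \<longlonglongrightarrow> 0" for j
  proof -
    have "(\<lambda>m. real (Suc j) * inverse (real m)) \<longlonglongrightarrow> real (Suc j) * 0"
      by (intro tendsto_mult tendsto_const lim_inverse_n)
    then have t: "filterlim (\<lambda>m. real (Suc j) / real m) (at_right 0) sequentially"
      unfolding filterlim_at by (auto simp: divide_inverse eventually_sequentially intro!: exI[of _ 1])
    have "(\<lambda>m. exp (- \<delta> * real j) * (real (Suc j) ^ ?n * (\<Phi> (real (Suc j) / real m) / (real (Suc j) / real m) ^ ?n)))
        \<longlonglongrightarrow> exp (- \<delta> * real j) * (real (Suc j) ^ ?n * 0)"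
      by (intro tendsto_mult tendsto_const filterlim_compose[OF lim[folded \<Phi>_def] t])
    moreover have "\<forall>\<^sub>F m in sequentially. exp (- \<delta> * real j) * (real (Suc j) ^ ?n * (\<Phi> (real (Suc j) / real m) / (real (Suc j) / real m) ^ ?n)) = a j m"
      using eventually_gt_at_top[of 0] by eventually_elim (simp add: a_def power_divide)
    ultimately show ?thesis by (simp add: tendsto_cong)
  qed
  have sM: "summable (\<lambda>j. exp (- \<delta> * real j) * real (Suc j) ^ ?n * M)"
    by (intro summable_mult2 summable_exp_power \<delta>)
  have sa: "summable (\<lambda>j. a j m)" for m
    by (rule summable_comparison_test'[OF sM]) (use a0 ab in auto)
  \<comment> \<open>Dominated convergence for series: for fixed \<open>j\<close> the balls shrink to
    \<open>xc\<close>, and the bound \<open>ab\<close> is summable in \<open>j\<close> and free of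
    \<open>m\<close>.\<close>
  have "((\<lambda>m. suminf (\<lambda>j. a j m)) \<longlongrightarrow> suminf (\<lambda>j. 0)) sequentially"
    using tannerys_theorem[OF al _ sM] a0 ab by (simp add: always_eventually)
  then have S: "(\<lambda>m. suminf (\<lambda>j. a j m)) \<longlonglongrightarrow> 0" by simp
  show ?thesis
  proof (rule tendsto_sandwich[OF _ _ tendsto_const S])
    show "\<forall>\<^sub>F m in sequentially. 0 \<le> real m ^ ?n * (LINT x:\<Omega>|lebesgue. f x * exp (- \<delta> * (real m * norm (x - xc))))"
      using f(2) by (intro always_eventually allI mult_nonneg_nonneg set_integral_pointwise_nonneg) auto
    show "\<forall>\<^sub>F m in sequentially. real m ^ ?n * (LINT x:\<Omega>|lebesgue. f x * exp (- \<delta> * (real m * norm (x - xc)))) \<le> suminf (\<lambda>j. a j m)"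
      using eventually_gt_at_top[of 0]
    proof eventually_elim
      case (elim m)
      obtain B where B: "\<And>x. x \<in> \<Omega> \<Longrightarrow> norm (x - xc) \<le> B"
      proof -
        obtain B0 where "\<And>x. x \<in> \<Omega> \<Longrightarrow> norm x \<le> B0" using \<Omega>(1) by (auto simp: bounded_iff)
        then have "norm (x - xc) \<le> B0 + norm xc" if "x \<in> \<Omega>" for x
          using norm_triangle_ineq4[of x xc] that by fastforce
        then show thesis using that by blast
      qed
      \<comment> \<open>For fixed \<open>m\<close> finitely many shells exhaust the bounded set
        \<open>\<Omega>\<close>, so the integral is estimated by a finite sum.\<close>
      obtain J where J: "real m * B < real J" using reals_Archimedean2 by blast
      let ?g = "\<lambda>j x. exp (- \<delta> * real j) * (indicator (ball xc (real (Suc j) / real m) \<inter> \<Omega>) x *\<^sub>R f x)"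
      have gi: "integrable lebesgue (?g j)" for j
        using bi[of "real (Suc j) / real m"] unfolding set_integrable_def by (rule integrable_mult_right)
      have fe: "integrable lebesgue (\<lambda>x. indicator \<Omega> x *\<^sub>R (f x * exp (- \<delta> * (real m * norm (x - xc)))))"
        using set_integrable_mult_exp_neg[OF f(1), of "\<delta> * real m" xc] \<delta>
        by (simp add: set_integrable_def mult.assoc)
      have "(LINT x:\<Omega>|lebesgue. f x * exp (- \<delta> * (real m * norm (x - xc)))) \<le> (\<integral>x. (\<Sum>j<J. ?g j x) \<partial>lebesgue)"
        unfolding set_lebesgue_integral_def
      proof (rule integral_mono[OF fe])
        show "integrable lebesgue (\<lambda>x. \<Sum>j<J. ?g j x)" using gi by auto
        fix x
        show "indicator \<Omega> x *\<^sub>R (f x * exp (- \<delta> * (real m * norm (x - xc)))) \<le> (\<Sum>j<J. ?g j x)"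
        proof (cases "x \<in> \<Omega>")
          case True
          define j where "j = nat \<lfloor>real m * norm (x - xc)\<rfloor>"
          have j: "real j \<le> real m * norm (x - xc)" "real m * norm (x - xc) < real (Suc j)"
          proof -
            have "real j = of_int \<lfloor>real m * norm (x - xc)\<rfloor>" by (simp add: j_def)
            then show "real j \<le> real m * norm (x - xc)" "real m * norm (x - xc) < real (Suc j)"
              using real_of_int_floor_add_one_gt[of "real m * norm (x - xc)"] of_int_floor_le[of "real m * norm (x - xc)"]
              unfolding of_nat_Suc by linarith+
          qed
          have "real m * norm (x - xc) \<le> real m * B" using B[OF True] by (intro mult_left_mono) auto
          then have "j < J" using j(1) J by linarith
          have "norm (x - xc) < real (Suc j) / real m" using j(2) elim by (simp add: pos_less_divide_eq mult.commute del: of_nat_Suc)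
          then have xb: "x \<in> ball xc (real (Suc j) / real m) \<inter> \<Omega>" using True by (simp add: dist_norm norm_minus_commute)
          have "f x * exp (- \<delta> * (real m * norm (x - xc))) \<le> f x * exp (- \<delta> * real j)"
            using f(2)[of x] \<delta> j(1) by (intro mult_left_mono) auto
          then have "indicator \<Omega> x *\<^sub>R (f x * exp (- \<delta> * (real m * norm (x - xc)))) \<le> ?g j x"
            using True xb by (simp add: mult.commute)
          also have "\<dots> \<le> (\<Sum>j<J. ?g j x)"
            using \<open>j < J\<close> f(2) by (intro member_le_sum) auto
          finally show ?thesis .
        qed (use f(2) in \<open>auto intro!: sum_nonneg\<close>)
      qed
      also have "\<dots> = (\<Sum>j<J. \<integral>x. ?g j x \<partial>lebesgue)"
        by (rule Bochner_Integration.integral_sum) (rule gi)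
      also have "\<dots> = (\<Sum>j<J. exp (- \<delta> * real j) * \<Phi> (real (Suc j) / real m))"
        by (simp add: \<Phi>_def set_lebesgue_integral_def)
      finally have "real m ^ ?n * (LINT x:\<Omega>|lebesgue. f x * exp (- \<delta> * (real m * norm (x - xc))))
          \<le> real m ^ ?n * (\<Sum>j<J. exp (- \<delta> * real j) * \<Phi> (real (Suc j) / real m))"
        by (intro mult_left_mono) auto
      also have "\<dots> = (\<Sum>j<J. a j m)" by (simp add: a_def sum_distrib_left mult_ac)
      also have "\<dots> \<le> suminf (\<lambda>j. a j m)" by (rule sum_le_suminf[OF sa]) (auto simp: a0)
      finally show ?case .
    qed
  qed
qed

section \<open>The harmonic exponential on the tangent cone\<close>

context simplicial_corner
begin

definition cone where "cone = {y. \<forall>i. 0 < N y $ i}"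

definition cexp where "cexp y = exp (Complex (a \<bullet> y) (b \<bullet> y))"

lemma continuous_N: "continuous_on S (\<lambda>x. N x $ i)"
  using linear_continuous_on[of N S] linear_N linear_conv_bounded_linear
  by (auto intro!: continuous_intros)

lemma cone_sum:
  shows "y = (\<Sum>i\<in>UNIV. (N y $ i) *\<^sub>R T (axis i 1))"
proof -
  have "N y = (\<Sum>i\<in>UNIV. (N y $ i) *\<^sub>R axis i 1)"
    using basis_expansion[of "N y"] by (simp add: scalar_mult_eq_scaleR)
  then have "T (N y) = T (\<Sum>i\<in>UNIV. (N y $ i) *\<^sub>R axis i 1)" by simp
  also have "\<dots> = (\<Sum>i\<in>UNIV. (N y $ i) *\<^sub>R T (axis i 1))"
    by (simp add: linear_sum[OF linear_T] linear_scale[OF linear_T])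
  finally show ?thesis by (simp add: TN)
qed

text \<open>A point with nonnegative coordinates is a nonnegative combination of the edge vectors.
  Each of them has inner product at most \<open>- d\<close> with \<open>a\<close> and length at most
  \<open>M\<close>, so \<open>\<delta> = d / M\<close> works.\<close>

lemma cone_decay: "\<exists>\<delta>>0. \<forall>y. (\<forall>i. 0 \<le> N y $ i) \<longrightarrow> a \<bullet> y \<le> - \<delta> * norm y"
proof -
  define d where "d = Min (range (\<lambda>i. - (a \<bullet> T (axis i 1))))"
  have d: "d > 0" "\<And>i. d \<le> - (a \<bullet> T (axis i 1))" unfolding d_def using a_neg by (auto simp: Min_gr_iff)
  define M where "M = 1 + (\<Sum>i\<in>UNIV. norm (T (axis i 1)))"
  have Mi: "norm (T (axis i 1)) \<le> M" for i
    using member_le_sum[of i UNIV "\<lambda>i. norm (T (axis i 1))"] by (simp add: M_def)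
  have M: "M > 0" unfolding M_def by (intro add_pos_nonneg sum_nonneg) auto
  have "a \<bullet> y \<le> - (d / M) * norm y" if y: "\<forall>i. 0 \<le> N y $ i" for y
  proof -
    have "norm y \<le> (\<Sum>i\<in>UNIV. norm ((N y $ i) *\<^sub>R T (axis i 1)))"
      by (subst cone_sum) (rule norm_sum)
    also have "\<dots> \<le> (\<Sum>i\<in>UNIV. N y $ i * M)"
      using y Mi by (intro sum_mono) (auto intro: mult_left_mono)
    finally have 1: "norm y \<le> M * (\<Sum>i\<in>UNIV. N y $ i)" by (simp add: sum_distrib_left mult.commute)
    have "a \<bullet> y = (\<Sum>i\<in>UNIV. N y $ i * (a \<bullet> T (axis i 1)))"
      by (subst cone_sum) (simp add: inner_sum_right)
    also have "\<dots> \<le> (\<Sum>i\<in>UNIV. N y $ i * (- d))"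
    proof (intro sum_mono mult_left_mono)
      show "a \<bullet> T (axis i 1) \<le> - d" for i using d(2)[of i] by linarith
    qed (use y in auto)
    also have "\<dots> = - (d / M) * (M * (\<Sum>i\<in>UNIV. N y $ i))"
      using M by (simp add: sum_distrib_left sum_negf mult.commute)
    also have "\<dots> \<le> - (d / M) * norm y" using 1 d M by (intro mult_left_mono_neg) auto
    finally show ?thesis .
  qed
  then show ?thesis using d M by (intro exI[of _ "d / M"]) auto
qed

lemma norm_cexp: "cmod (cexp y) = exp (a \<bullet> y)" by (simp add: cexp_def)

lemma cexp_add: "cexp (x + y) = cexp x * cexp y"
  by (simp add: cexp_def inner_add_right exp_add[symmetric] complex_add)

lemma smooth_cexp: "smooth cexp" unfolding cexp_def by (rule smooth_exp_ridge)

lemma cexp_measurable: "cexp \<in> borel_measurable lebesgue" by (rule smooth_measurable[OF smooth_cexp])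

lemma open_cone: "open cone"
proof -
  have "cone = (\<Inter>i\<in>UNIV. {y. 0 < N y $ i})" by (auto simp: cone_def)
  then show ?thesis by (auto intro!: open_INT open_Collect_less continuous_intros continuous_N)
qed

lemma cexp_integrable_cone: "set_integrable lebesgue cone cexp"
proof -
  obtain \<delta> where \<delta>: "\<delta> > 0" "\<And>y. (\<forall>i. 0 \<le> N y $ i) \<Longrightarrow> a \<bullet> y \<le> - \<delta> * norm y" using cone_decay by blast
  show ?thesis unfolding set_integrable_def
  proof (rule Bochner_Integration.integrable_bound[OF integrable_exp_neg_norm[OF \<delta>(1)]])
    have "cone \<in> sets lebesgue" using open_cone by auto
    then show "(\<lambda>x. indicat_real cone x *\<^sub>R cexp x) \<in> borel_measurable lebesgue"
      using cexp_measurable by (intro borel_measurable_scaleR borel_measurable_indicator)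
    show "AE y in lebesgue. norm (indicat_real cone y *\<^sub>R cexp y) \<le> norm (exp (- \<delta> * norm y))"
      using \<delta>(2) by (auto simp: indicator_def norm_cexp cone_def less_imp_le)
  qed
qed

text \<open>Cutting off the cone in direction \<open>T (axis j 1)\<close> multiplies the integral by
  \<open>1 - cexp (t *\<^sub>R T (axis j 1))\<close>; a vanishing integral over the cone would thus force the integral over every small
  parallelepiped to vanish, where \<open>cexp\<close> is close to \<open>1\<close>.\<close>

lemma integral_cexp_cone_neq_0: "(LINT y:cone|lebesgue. cexp y) \<noteq> 0"
proof
  assume 0: "(LINT y:cone|lebesgue. cexp y) = 0"
  \<comment> \<open>\<open>S\<close> is the set of coordinates already cut off at \<open>t\<close>;
    the induction on \<open>S\<close> leads from the cone, \<open>S = {}\<close>, to the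
    parallelepiped, \<open>S = UNIV\<close>.\<close>
  define K where "K S t = {y. (\<forall>i. 0 < N y $ i) \<and> (\<forall>i\<in>S. N y $ i \<le> t)}" for S t
  have Kc: "K S t \<subseteq> cone" for S t by (auto simp: K_def cone_def)
  have Ks: "K S t \<in> sets lebesgue" for S t
  proof -
    have "closed {y. \<forall>i\<in>S. N y $ i \<le> t}"
    proof -
      have "{y. \<forall>i\<in>S. N y $ i \<le> t} = (\<Inter>i\<in>S. {y. N y $ i \<le> t})" by auto
      then show ?thesis by (auto intro!: closed_INT closed_Collect_le continuous_intros continuous_N)
    qed
    moreover have "K S t = cone \<inter> {y. \<forall>i\<in>S. N y $ i \<le> t}" by (auto simp: K_def cone_def)
    ultimately show ?thesis using open_cone by (auto intro!: sets.Int)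
  qed
  have Ki: "set_integrable lebesgue (K S t) cexp" for S t
    by (rule set_integrable_subset[OF cexp_integrable_cone Ks Kc])
  have K0: "(LINT y:K S t|lebesgue. cexp y) = 0" if t: "t > 0" for S t
    using finite[of S]
  proof (induction S rule: finite_induct)
    case empty
    have "K {} t = cone" by (auto simp: K_def cone_def)
    then show ?case using 0 by simp
  next
    case (insert j S)
    define p where "p = t *\<^sub>R T (axis j 1)"
    have Np: "N p = t *\<^sub>R axis j 1" by (simp add: p_def linear_scale[OF linear_N] NT)
    let ?K' = "(\<lambda>y. p + 1 *\<^sub>R y) ` K S t"
    \<comment> \<open>As \<open>j\<close> is not in \<open>S\<close>, shifting by \<open>t\<close>
      along the edge \<open>j\<close> moves \<open>K S t\<close> exactly onto the part removed by
      the new cut. The integral over that part is \<open>cexp p\<close> times the one over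
      \<open>K S t\<close>, hence \<open>0\<close>.\<close>
    have K'e: "?K' = K S t - K (insert j S) t"
    proof (intro equalityI subsetI)
      fix x assume "x \<in> ?K'"
      then obtain y where y: "y \<in> K S t" "x = p + y" by auto
      have Nx: "N x $ i = N y $ i + (if i = j then t else 0)" for i
        using y(2) by (simp add: linear_add[OF linear_N] Np axis_def)
      have "x \<in> K S t"
        using y(1) t insert.hyps(2) by (auto simp: K_def Nx intro!: add_pos_nonneg)
      moreover have "0 < N y $ j" using y(1) by (simp add: K_def)
      then have "\<not> N x $ j \<le> t" by (simp add: Nx)
      ultimately show "x \<in> K S t - K (insert j S) t" by (simp add: K_def)
    next
      fix x assume x: "x \<in> K S t - K (insert j S) t"
      then have xj: "N x $ j > t" by (auto simp: K_def)
      have Nx: "N (x - p) $ i = N x $ i - (if i = j then t else 0)" for i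
        by (simp add: linear_diff[OF linear_N] Np axis_def)
      have "x - p \<in> K S t" using x xj insert.hyps(2) by (auto simp: K_def Nx)
      then show "x \<in> ?K'" by (intro image_eqI[of _ _ "x - p"]) auto
    qed
    have K's: "?K' \<in> sets lebesgue" unfolding K'e using Ks by auto
    have K'i: "set_integrable lebesgue ?K' cexp"
      by (rule set_integrable_subset[OF Ki[of S t] K's]) (unfold K'e, blast)
    have "(LINT y:?K'|lebesgue. cexp y) = (LINT y:K S t|lebesgue. cexp p * cexp y)"
      using set_integral_translate_scale[OF _ K'i] by (simp add: cexp_add)
    also have "\<dots> = 0" using insert.IH by simp
    finally have K'0: "(LINT y:?K'|lebesgue. cexp y) = 0" .
    have un: "K S t = K (insert j S) t \<union> ?K'" unfolding K'e by (auto simp: K_def)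
    have "(LINT y:K S t|lebesgue. cexp y) = (LINT y:K (insert j S) t|lebesgue. cexp y) + (LINT y:?K'|lebesgue. cexp y)"
    proof -
      have "(LINT y:K (insert j S) t \<union> ?K'|lebesgue. cexp y) = (LINT y:K (insert j S) t|lebesgue. cexp y) + (LINT y:?K'|lebesgue. cexp y)"
        by (rule set_integral_Un[OF _ Ki K'i]) (unfold K'e, blast)
      then show ?thesis using un by simp
    qed
    then show ?case using insert.IH K'0 by simp
  qed
  obtain M where M: "M > 0" "\<And>y. norm (T y) \<le> M * norm y"
    using linear_bounded_pos[OF linear_T] by blast
  have "isCont cexp 0"
    using smooth_differentiable[OF smooth_cexp] differentiable_imp_continuous_within by blast
  moreover have "cexp 0 = 1" by (simp add: cexp_def flip: zero_complex.code)
  ultimately have "\<exists>d>0. \<forall>y. norm (y - 0) < d \<longrightarrow> norm (cexp y - 1) < 1/2"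
    unfolding continuous_at_eps_delta dist_norm by (metis half_gt_zero_iff zero_less_one)
  then obtain d where d: "d > 0" "\<And>y. norm y < d \<Longrightarrow> cmod (cexp y - 1) < 1/2" by auto
  \<comment> \<open>Chosen so that \<open>M * n * t = d / 2\<close>, which puts the parallelepiped
    into the ball of radius \<open>d\<close>, where \<open>cexp\<close> differs from
    \<open>1\<close> by less than \<open>1/2\<close>.\<close>
  define t where "t = d / (2 * M * real CARD('n))"
  have t: "t > 0" using d M by (simp add: t_def)
  let ?K = "K UNIV t"
  have Kd: "norm y < d" if "y \<in> ?K" for y
  proof -
    have "norm (N y) \<le> (\<Sum>i\<in>UNIV. \<bar>N y $ i\<bar>)" by (rule norm_le_l1_cart)
    also have "\<dots> \<le> (\<Sum>i\<in>(UNIV::'n set). t)" using that by (intro sum_mono) (auto simp: K_def less_imp_le)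
    finally have "norm (N y) \<le> real CARD('n) * t" by simp
    then have "M * norm (N y) \<le> M * (real CARD('n) * t)" using M by (intro mult_left_mono) auto
    also have "\<dots> = d / 2" using M by (simp add: t_def)
    finally show ?thesis using M(2)[of "N y"] d by (simp add: TN)
  qed
  have Kb: "bounded ?K" using Kd by (auto simp: bounded_iff intro: less_imp_le)
  define B where "B = {y. (\<forall>i. 0 < N y $ i \<and> N y $ i < t)}"
  have B: "open B" "bounded B" "B \<noteq> {}" "B \<subseteq> ?K"
  proof -
    have "B = (\<Inter>i\<in>UNIV. {y. 0 < N y $ i} \<inter> {y. N y $ i < t})" by (auto simp: B_def)
    then show "open B" by (auto intro!: open_INT open_Int open_Collect_less continuous_intros continuous_N)
    show BK: "B \<subseteq> ?K" by (auto simp: B_def K_def less_imp_le)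
    show "bounded B" using Kb BK bounded_subset by blast
    have "T (\<chi> i. t / 2) \<in> B" using t by (simp add: B_def NT)
    then show "B \<noteq> {}" by blast
  qed
  have "measure lebesgue B \<le> measure lebesgue ?K"
    using B Kb Ks by (intro measure_mono_fmeasurable bounded_set_imp_lmeasurable) auto
  then have mK: "measure lebesgue ?K > 0" using measure_open_pos[OF B(1-3)] by linarith
  have ci: "set_integrable lebesgue ?K (\<lambda>x. c::complex)" for c
    using Kb Ks by (intro continuous_set_integrable) auto
  have "measure lebesgue ?K = cmod (LINT y:?K|lebesgue. 1)"
  proof -
    have "(LINT y:?K|lebesgue. complex_of_real 1) = of_real (LINT y:?K|lebesgue. 1)"
      by (rule set_integral_complex_of_real)
    then show ?thesis using set_integral_const_eq[OF Kb Ks, of 1] by simp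
  qed
  also have "\<dots> = cmod (LINT y:?K|lebesgue. cexp y - 1)"
    using set_integral_diff(2)[OF Ki ci, of 1] K0[OF t, of UNIV] by (simp add: norm_minus_commute)
  also have "\<dots> \<le> (LINT y:?K|lebesgue. cmod (cexp y - 1))"
    by (rule set_integral_norm_bound[OF set_integral_diff(1)[OF Ki ci]])
  also have "\<dots> \<le> (LINT y:?K|lebesgue. 1/2)"
    unfolding set_lebesgue_integral_def
  proof (rule integral_mono)
    show "integrable lebesgue (\<lambda>y. indicat_real ?K y *\<^sub>R cmod (cexp y - 1))"
      using set_integrable_norm[OF set_integral_diff(1)[OF Ki ci]] by (simp add: set_integrable_def)
    have "set_integrable lebesgue ?K (\<lambda>x. 1/2::real)" using Kb Ks by (intro continuous_set_integrable) auto
    then show "integrable lebesgue (\<lambda>y. indicat_real ?K y *\<^sub>R (1/2::real))" by (simp add: set_integrable_def)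
    show "indicat_real ?K y *\<^sub>R cmod (cexp y - 1) \<le> indicat_real ?K y *\<^sub>R (1/2)" for y
      using d(2)[OF Kd[of y]] by (auto simp: indicator_def)
  qed
  also have "\<dots> = measure lebesgue ?K / 2" using set_integral_const_eq[OF Kb Ks, of "1/2"] by simp
  finally show False using mK by simp
qed

text \<open>Blowing \<open>\<Omega>\<close> up by the factor \<open>m\<close> about
  \<open>xc\<close> gives sets \<open>Q m\<close> inside the cone that eventually contain each of
  its points, and \<open>cexp\<close> is integrable over the cone.\<close>

lemma integral_cexp_tendsto:
  assumes \<Omega>: "open \<Omega>" "bounded \<Omega>"
  shows "(\<lambda>m. real m ^ CARD('n) *\<^sub>R (LINT x:\<Omega>|lebesgue. cexp (real m *\<^sub>R (x - xc)))) \<longlonglongrightarrow> (LINT y:cone|lebesgue. cexp y)"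
proof -
  define Q where "Q m = {y. xc + (1 / real m) *\<^sub>R y \<in> \<Omega>}" for m :: nat
  have Qc: "Q m \<subseteq> cone" if "m > 0" for m
  proof
    fix y assume "y \<in> Q m"
    from \<Omega>_cone[OF this[unfolded Q_def, simplified]] show "y \<in> cone"
      using that by (simp add: cone_def linear_scale[OF linear_N] zero_less_divide_iff)
  qed
  have Qs: "Q m \<in> sets lebesgue" for m
  proof -
    have "open ((\<lambda>y. xc + (1 / real m) *\<^sub>R y) -` \<Omega>)"
      by (intro open_vimage \<Omega> continuous_intros)
    moreover have "(\<lambda>y. xc + (1 / real m) *\<^sub>R y) -` \<Omega> = Q m" by (auto simp: Q_def)
    ultimately show ?thesis by auto
  qed
  have "(\<lambda>m. \<integral>y. indicat_real (Q m) y *\<^sub>R cexp y \<partial>lebesgue) \<longlonglongrightarrow> (\<integral>y. indicat_real cone y *\<^sub>R cexp y \<partial>lebesgue)"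
  \<comment> \<open>The index is shifted by one because \<open>Qc\<close> is available for positive
    \<open>m\<close>, where the division by \<open>real m\<close> has its usual meaning.\<close>
  proof (rule LIMSEQ_offset[of _ 1], rule integral_dominated_convergence[where w="\<lambda>y. cmod (indicat_real cone y *\<^sub>R cexp y)"])
    show "(\<lambda>y. indicat_real cone y *\<^sub>R cexp y) \<in> borel_measurable lebesgue"
      using cexp_integrable_cone by (auto simp: set_integrable_def)
    show "(\<lambda>y. indicat_real (Q (m + 1)) y *\<^sub>R cexp y) \<in> borel_measurable lebesgue" for m
      using Qs cexp_measurable by (intro borel_measurable_scaleR borel_measurable_indicator)
    show "integrable lebesgue (\<lambda>y. cmod (indicat_real cone y *\<^sub>R cexp y))"
      using cexp_integrable_cone by (intro integrable_norm) (simp add: set_integrable_def)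
    show "AE y in lebesgue. norm (indicat_real (Q (m + 1)) y *\<^sub>R cexp y) \<le> cmod (indicat_real cone y *\<^sub>R cexp y)" for m
      using Qc[of "m + 1"] by (auto simp: indicator_def)
    show "AE y in lebesgue. (\<lambda>m. indicat_real (Q (m + 1)) y *\<^sub>R cexp y) \<longlonglongrightarrow> indicat_real cone y *\<^sub>R cexp y"
    proof (rule AE_I2)
      fix y
      show "(\<lambda>m. indicat_real (Q (m + 1)) y *\<^sub>R cexp y) \<longlonglongrightarrow> indicat_real cone y *\<^sub>R cexp y"
      proof (cases "y \<in> cone")
        case False
        then have "y \<notin> Q (m + 1)" for m using Qc[of "m + 1"] by auto
        then show ?thesis using False by simp
      next
        case True
        obtain m0 where m0: "norm (N y) / \<epsilon> < real m0" using reals_Archimedean2 by blast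
        have "y \<in> Q (m + 1)" if "m \<ge> m0" for m
        proof -
          have "norm (N y) < real (m + 1) * \<epsilon>"
          proof -
            have "norm (N y) / \<epsilon> < real (m + 1)" using m0 that by simp
            then show ?thesis using \<epsilon>_pos by (simp only: pos_divide_less_eq)
          qed
          then have "N y $ i < real (m + 1) * \<epsilon>" for i
            using component_le_norm_cart[of "N y" i] by linarith
          then have "0 < N ((xc + (1 / real (m + 1)) *\<^sub>R y) - xc) $ i \<and> N ((xc + (1 / real (m + 1)) *\<^sub>R y) - xc) $ i < \<epsilon>" for i
            using True by (simp add: cone_def linear_scale[OF linear_N] divide_simps mult.commute)
          from box_\<Omega>[OF this] show ?thesis by (simp add: Q_def)
        qed
        then have "\<forall>\<^sub>F m in sequentially. indicat_real cone y *\<^sub>R cexp y = indicat_real (Q (m + 1)) y *\<^sub>R cexp y"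
          using True by (auto simp: eventually_sequentially intro!: exI[of _ m0])
        from Lim_transform_eventually[OF tendsto_const this] show ?thesis .
      qed
    qed
  qed
  moreover have "\<forall>\<^sub>F m in sequentially. (\<integral>y. indicat_real (Q m) y *\<^sub>R cexp y \<partial>lebesgue) = real m ^ CARD('n) *\<^sub>R (LINT x:\<Omega>|lebesgue. cexp (real m *\<^sub>R (x - xc)))"
    using eventually_gt_at_top[of 0]
  proof eventually_elim
    case (elim m)
    have im: "(\<lambda>y. xc + (1 / real m) *\<^sub>R y) ` Q m = \<Omega>"
    proof (intro equalityI subsetI)
      fix x assume "x \<in> \<Omega>"
      moreover have "x = xc + (1 / real m) *\<^sub>R (real m *\<^sub>R (x - xc))" using elim by simp
      ultimately show "x \<in> (\<lambda>y. xc + (1 / real m) *\<^sub>R y) ` Q m"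
        by (intro image_eqI[of _ _ "real m *\<^sub>R (x - xc)"]) (auto simp: Q_def)
    qed (auto simp: Q_def)
    have "set_integrable lebesgue ((\<lambda>y. xc + (1 / real m) *\<^sub>R y) ` Q m) (\<lambda>x. cexp (real m *\<^sub>R (x - xc)))"
      unfolding im using \<Omega> smooth_continuous_on[OF smooth_cexp, of UNIV]
      by (intro continuous_set_integrable) (auto intro!: continuous_on_compose2[of UNIV cexp] continuous_intros)
    from set_integral_translate_scale[OF _ this] elim
    have "(LINT x:\<Omega>|lebesgue. cexp (real m *\<^sub>R (x - xc))) = (1 / real m) ^ CARD('n) *\<^sub>R (LINT y:Q m|lebesgue. cexp y)"
      unfolding im by simp
    then show ?case using elim by (simp add: power_divide set_lebesgue_integral_def)
  qed
  ultimately show ?thesis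
    unfolding set_lebesgue_integral_def[of _ cone] by (rule Lim_transform_eventually)
qed

text \<open>The Laplacian multiplies the exponential by \<open>s\<^sup>2\<close> times the sum of
  the squares of the entries of \<open>a + \<i> b\<close>, whose real part is
  \<open>a \<bullet> a - b \<bullet> b\<close> and whose imaginary part is
  \<open>2 * (a \<bullet> b)\<close>.\<close>

lemma cexp_harmonic:
  "smooth (\<lambda>x. cexp (s *\<^sub>R x))" "laplacian (\<lambda>x. cexp (s *\<^sub>R x)) x = 0"
proof -
  have e: "cexp (s *\<^sub>R x) = exp (Complex ((s *\<^sub>R a) \<bullet> x) ((s *\<^sub>R b) \<bullet> x))" for x by (simp add: cexp_def)
  let ?h = "\<lambda>x. exp (Complex ((s *\<^sub>R a) \<bullet> x) ((s *\<^sub>R b) \<bullet> x))"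
  have sm: "smooth ?h" by (rule smooth_exp_ridge)
  then show "smooth (\<lambda>x. cexp (s *\<^sub>R x))" unfolding e .
  let ?z = "\<lambda>i. Complex ((s *\<^sub>R a) $ i) ((s *\<^sub>R b) $ i)"
  have 1: "pderiv_dir i ?h = (\<lambda>x. ?z i * ?h x)" for i by (rule ext) (rule pderiv_dir_exp_ridge)
  have 2: "pderiv_dir i (\<lambda>x. ?z i * ?h x) x = ?z i * (?z i * ?h x)" for i x
    using pderiv_dir_eq[OF has_derivative_mult_right[OF smooth_has_derivative[OF sm]], of i "?z i" x] fun_cong[OF 1, of i x]
    by (simp add: pderiv_dir_def)
  have "laplacian ?h x = (\<Sum>i\<in>UNIV. ?z i * ?z i) * ?h x"
    unfolding laplacian_def pderivs.simps 1 2 by (simp only: sum_distrib_right mult.assoc)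
  also have "(\<Sum>i\<in>UNIV. ?z i * ?z i) = 0"
  proof -
    have "Re (\<Sum>i\<in>UNIV. ?z i * ?z i) = s\<^sup>2 * (a \<bullet> a - b \<bullet> b)"
      by (simp add: inner_vec_def sum_distrib_left sum_subtractf power2_eq_square algebra_simps)
    moreover have "Im (\<Sum>i\<in>UNIV. ?z i * ?z i) = 2 * s\<^sup>2 * (a \<bullet> b)"
      by (simp add: inner_vec_def sum_distrib_left power2_eq_square algebra_simps)
    moreover have "a \<bullet> a = b \<bullet> b" using norm_ab by (simp add: norm_eq)
    ultimately show ?thesis by (simp add: complex_eq_iff orth_ab)
  qed
  finally show "laplacian (\<lambda>x. cexp (s *\<^sub>R x)) x = 0" unfolding e by simp
qed

text \<open>The power \<open>real m ^ n\<close> compensates for the volume of the region of size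
  \<open>1 / m\<close> where the exponential lives: the constant \<open>c\<close> keeps a limit,
  while the deviation \<open>F - c\<close> is small in the mean there and contributes
  nothing.\<close>

lemma orthogonal_harmonic_limit_eq_0:
  assumes \<Omega>: "open \<Omega>" "bounded \<Omega>" and F: "set_integrable lebesgue \<Omega> F"
    and orth: "\<And>h. smooth h \<Longrightarrow> (\<And>x. laplacian h x = 0) \<Longrightarrow> (LINT x:\<Omega>|lebesgue. F x * h x) = 0"
    and lim: "((\<lambda>r. (LINT x:(ball xc r \<inter> \<Omega>)|lebesgue. cmod (F x - c)) / r ^ CARD('n)) \<longlongrightarrow> 0) (at_right 0)"
  shows "c = 0"
proof -
  have \<Omega>s: "\<Omega> \<in> sets lebesgue" using \<Omega> by auto
  let ?h = "\<lambda>m x. cexp (real m *\<^sub>R (x - xc))"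
  have ci: "set_integrable lebesgue \<Omega> (\<lambda>x. c)" using \<Omega> by (intro continuous_set_integrable) auto
  have Fc: "set_integrable lebesgue \<Omega> (\<lambda>x. F x - c)" by (rule set_integral_diff(1)[OF F ci])
  \<comment> \<open>Recentring at \<open>xc\<close> only multiplies the harmonic exponential by a
    constant, which comes out of the integral before \<open>orth\<close> is applied.\<close>
  have he: "?h m x = cexp (- (real m *\<^sub>R xc)) * cexp (real m *\<^sub>R x)" for m :: nat and x
    by (simp add: cexp_add[symmetric] scaleR_right_diff_distrib)
  have hs: "smooth (?h m)" for m
    unfolding he by (intro smooth_mult smooth_const cexp_harmonic)
  have F0: "(LINT x:\<Omega>|lebesgue. F x * ?h m x) = 0" for m
  proof -
    have "(LINT x:\<Omega>|lebesgue. F x * ?h m x) = (LINT x:\<Omega>|lebesgue. cexp (- (real m *\<^sub>R xc)) * (F x * cexp (real m *\<^sub>R x)))"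
      unfolding he by (simp only: mult_ac)
    also have "\<dots> = cexp (- (real m *\<^sub>R xc)) * (LINT x:\<Omega>|lebesgue. F x * cexp (real m *\<^sub>R x))" by simp
    finally show ?thesis using orth[OF cexp_harmonic(1,2)] by simp
  qed
  obtain \<delta> where \<delta>: "\<delta> > 0" "\<And>y. (\<forall>i. 0 \<le> N y $ i) \<Longrightarrow> a \<bullet> y \<le> - \<delta> * norm y" using cone_decay by blast
  have hb: "cmod (?h m x) \<le> exp (- \<delta> * (real m * norm (x - xc)))" if "x \<in> \<Omega>" for m x
  proof -
    have "\<forall>i. 0 \<le> N (real m *\<^sub>R (x - xc)) $ i"
      using \<Omega>_cone[OF that] by (auto simp: linear_scale[OF linear_N] less_imp_le)
    from \<delta>(2)[OF this] show ?thesis by (simp add: norm_cexp)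
  qed
  have S1: "(\<lambda>m. real m ^ CARD('n) * (LINT x:\<Omega>|lebesgue. cmod (F x - c) * exp (- \<delta> * (real m * norm (x - xc))))) \<longlonglongrightarrow> 0"
    by (rule exp_weighted_integral_tendsto_0[OF \<Omega>(2) \<Omega>s set_integrable_norm[OF Fc] _ lim \<delta>(1)]) auto
  have "(\<lambda>m. real m ^ CARD('n) *\<^sub>R (LINT x:\<Omega>|lebesgue. (F x - c) * ?h m x)) \<longlonglongrightarrow> 0"
  proof (rule Lim_null_comparison[OF always_eventually S1], rule allI)
    fix m
    have "cmod (LINT x:\<Omega>|lebesgue. (F x - c) * ?h m x) \<le> (LINT x:\<Omega>|lebesgue. cmod ((F x - c) * ?h m x))"
      by (rule set_integral_norm_bound[OF set_integrable_mult_smooth[OF Fc hs \<Omega>(2)]])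
    also have "\<dots> \<le> (LINT x:\<Omega>|lebesgue. cmod (F x - c) * exp (- \<delta> * (real m * norm (x - xc))))"
      unfolding set_lebesgue_integral_def
    proof (rule integral_mono)
      show "integrable lebesgue (\<lambda>x. indicat_real \<Omega> x *\<^sub>R cmod ((F x - c) * ?h m x))"
        using set_integrable_norm[OF set_integrable_mult_smooth[OF Fc hs \<Omega>(2)]] by (simp add: set_integrable_def)
      show "integrable lebesgue (\<lambda>x. indicat_real \<Omega> x *\<^sub>R (cmod (F x - c) * exp (- \<delta> * (real m * norm (x - xc)))))"
        using set_integrable_mult_exp_neg[OF set_integrable_norm[OF Fc], of "\<delta> * real m" xc] \<delta>(1)
        by (simp add: set_integrable_def mult.assoc)
      show "indicat_real \<Omega> x *\<^sub>R cmod ((F x - c) * ?h m x) \<le> indicat_real \<Omega> x *\<^sub>R (cmod (F x - c) * exp (- \<delta> * (real m * norm (x - xc))))" for x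
        using mult_left_mono[OF hb[of x m], of "cmod (F x - c)"] by (auto simp: indicator_def norm_mult)
    qed
    finally have "cmod (LINT x:\<Omega>|lebesgue. (F x - c) * ?h m x) \<le> (LINT x:\<Omega>|lebesgue. cmod (F x - c) * exp (- \<delta> * (real m * norm (x - xc))))" .
    then show "norm (real m ^ CARD('n) *\<^sub>R (LINT x:\<Omega>|lebesgue. (F x - c) * ?h m x)) \<le> real m ^ CARD('n) * (LINT x:\<Omega>|lebesgue. cmod (F x - c) * exp (- \<delta> * (real m * norm (x - xc))))"
      by (simp add: mult_left_mono)
  qed
  moreover have "(LINT x:\<Omega>|lebesgue. (F x - c) * ?h m x) = - (c * (LINT x:\<Omega>|lebesgue. ?h m x))" for m
    unfolding left_diff_distrib set_integral_diff(2)[OF set_integrable_mult_smooth[OF F hs \<Omega>(2)] set_integrable_mult_smooth[OF ci hs \<Omega>(2)]] F0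
    by simp
  ultimately have "(\<lambda>m. - (c * (real m ^ CARD('n) *\<^sub>R (LINT x:\<Omega>|lebesgue. ?h m x)))) \<longlonglongrightarrow> 0"
    by simp
  moreover have "(\<lambda>m. - (c * (real m ^ CARD('n) *\<^sub>R (LINT x:\<Omega>|lebesgue. ?h m x)))) \<longlonglongrightarrow> - (c * (LINT y:cone|lebesgue. cexp y))"
    by (intro tendsto_intros integral_cexp_tendsto \<Omega>)
  ultimately have "- (c * (LINT y:cone|lebesgue. cexp y)) = 0" using LIMSEQ_unique by blast
  then show ?thesis using integral_cexp_cone_neq_0 by simp
qed

end

section \<open>Means at a vertex\<close>

lemma sobolev_subset:
  assumes f: "f \<in> sobolev m U" and V: "V \<subseteq> U" "open V"
  shows "f \<in> sobolev m V"
proof -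
  have Vs: "V \<in> sets lebesgue" using V by auto
  have "\<exists>g\<in>L2_on V. has_weak_pderivs V is f g" if "length is \<le> m" for "is"
    using f that L2_on_subset[OF _ V(1) Vs] has_weak_pderivs_subset[OF _ V(1)] unfolding sobolev_def by blast
  then show ?thesis using f L2_on_subset[OF _ V(1) Vs] by (auto simp: sobolev_def)
qed

section \<open>Parallelepipeds at the corner\<close>

context simplicial_corner
begin

text \<open>\<open>sobolev2_mean_limit\<close> works with dilates of one fixed convex set, whose
  closure contains the centre. The parallelepipeds spanned by the edges provide such sets inside
  \<open>\<Omega>\<close>.\<close>

definition parallelepiped where "parallelepiped \<eta> = {x. \<forall>i. 0 < N x $ i \<and> N x $ i < \<eta>}"

lemma parallelepiped_props:
  assumes \<eta>: "\<eta> > 0"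
  shows "open (parallelepiped \<eta>)" "convex (parallelepiped \<eta>)" "bounded (parallelepiped \<eta>)" "parallelepiped \<eta> \<noteq> {}"
    "0 \<in> closure (parallelepiped \<eta>)"
proof -
  have "parallelepiped \<eta> = (\<Inter>i\<in>UNIV. {y. 0 < N y $ i} \<inter> {y. N y $ i < \<eta>})" by (auto simp: parallelepiped_def)
  then show "open (parallelepiped \<eta>)"
    by (auto intro!: open_INT open_Int open_Collect_less continuous_intros continuous_N)
  have im: "parallelepiped \<eta> = T ` box 0 (\<chi> i. \<eta>)"
  proof (intro equalityI subsetI)
    fix x assume "x \<in> parallelepiped \<eta>"
    then have "N x \<in> box 0 (\<chi> i. \<eta>)" by (simp add: parallelepiped_def mem_box_cart)
    then show "x \<in> T ` box 0 (\<chi> i. \<eta>)" using TN by (metis imageI)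
  qed (auto simp: parallelepiped_def NT mem_box_cart)
  show "convex (parallelepiped \<eta>)" unfolding im by (intro convex_linear_image linear_T convex_box)
  show "bounded (parallelepiped \<eta>)" unfolding im
    using linear_T by (intro bounded_linear_image) (auto simp: linear_conv_bounded_linear)
  have x0: "T (\<chi> i. \<eta> / 2) \<in> parallelepiped \<eta>" using \<eta> by (simp add: parallelepiped_def NT)
  then show "parallelepiped \<eta> \<noteq> {}" by blast
  show "0 \<in> closure (parallelepiped \<eta>)"
    unfolding closure_approachable
  proof (intro allI impI)
    fix e :: real assume e: "e > 0"
    let ?x = "T (\<chi> i. \<eta> / 2)"
    define s where "s = min 1 (e / (2 * (norm ?x + 1)))"
    have s: "0 < s" "s \<le> 1" "s \<le> e / (2 * (norm ?x + 1))" using e by (auto simp: s_def add_nonneg_pos)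
    have "s *\<^sub>R ?x \<in> parallelepiped \<eta>"
    proof -
      have "s * \<eta> \<le> 1 * \<eta>" using s \<eta> by (intro mult_right_mono) auto
      then have "s * \<eta> / 2 < \<eta>" using \<eta> by linarith
      then show ?thesis using s \<eta> by (simp add: parallelepiped_def linear_scale[OF linear_N] NT)
    qed
    moreover have "dist (s *\<^sub>R ?x) 0 < e"
    proof -
      have "s * norm ?x \<le> e / (2 * (norm ?x + 1)) * (norm ?x + 1)" using s e by (intro mult_mono) auto
      also have "\<dots> = e / 2"
      proof -
        have "e / (2 * A) * A = e / 2" if "A \<noteq> 0" for A :: real using that by simp
        moreover have "norm ?x + 1 \<noteq> 0" using norm_ge_zero[of ?x] by linarith
        ultimately show ?thesis by blast
      qed
      finally show ?thesis using s e by simp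
    qed
    ultimately show "\<exists>y\<in>parallelepiped \<eta>. dist y 0 < e" by blast
  qed
qed

lemma parallelepiped_norm_bound: "\<exists>M>0. \<forall>\<eta>>0. \<forall>x\<in>parallelepiped \<eta>. norm x \<le> M * \<eta>"
proof -
  obtain M where M: "M > 0" "\<And>y. norm (T y) \<le> M * norm y" using linear_bounded_pos[OF linear_T] by blast
  have "norm x \<le> (M * real CARD('n)) * \<eta>" if "\<eta> > 0" "x \<in> parallelepiped \<eta>" for \<eta> x
  proof -
    have "norm (N x) \<le> (\<Sum>i\<in>UNIV. \<bar>N x $ i\<bar>)" by (rule norm_le_l1_cart)
    also have "\<dots> \<le> (\<Sum>i\<in>(UNIV::'n set). \<eta>)" using that by (intro sum_mono) (auto simp: parallelepiped_def less_imp_le)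
    finally have "M * norm (N x) \<le> M * (real CARD('n) * \<eta>)" using M by (intro mult_left_mono) auto
    then show ?thesis using M(2)[of "N x"] by (simp add: TN mult.assoc)
  qed
  then show ?thesis using M by (intro exI[of _ "M * real CARD('n)"]) auto
qed

lemma translate_parallelepiped_subset:
  assumes "0 < s" "s * \<eta> \<le> \<epsilon>"
  shows "(\<lambda>y. xc + s *\<^sub>R y) ` parallelepiped \<eta> \<subseteq> \<Omega>"
proof clarify
  fix y assume y: "y \<in> parallelepiped \<eta>"
  show "xc + s *\<^sub>R y \<in> \<Omega>"
  proof (rule box_\<Omega>)
    fix i
    have "0 < N y $ i" "N y $ i < \<eta>" using y by (auto simp: parallelepiped_def)
    then have "0 < s * N y $ i" "s * N y $ i < s * \<eta>" using assms(1) by auto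
    then show "0 < N (xc + s *\<^sub>R y - xc) $ i \<and> N (xc + s *\<^sub>R y - xc) $ i < \<epsilon>"
      using assms(2) by (simp add: linear_scale[OF linear_N])
  qed
qed

text \<open>The constant comes from dilates of a parallelepiped at the corner. For small
  \<open>r\<close>, \<open>ball xc r \<inter> \<Omega>\<close> is contained in the dilate by a fixed
  multiple \<open>\<kappa> r\<close>, so its integral is no larger, and the normalisation changes by
  the constant \<open>\<kappa> ^ n\<close>.\<close>

lemma vertex_mean_limit:
  assumes \<Omega>: "open \<Omega>" "bounded \<Omega>" and n3: "CARD('n) \<le> 3" and r0: "r0 > 0" and fL: "f \<in> L2_on \<Omega>"
    and f: "f \<in> sobolev 2 (ball xc r0 \<inter> \<Omega>)"
  shows "\<exists>c. ((\<lambda>r. (LINT x:(ball xc r \<inter> \<Omega>)|lebesgue. cmod (f x - c)) / r ^ CARD('n)) \<longlongrightarrow> 0) (at_right 0)"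
proof -
  obtain M where M: "M > 0" "\<And>\<eta> x. \<eta> > 0 \<Longrightarrow> x \<in> parallelepiped \<eta> \<Longrightarrow> norm x \<le> M * \<eta>"
    using parallelepiped_norm_bound by blast
  \<comment> \<open>Small enough for the parallelepiped at \<open>xc\<close> to lie in
    \<open>\<Omega>\<close>, because of \<open>\<epsilon>\<close>, and in the ball of radius
    \<open>r0\<close>, because of \<open>r0 / (2 * M)\<close>.\<close>
  define \<eta> where "\<eta> = min \<epsilon> (r0 / (2 * M))"
  have \<eta>: "\<eta> > 0" "\<eta> \<le> \<epsilon>" "M * \<eta> < r0"
  proof -
    show "\<eta> > 0" "\<eta> \<le> \<epsilon>" using \<epsilon>_pos r0 M by (auto simp: \<eta>_def)
    have "M * \<eta> \<le> M * (r0 / (2 * M))" using M by (intro mult_left_mono) (auto simp: \<eta>_def)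
    also have "\<dots> < r0" using M r0 by simp
    finally show "M * \<eta> < r0" .
  qed
  let ?Q = "parallelepiped \<eta>"
  note Q = parallelepiped_props[OF \<eta>(1)]
  have "(\<lambda>y. xc + y) ` ?Q \<subseteq> ball xc r0 \<inter> \<Omega>"
    using translate_parallelepiped_subset[of 1 \<eta>] \<eta> M(2)[OF \<eta>(1)] by (force simp: dist_norm)
  moreover have "open ((\<lambda>y. xc + y) ` ?Q)" using Q by (intro open_translation)
  ultimately have "f \<in> sobolev 2 ((\<lambda>y. xc + y) ` ?Q)" by (rule sobolev_subset[OF f])
  from sobolev2_mean_limit[OF Q n3 this] obtain c where
    c: "((\<lambda>r. (LINT x:(\<lambda>y. xc + r *\<^sub>R y) ` ?Q|lebesgue. cmod (f x - c)) / r ^ CARD('n)) \<longlongrightarrow> 0) (at_right 0)"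
    by blast
  obtain L where L: "L > 0" "\<And>x. norm (N x) \<le> L * norm x" using linear_bounded_pos[OF linear_N] by blast
  \<comment> \<open>As \<open>L\<close> bounds \<open>N\<close>, a point at distance less than
    \<open>r\<close> has coordinates below \<open>L * r = \<eta> * (\<kappa> * r)\<close>.\<close>
  define \<kappa> where "\<kappa> = L / \<eta>"
  have \<kappa>: "\<kappa> > 0" using L \<eta> by (simp add: \<kappa>_def)
  have \<Omega>s: "\<Omega> \<in> sets lebesgue" using \<Omega> by auto
  have fc: "set_integrable lebesgue \<Omega> (\<lambda>x. f x - c)"
    using \<Omega> by (intro set_integral_diff(1) L2_on_integrable[OF fL] continuous_set_integrable) auto
  have "filterlim (\<lambda>r. \<kappa> * r) (at_right 0) (at_right 0)"
    using \<kappa> by (auto simp: filterlim_at eventually_at_filter intro!: tendsto_eq_intros)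
  from filterlim_compose[OF c this] have
    "((\<lambda>r. \<kappa> ^ CARD('n) * ((LINT x:(\<lambda>y. xc + (\<kappa> * r) *\<^sub>R y) ` ?Q|lebesgue. cmod (f x - c)) / (\<kappa> * r) ^ CARD('n))) \<longlongrightarrow> \<kappa> ^ CARD('n) * 0) (at_right 0)"
    by (intro tendsto_mult tendsto_const)
  then have up: "((\<lambda>r. (LINT x:(\<lambda>y. xc + (\<kappa> * r) *\<^sub>R y) ` ?Q|lebesgue. cmod (f x - c)) / r ^ CARD('n)) \<longlongrightarrow> 0) (at_right 0)"
    using \<kappa> by (simp add: power_mult_distrib)
  have "((\<lambda>r. (LINT x:(ball xc r \<inter> \<Omega>)|lebesgue. cmod (f x - c)) / r ^ CARD('n)) \<longlongrightarrow> 0) (at_right 0)"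
  proof (rule tendsto_sandwich[OF _ _ tendsto_const up])
    show "\<forall>\<^sub>F r in at_right 0. 0 \<le> (LINT x:(ball xc r \<inter> \<Omega>)|lebesgue. cmod (f x - c)) / r ^ CARD('n)"
      unfolding eventually_at_right_field
      by (intro exI[of _ 1]) (auto intro!: divide_nonneg_nonneg set_integral_pointwise_nonneg)
    have "(LINT x:(ball xc r \<inter> \<Omega>)|lebesgue. cmod (f x - c)) / r ^ CARD('n)
        \<le> (LINT x:(\<lambda>y. xc + (\<kappa> * r) *\<^sub>R y) ` ?Q|lebesgue. cmod (f x - c)) / r ^ CARD('n)"
      if r: "0 < r" "r < 1 / \<kappa>" for r
    proof (intro divide_right_mono set_integral_subset_mono set_integrable_norm)
      have "\<kappa> * r \<le> 1" using r \<kappa> by (simp add: pos_less_divide_eq mult.commute)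
      then have "\<kappa> * r * \<eta> \<le> 1 * \<eta>" using \<eta> by (intro mult_right_mono) auto
      then have "\<kappa> * r * \<eta> \<le> \<epsilon>" using \<eta>(2) by linarith
      then have sub: "(\<lambda>y. xc + (\<kappa> * r) *\<^sub>R y) ` ?Q \<subseteq> \<Omega>"
        using \<eta>(2) \<kappa> r by (intro translate_parallelepiped_subset) auto
      have "open ((\<lambda>y. xc + (\<kappa> * r) *\<^sub>R y) ` ?Q)"
        using \<kappa> r Q by (intro open_translate_scale) auto
      then show "set_integrable lebesgue ((\<lambda>y. xc + (\<kappa> * r) *\<^sub>R y) ` ?Q) (\<lambda>x. f x - c)"
        by (intro set_integrable_subset[OF fc _ sub]) auto
      show "ball xc r \<inter> \<Omega> \<in> sets lebesgue" using \<Omega>s by auto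
      show "ball xc r \<inter> \<Omega> \<subseteq> (\<lambda>y. xc + (\<kappa> * r) *\<^sub>R y) ` ?Q"
      proof
        fix x assume x: "x \<in> ball xc r \<inter> \<Omega>"
        let ?y = "(1 / (\<kappa> * r)) *\<^sub>R (x - xc)"
        have "?y \<in> ?Q"
          unfolding parallelepiped_def
        proof (intro CollectI allI conjI)
          fix i
          have p: "0 < N (x - xc) $ i" using \<Omega>_cone x by auto
          then show "0 < N ?y $ i" using \<kappa> r by (simp add: linear_scale[OF linear_N])
          have "N (x - xc) $ i \<le> norm (N (x - xc))" using component_le_norm_cart[of "N (x - xc)" i] by linarith
          also have "\<dots> \<le> L * norm (x - xc)" by (rule L(2))
          also have "\<dots> < L * r" using x L by (simp add: dist_norm norm_minus_commute)
          also have "\<dots> = \<eta> * (\<kappa> * r)" using \<eta> by (simp add: \<kappa>_def)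
          finally show "N ?y $ i < \<eta>" using \<kappa> r by (simp add: linear_scale[OF linear_N] pos_divide_less_eq)
        qed
        moreover have "x = xc + (\<kappa> * r) *\<^sub>R ?y" using \<kappa> r by simp
        ultimately show "x \<in> (\<lambda>y. xc + (\<kappa> * r) *\<^sub>R y) ` ?Q" by (rule image_eqI[rotated])
      qed
    qed (use r in auto)
    then show "\<forall>\<^sub>F r in at_right 0. (LINT x:(ball xc r \<inter> \<Omega>)|lebesgue. cmod (f x - c)) / r ^ CARD('n)
        \<le> (LINT x:(\<lambda>y. xc + (\<kappa> * r) *\<^sub>R y) ` ?Q|lebesgue. cmod (f x - c)) / r ^ CARD('n)"
      unfolding eventually_at_right_field using \<kappa> by (intro exI[of _ "1 / \<kappa>"]) auto
  qed
  then show ?thesis by blast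
qed

text \<open>This passes from the normalisation by \<open>r ^ n\<close> to that by the measure. A
  copy of the parallelepiped shrunk by \<open>r / D\<close> fits into the ball; the factor
  \<open>2\<close> in \<open>D\<close> leaves room for the open ball.\<close>

lemma vertex_ball_measure_lower_bound:
  assumes \<Omega>: "open \<Omega>"
  shows "\<exists>\<kappa>>0. \<forall>\<^sub>F r in at_right 0. \<kappa> * r ^ CARD('n) \<le> measure lebesgue (ball xc r \<inter> \<Omega>)"
proof -
  obtain M where M: "M > 0" "\<And>\<eta> x. \<eta> > 0 \<Longrightarrow> x \<in> parallelepiped \<eta> \<Longrightarrow> norm x \<le> M * \<eta>"
    using parallelepiped_norm_bound by blast
  let ?Q = "parallelepiped \<epsilon>"
  note Q = parallelepiped_props[OF \<epsilon>_pos]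
  define D where "D = 2 * M * \<epsilon>"
  have D: "D > 0" using M \<epsilon>_pos by (simp add: D_def)
  have "measure lebesgue ?Q / D ^ CARD('n) * r ^ CARD('n) \<le> measure lebesgue (ball xc r \<inter> \<Omega>)"
    if r: "0 < r" "r < D" for r
  proof -
    have rD: "0 < r / D" "r / D \<le> 1" using r D by auto
    have "measure lebesgue ?Q / D ^ CARD('n) * r ^ CARD('n) = measure lebesgue ((\<lambda>y. xc + (r / D) *\<^sub>R y) ` ?Q)"
      using measure_translate_scale[OF Q(1,3) rD(1), of xc] by (simp add: power_divide)
    also have "\<dots> \<le> measure lebesgue (ball xc r \<inter> \<Omega>)"
    proof (rule measure_mono_fmeasurable)
      have "r / D * \<epsilon> \<le> 1 * \<epsilon>" using rD \<epsilon>_pos by (intro mult_right_mono) auto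
      then have 1: "(\<lambda>y. xc + (r / D) *\<^sub>R y) ` ?Q \<subseteq> \<Omega>" using rD by (intro translate_parallelepiped_subset) auto
      have 2: "(\<lambda>y. xc + (r / D) *\<^sub>R y) ` ?Q \<subseteq> ball xc r"
      proof clarify
        fix y assume "y \<in> ?Q"
        then have "r / D * norm y \<le> r / D * (M * \<epsilon>)" using M(2)[OF \<epsilon>_pos] rD by (intro mult_left_mono) auto
        also have "\<dots> < r" using r M \<epsilon>_pos by (simp add: D_def)
        finally show "xc + (r / D) *\<^sub>R y \<in> ball xc r" using rD by (simp add: dist_norm abs_of_pos del: abs_divide)
      qed
      show "(\<lambda>y. xc + (r / D) *\<^sub>R y) ` ?Q \<subseteq> ball xc r \<inter> \<Omega>" using 1 2 by blast
      have "open ((\<lambda>y. xc + (r / D) *\<^sub>R y) ` ?Q)"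
        using rD Q by (intro open_translate_scale) auto
      then show "(\<lambda>y. xc + (r / D) *\<^sub>R y) ` ?Q \<in> sets lebesgue" by auto
      show "ball xc r \<inter> \<Omega> \<in> lmeasurable" using \<Omega> by (intro bounded_set_imp_lmeasurable) auto
    qed
    finally show ?thesis .
  qed
  then have "\<forall>\<^sub>F r in at_right 0. measure lebesgue ?Q / D ^ CARD('n) * r ^ CARD('n) \<le> measure lebesgue (ball xc r \<inter> \<Omega>)"
    unfolding eventually_at_right_field using D by (intro exI[of _ D]) auto
  moreover have "measure lebesgue ?Q / D ^ CARD('n) > 0" using measure_open_pos[OF Q(1,3,4)] D by simp
  ultimately show ?thesis by blast
qed

end

section \<open>Elementary properties of polygons, cuboids and bounded potentials\<close>

lemma convex_polygon_props:
  fixes \<Omega> :: "(real^'n::finite) set"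
  assumes "convex_polygon \<Omega>"
  shows "open \<Omega>" "bounded \<Omega>" "convex \<Omega>"
proof -
  obtain P where P: "polytope P" "\<Omega> = interior P" using assms by (auto simp: convex_polygon_def)
  then show "open \<Omega>" "bounded \<Omega>" "convex \<Omega>"
    using polytope_imp_bounded[OF P(1)] polytope_imp_convex[OF P(1)]
    by (auto intro: bounded_interior convex_interior)
qed

lemma cuboid_props:
  fixes \<Omega> :: "(real^'n::finite) set"
  assumes "cuboid \<Omega>"
  shows "open \<Omega>" "bounded \<Omega>" "convex \<Omega>"
proof -
  obtain T :: "real^'n \<Rightarrow> real^'n" and c a b where T: "orthogonal_transformation T" "\<Omega> = (\<lambda>x. c + T x) ` box a b"
    using assms by (auto simp: cuboid_def)
  have im: "\<Omega> = (+) c ` (T ` box a b)" by (simp add: T(2) image_image)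
  have lin: "linear T" "surj T"
    using T(1) by (auto simp: orthogonal_transformation_linear orthogonal_transformation_surj)
  show "open \<Omega>" unfolding im
    by (intro open_translation open_surjective_linear_image lin open_box)
  show "bounded \<Omega>" unfolding im
    using lin(1) by (intro bounded_translation bounded_linear_image) (auto simp: linear_conv_bounded_linear)
  show "convex \<Omega>" unfolding im
    by (intro convex_translation convex_linear_image lin convex_box)
qed

lemma set_integrable_mult_essentially_bounded:
  fixes f V :: "real^'n::finite \<Rightarrow> complex"
  assumes f: "set_integrable lebesgue U f" and V: "essentially_bounded V"
  shows "set_integrable lebesgue U (\<lambda>x. V x * f x)"
proof -
  obtain C where Vm: "V \<in> borel_measurable lebesgue" and C: "AE x in lebesgue. cmod (V x) \<le> C"
    using V unfolding essentially_bounded_def by blast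
  have "integrable lebesgue (\<lambda>x. C *\<^sub>R (indicator U x *\<^sub>R f x))"
    using f unfolding set_integrable_def by (rule integrable_scaleR_right)
  then show ?thesis unfolding set_integrable_def
  proof (rule Bochner_Integration.integrable_bound)
    have "(\<lambda>x. V x * (indicat_real U x *\<^sub>R f x)) \<in> borel_measurable lebesgue"
      using f Vm unfolding set_integrable_def by (intro borel_measurable_times) auto
    then show "(\<lambda>x. indicat_real U x *\<^sub>R (V x * f x)) \<in> borel_measurable lebesgue" by simp
    show "AE x in lebesgue. norm (indicat_real U x *\<^sub>R (V x * f x)) \<le> norm (C *\<^sub>R (indicat_real U x *\<^sub>R f x))"
      using C
    proof eventually_elim
      case (elim x)
      have "cmod (V x) * cmod (f x) \<le> \<bar>C\<bar> * cmod (f x)" using elim by (intro mult_right_mono) auto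
      then show ?case by (auto simp: indicator_def norm_mult)
    qed
  qed
qed

theorem mainTheorem2:
  fixes \<Omega> :: "(real^'n::finite) set"
    and \<phi> V v w :: "real^'n \<Rightarrow> complex"
    and k r0 :: real
    and xc :: "real^'n"
  assumes dim: "CARD('n) \<in> {2, 3}"
    and adm: "qualitatively_admissible \<Omega> \<phi> V"
    and k: "k > 0"
    and vL2: "v \<in> L2_on \<Omega>"
    and wL2: "w \<in> L2_on \<Omega>"
    and v_eq: "weakly_solves \<Omega> (\<lambda>x. (complex_of_real k)\<^sup>2) v"
    and w_eq: "weakly_solves \<Omega> (\<lambda>x. (complex_of_real k)\<^sup>2 * (1 + V x)) w"
    and bdry: "(\<lambda>x. w x - v x) \<in> sobolev_0 2 \<Omega>"
    and v_norm: "L2_norm_on \<Omega> v = 1"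
    and xc: "vertex_of xc \<Omega>"
    and phi_xc: "\<phi> xc \<noteq> 0"
    and r0: "r0 > 0"
    and v_H2: "v \<in> sobolev 2 (ball xc r0 \<inter> \<Omega>)"
    and w_H2: "w \<in> sobolev 2 (ball xc r0 \<inter> \<Omega>)"
  shows "((\<lambda>r. (LINT x:(ball xc r \<inter> \<Omega>)|lebesgue. cmod (v x))
               / measure lebesgue (ball xc r \<inter> \<Omega>)) \<longlongrightarrow> 0) (at_right 0)"
  proof -
  have n3: "CARD('n) \<le> 3" using dim by auto
  have V: "essentially_bounded V" "V = (\<lambda>x. indicator \<Omega> x * \<phi> x)" and
    shape: "convex_polygon \<Omega> \<or> cuboid \<Omega>"
    using adm by (auto simp: qualitatively_admissible_def)
  have "(0::real) < 1/4" by simp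
  from less_trans[OF this] have "\<exists>\<alpha>>0. uniformly_holder \<alpha> \<phi>"
    using adm unfolding qualitatively_admissible_def by blast
  then obtain \<alpha> C where \<alpha>: "\<alpha> > 0" and C: "\<And>x y. cmod (\<phi> x - \<phi> y) \<le> C * dist x y powr \<alpha>"
    by (auto simp: uniformly_holder_def)
  have \<Omega>: "open \<Omega>" "bounded \<Omega>" "convex \<Omega>"
    using shape convex_polygon_props cuboid_props by blast+
  have \<Omega>s: "\<Omega> \<in> sets lebesgue" using \<Omega> by auto
  obtain T N \<epsilon> a b where "simplicial_corner \<Omega> xc T N \<epsilon> a b"
    using shape convex_polygon_corner[OF _ xc] cuboid_corner[OF _ xc] by blast
  then interpret simplicial_corner \<Omega> xc T N \<epsilon> a b .
  have xc_notin: "xc \<notin> \<Omega>"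
  proof
    assume "xc \<in> \<Omega>"
    from \<Omega>_cone[OF this] show False by (simp add: linear_0[OF linear_N])
  qed
  define u where "u = (\<lambda>x. w x - v x)"
  define K where "K = (complex_of_real k)\<^sup>2"
  define A where "A r = ball xc r \<inter> \<Omega>" for r
  have As: "A r \<in> sets lebesgue" "bounded (A r)" "A r \<subseteq> \<Omega>" for r
    using \<Omega>s \<Omega>(2) by (auto simp: A_def intro: bounded_subset)
  define I where "I f r = (LINT x:A r|lebesgue. cmod (f x)) / r ^ CARD('n)" for f :: "real^'n \<Rightarrow> complex" and r
  have vi: "set_integrable lebesgue \<Omega> v" and wi: "set_integrable lebesgue \<Omega> w"
    using L2_on_integrable[OF _ \<Omega>(2) \<Omega>s] vL2 wL2 by auto
  have ui: "set_integrable lebesgue \<Omega> u" unfolding u_def by (rule set_integral_diff(1)[OF wi vi])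
  have Vwi: "set_integrable lebesgue \<Omega> (\<lambda>x. V x * w x)"
    by (rule set_integrable_mult_essentially_bounded[OF wi V(1)])
  have ci: "set_integrable lebesgue \<Omega> (\<lambda>x. d::complex)" for d
    using \<Omega> by (intro continuous_set_integrable) auto
  have u0: "((\<lambda>r. I u r) \<longlongrightarrow> 0) (at_right 0)"
    unfolding I_def A_def
    by (rule sobolev_0_mean_limit[OF \<Omega> n3 _ xc_notin]) (use bdry in \<open>simp add: u_def\<close>)
  obtain cw where cw: "((\<lambda>r. I (\<lambda>x. w x - cw) r) \<longlongrightarrow> 0) (at_right 0)"
    using vertex_mean_limit[OF \<Omega>(1,2) n3 r0 wL2 w_H2] unfolding I_def A_def by blast
  \<comment> \<open>Subtracting the two equations gives
    \<open>\<Delta>u + K u + K V w = 0\<close>.\<close>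
  define F where "F x = - K * (u x + V x * w x)" for x
  have Fi: "set_integrable lebesgue \<Omega> F"
    unfolding F_def by (intro set_integrable_mult_right set_integral_add(1) ui Vwi)
  have Feq: "(LINT x:\<Omega>|lebesgue. u x * laplacian \<eta> x) = (LINT x:\<Omega>|lebesgue. F x * \<eta> x)"
    if \<eta>: "\<eta> \<in> test_functions \<Omega>" for \<eta>
  proof -
    note sm = test_functions_smooth[OF \<eta>]
    have lap: "smooth (laplacian \<eta>)"
      unfolding laplacian_def by (intro smooth_sum smooth_pderivs[OF sm])
    note il = set_integrable_mult_smooth[OF _ lap \<Omega>(2)] and ie = set_integrable_mult_smooth[OF _ sm \<Omega>(2)]
    have W: "(LINT x:\<Omega>|lebesgue. w x * laplacian \<eta> x) + K * (LINT x:\<Omega>|lebesgue. w x * \<eta> x) + K * (LINT x:\<Omega>|lebesgue. V x * w x * \<eta> x) = 0"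
    proof -
      have "(LINT x:\<Omega>|lebesgue. w x * (laplacian \<eta> x + K * (1 + V x) * \<eta> x)) = 0"
        using w_eq \<eta> unfolding weakly_solves_def K_def by blast
      moreover have "w x * (laplacian \<eta> x + K * (1 + V x) * \<eta> x) = w x * laplacian \<eta> x + K * (w x * \<eta> x) + K * (V x * w x * \<eta> x)" for x
        by (simp add: algebra_simps)
      moreover have "(LINT x:\<Omega>|lebesgue. w x * laplacian \<eta> x + K * (w x * \<eta> x) + K * (V x * w x * \<eta> x))
          = (LINT x:\<Omega>|lebesgue. w x * laplacian \<eta> x) + (LINT x:\<Omega>|lebesgue. K * (w x * \<eta> x)) + (LINT x:\<Omega>|lebesgue. K * (V x * w x * \<eta> x))"
        by (subst set_integral_add(2) set_integral_add(2), (intro set_integral_add(1) set_integrable_mult_right il[OF wi] ie[OF wi] ie[OF Vwi])+)+ simp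
      ultimately show ?thesis by simp
    qed
    have E: "(LINT x:\<Omega>|lebesgue. v x * laplacian \<eta> x) + K * (LINT x:\<Omega>|lebesgue. v x * \<eta> x) = 0"
    proof -
      have "(LINT x:\<Omega>|lebesgue. v x * (laplacian \<eta> x + K * \<eta> x)) = 0"
        using v_eq \<eta> unfolding weakly_solves_def K_def by blast
      moreover have "v x * (laplacian \<eta> x + K * \<eta> x) = v x * laplacian \<eta> x + K * (v x * \<eta> x)" for x
        by (simp add: algebra_simps)
      moreover have "(LINT x:\<Omega>|lebesgue. v x * laplacian \<eta> x + K * (v x * \<eta> x)) = (LINT x:\<Omega>|lebesgue. v x * laplacian \<eta> x) + (LINT x:\<Omega>|lebesgue. K * (v x * \<eta> x))"
        by (intro set_integral_add(2) set_integrable_mult_right il[OF vi] ie[OF vi])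
      ultimately show ?thesis by simp
    qed
    have L: "(LINT x:\<Omega>|lebesgue. u x * laplacian \<eta> x) = (LINT x:\<Omega>|lebesgue. w x * laplacian \<eta> x) - (LINT x:\<Omega>|lebesgue. v x * laplacian \<eta> x)"
      unfolding u_def left_diff_distrib by (rule set_integral_diff(2)[OF il[OF wi] il[OF vi]])
    have U: "(LINT x:\<Omega>|lebesgue. u x * \<eta> x) = (LINT x:\<Omega>|lebesgue. w x * \<eta> x) - (LINT x:\<Omega>|lebesgue. v x * \<eta> x)"
      unfolding u_def left_diff_distrib by (rule set_integral_diff(2)[OF ie[OF wi] ie[OF vi]])
    have "(LINT x:\<Omega>|lebesgue. F x * \<eta> x) = (LINT x:\<Omega>|lebesgue. - K * (u x * \<eta> x + V x * w x * \<eta> x))"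
      by (simp add: F_def algebra_simps)
    also have "\<dots> = - K * ((LINT x:\<Omega>|lebesgue. u x * \<eta> x) + (LINT x:\<Omega>|lebesgue. V x * w x * \<eta> x))"
      unfolding set_integral_mult_right set_integral_add(2)[OF ie[OF ui] ie[OF Vwi]] ..
    finally show ?thesis
      unfolding L U eq_neg_iff_add_eq_0[THEN iffD2, OF W[unfolded add.assoc]] eq_neg_iff_add_eq_0[THEN iffD2, OF E]
      by (simp add: distrib_left right_diff_distrib)
  qed
  \<comment> \<open>The limit of \<open>F\<close> at \<open>xc\<close> in the mean: \<open>u\<close>
    has limit \<open>0\<close>, \<open>w\<close> has limit \<open>cw\<close>, and on
    \<open>\<Omega>\<close> the potential is \<open>\<phi>\<close>, which is continuous at
    \<open>xc\<close>.\<close>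
  define c0 where "c0 = - K * (\<phi> xc * cw)"
  define mB where "mB = measure lebesgue (ball (0::real^'n) 1)"
  have mA: "measure lebesgue (A r) \<le> r ^ CARD('n) * mB" if "r > 0" for r
  proof -
    have "measure lebesgue (A r) \<le> measure lebesgue (ball xc r)"
      using As by (intro measure_mono_fmeasurable) (auto simp: A_def)
    also have "\<dots> = r ^ CARD('n) * mB"
      using measure_translate_scale[of "ball (0::real^'n) 1" r xc] translate_scale_unit_ball[of r xc] that by (simp add: mB_def)
    finally show ?thesis .
  qed
  have F_lim: "((\<lambda>r. I (\<lambda>x. F x - c0) r) \<longlongrightarrow> 0) (at_right 0)"
  proof (rule tendsto_sandwich[OF _ _ tendsto_const])
    \<comment> \<open>A modulus of continuity of \<open>\<phi>\<close> at \<open>xc\<close>; the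
      absolute value is there because the Hoelder constant comes without a sign.\<close>
    let ?om = "\<lambda>r. \<bar>C\<bar> * r powr \<alpha>"
    let ?up = "\<lambda>r. cmod K * (I u r + (?om r + cmod (\<phi> xc)) * I (\<lambda>x. w x - cw) r + ?om r * cmod cw * mB)"
    have "((\<lambda>r::real. r powr \<alpha>) \<longlongrightarrow> 0) (at_right 0)"
      using \<alpha> by (intro tendsto_zero_powrI[OF tendsto_ident_at tendsto_const]) (auto simp: eventually_at_filter)
    then have "(?up \<longlongrightarrow> cmod K * (0 + (\<bar>C\<bar> * 0 + cmod (\<phi> xc)) * 0 + \<bar>C\<bar> * 0 * cmod cw * mB)) (at_right 0)"
      by (intro tendsto_intros u0 cw)
    then show "(?up \<longlongrightarrow> 0) (at_right 0)" by simp
    show "\<forall>\<^sub>F r in at_right 0. 0 \<le> I (\<lambda>x. F x - c0) r"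
      unfolding I_def eventually_at_right_field
      by (intro exI[of _ 1]) (auto intro!: divide_nonneg_nonneg set_integral_pointwise_nonneg)
    have "I (\<lambda>x. F x - c0) r \<le> ?up r" if r: "r > 0" for r
    proof -
      note sub = set_integrable_subset[OF _ As(1) As(3)]
      have i1: "set_integrable lebesgue (A r) (\<lambda>x. cmod (u x))" by (intro set_integrable_norm sub ui)
      have i2: "set_integrable lebesgue (A r) (\<lambda>x. (?om r + cmod (\<phi> xc)) * cmod (w x - cw))"
        by (intro set_integrable_mult_right set_integrable_norm sub[OF set_integral_diff(1)[OF wi ci]])
      have i3: "set_integrable lebesgue (A r) (\<lambda>x. ?om r * cmod cw)"
        using As by (intro continuous_set_integrable) auto
      have pt: "cmod (F x - c0) \<le> cmod K * (cmod (u x) + (?om r + cmod (\<phi> xc)) * cmod (w x - cw) + ?om r * cmod cw)"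
        if x: "x \<in> A r" for x
      proof -
        have o: "cmod (\<phi> x - \<phi> xc) \<le> ?om r"
        proof -
          have "cmod (\<phi> x - \<phi> xc) \<le> C * dist x xc powr \<alpha>" by (rule C)
          also have "\<dots> \<le> \<bar>C\<bar> * r powr \<alpha>"
            using x \<alpha> by (intro mult_mono powr_mono2) (auto simp: A_def dist_commute)
          finally show ?thesis .
        qed
        have Vx: "V x = \<phi> x" using x by (simp add: V(2) A_def)
        \<comment> \<open>The difference of \<open>V w\<close> and \<open>\<phi> xc * cw\<close> is
          split so that every summand contains \<open>w x - cw\<close> or
          \<open>\<phi> x - \<phi> xc\<close>, which are small in the mean and uniformly,
          respectively.\<close>
        have e: "F x - c0 = - K * (u x + ((\<phi> x - \<phi> xc) + \<phi> xc) * (w x - cw) + (\<phi> x - \<phi> xc) * cw)"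
          by (simp add: F_def c0_def Vx algebra_simps)
        have "cmod (u x + ((\<phi> x - \<phi> xc) + \<phi> xc) * (w x - cw) + (\<phi> x - \<phi> xc) * cw)
            \<le> cmod (u x) + (cmod (\<phi> x - \<phi> xc) + cmod (\<phi> xc)) * cmod (w x - cw) + cmod (\<phi> x - \<phi> xc) * cmod cw"
        proof -
          have "cmod (((\<phi> x - \<phi> xc) + \<phi> xc) * (w x - cw)) \<le> (cmod (\<phi> x - \<phi> xc) + cmod (\<phi> xc)) * cmod (w x - cw)"
            unfolding norm_mult by (intro mult_right_mono norm_triangle_ineq) auto
          moreover have "cmod ((\<phi> x - \<phi> xc) * cw) = cmod (\<phi> x - \<phi> xc) * cmod cw" by (rule norm_mult)
          ultimately show ?thesis by (intro norm_triangle_le add_mono) auto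
        qed
        also have "\<dots> \<le> cmod (u x) + (?om r + cmod (\<phi> xc)) * cmod (w x - cw) + ?om r * cmod cw"
          by (intro add_mono mult_right_mono o order_refl) auto
        finally show ?thesis unfolding e norm_mult norm_minus_cancel by (intro mult_left_mono) auto
      qed
      have "(LINT x:A r|lebesgue. cmod (F x - c0)) \<le> (LINT x:A r|lebesgue. cmod K * (cmod (u x) + (?om r + cmod (\<phi> xc)) * cmod (w x - cw) + ?om r * cmod cw))"
        by (rule set_integral_mono)
           (intro set_integrable_norm sub[OF set_integral_diff(1)[OF Fi ci]] set_integrable_mult_right set_integral_add(1) i1 i2 i3 pt, assumption?)+
      also have "\<dots> = cmod K * ((LINT x:A r|lebesgue. cmod (u x)) + (?om r + cmod (\<phi> xc)) * (LINT x:A r|lebesgue. cmod (w x - cw)) + ?om r * cmod cw * measure lebesgue (A r))"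
        unfolding set_integral_mult_right set_integral_add(2)[OF set_integral_add(1)[OF i1 i2] i3] set_integral_add(2)[OF i1 i2]
          set_integral_const_eq[OF As(2,1)] by (simp only: mult.assoc)
      also have "\<dots> \<le> cmod K * ((LINT x:A r|lebesgue. cmod (u x)) + (?om r + cmod (\<phi> xc)) * (LINT x:A r|lebesgue. cmod (w x - cw)) + ?om r * cmod cw * (r ^ CARD('n) * mB))"
        by (intro mult_left_mono add_mono order_refl mA r) auto
      also have "\<dots> = ?up r * r ^ CARD('n)"
      proof -
        have "A * (X + B * Y + D * (R * m)) = A * (X / R + B * (Y / R) + D * m) * R"
          if "R \<noteq> 0" for A B D X Y R m :: real
          using that by (simp add: field_simps)
        moreover have "r ^ CARD('n) \<noteq> 0" using r by simp
        ultimately show ?thesis unfolding I_def by blast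
      qed
      finally show ?thesis unfolding I_def[of "\<lambda>x. F x - c0"] by (subst pos_divide_le_eq) (use r in auto)
    qed
    then show "\<forall>\<^sub>F r in at_right 0. I (\<lambda>x. F x - c0) r \<le> ?up r"
      unfolding eventually_at_right_field by (intro exI[of _ 1]) auto
  qed
  have u_H20: "u \<in> sobolev_0 2 \<Omega>" using bdry by (simp add: u_def)
  have "(LINT x:\<Omega>|lebesgue. F x * h x) = 0" if "smooth h" "\<And>x. laplacian h x = 0" for h
    by (rule laplacian_orthogonal_harmonic[OF \<Omega>(1,2) u_H20 Fi Feq that])
  then have "c0 = 0"
    using F_lim unfolding I_def A_def by (rule orthogonal_harmonic_limit_eq_0[OF \<Omega>(1,2) Fi])
  \<comment> \<open>Here \<open>\<phi> xc \<noteq> 0\<close> enters, together with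
    \<open>K \<noteq> 0\<close>.\<close>
  then have cw0: "cw = 0" using phi_xc k by (simp add: c0_def K_def)
  obtain \<kappa> where \<kappa>: "\<kappa> > 0" "\<forall>\<^sub>F r in at_right 0. \<kappa> * r ^ CARD('n) \<le> measure lebesgue (A r)"
    using vertex_ball_measure_lower_bound[OF \<Omega>(1)] unfolding A_def by blast
  have "((\<lambda>r. (LINT x:A r|lebesgue. cmod (v x)) / measure lebesgue (A r)) \<longlongrightarrow> 0) (at_right 0)"
  proof (rule tendsto_sandwich[OF _ _ tendsto_const])
    \<comment> \<open>Since \<open>v = w - u\<close>, the two vanishing means control that of
      \<open>v\<close>; by the choice of \<open>\<kappa>\<close>, dividing by
      \<open>\<kappa> * r ^ n\<close> instead of the measure only enlarges the quotient.\<close>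
    have "((\<lambda>r. (I w r + I u r) / \<kappa>) \<longlongrightarrow> (0 + 0) / \<kappa>) (at_right 0)"
      using cw \<kappa>(1) unfolding cw0 by (intro tendsto_intros u0) auto
    then show "((\<lambda>r. (I w r + I u r) / \<kappa>) \<longlongrightarrow> 0) (at_right 0)" by simp
    show "\<forall>\<^sub>F r in at_right 0. 0 \<le> (LINT x:A r|lebesgue. cmod (v x)) / measure lebesgue (A r)"
      by (intro always_eventually allI divide_nonneg_nonneg set_integral_pointwise_nonneg) auto
    show "\<forall>\<^sub>F r in at_right 0. (LINT x:A r|lebesgue. cmod (v x)) / measure lebesgue (A r) \<le> (I w r + I u r) / \<kappa>"
      using \<kappa>(2) eventually_at_right_less[of "0::real"]
    proof eventually_elim
      case (elim r)
      note sub = set_integrable_subset[OF _ As(1) As(3)]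
      have pos: "\<kappa> * r ^ CARD('n) > 0" using \<kappa>(1) elim by simp
      have "(LINT x:A r|lebesgue. cmod (v x)) \<le> (LINT x:A r|lebesgue. cmod (w x) + cmod (u x))"
      proof (rule set_integral_mono)
        show "cmod (v x) \<le> cmod (w x) + cmod (u x)" for x
          using norm_triangle_ineq4[of "w x" "u x"] by (simp add: u_def)
      qed (intro set_integral_add(1) set_integrable_norm sub vi wi ui)+
      also have "\<dots> = (LINT x:A r|lebesgue. cmod (w x)) + (LINT x:A r|lebesgue. cmod (u x))"
        by (intro set_integral_add(2) set_integrable_norm sub wi ui)
      finally have 1: "(LINT x:A r|lebesgue. cmod (v x)) \<le> (I w r + I u r) * r ^ CARD('n)"
        using elim unfolding I_def by (simp add: add_divide_distrib[symmetric])
      have "(LINT x:A r|lebesgue. cmod (v x)) / measure lebesgue (A r) \<le> (LINT x:A r|lebesgue. cmod (v x)) / (\<kappa> * r ^ CARD('n))"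
      proof (rule divide_left_mono[OF elim(1)])
        have "measure lebesgue (A r) > 0" using pos elim(1) by linarith
        then show "0 < measure lebesgue (A r) * (\<kappa> * r ^ CARD('n))" using pos by (rule mult_pos_pos)
      qed (auto intro: set_integral_pointwise_nonneg)
      also have "\<dots> \<le> (I w r + I u r) * r ^ CARD('n) / (\<kappa> * r ^ CARD('n))"
        using pos by (intro divide_right_mono 1) auto
      also have "\<dots> = (I w r + I u r) / \<kappa>" using elim by simp
      finally show ?case .
    qed
  qed
  then show ?thesis by (simp add: A_def)
qed

end
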